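(* In the setting and with the notation of the context, let $V\subset U$ be a fixed sufficiently small neighborhood of $\widetilde\mu$, and define the Polyak step $$\mu^+:=\mu-\frac{\mathcal L(\mu,\pi)-\mathcal L(\theta^\star)}{\|\nabla_\mu\mathcal L(\mu,\pi)\|^2}\,\nabla_\mu\mathcal L(\mu,\pi).$$ For any sufficiently small $\tau>0$, there is a neighborhood $W\subset V$ of $\widetilde\mu$, a constant $C>0$ and a threshold $\kappa_0\ge1$ such that exactly one of the following holds for every $\kappa\ge\kappa_0$ and every $\mu\in W\cap\mathcal A_{\tau,\kappa}$ (provided $\Delta_\pi$ is sufficiently small): (i) either $\mu^+\in\mathcal C_\kappa$; or (ii) the following contraction holds: $$\|P_{\mathcal M}(\mu^+)-\widetilde\mu\|\le\Bigl(q+\frac C\kappa\Bigr)\|P_{\mathcal M}(\mu)-\widetilde\mu\|.$$ In particular, after enlarging $\kappa_0$ if necessary, $q+\frac C\kappa<1$.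
   Context: $\phi(x\mid\mu)=(2\pi)^{-d/2}e^{-\|x-\mu\|^2/2}$ on $\mathbb R^d$. Teacher: $p^\star=\sum_{\ell=1}^m\pi^\star_\ell\phi(\cdot\mid\mu^\star_\ell)$ with $\pi^\star$ in the probability simplex and positive, satisfying: (A1) $M^\star=\sum_{\ell}\pi^\star_\ell\mu_\ell^\star{\mu_\ell^\star}^{\top}$ has exactly $m$ nonzero eigenvalues, the largest being $\lambda_{\max}$ and the smallest $\lambda_{\min}>0$; (A2) $D_{\max}\ge\|\mu_\ell^\star\|\ge D_{\min}\ge 4\frac{\lambda_{\max}}{\lambda_{\min}}\sqrt{dn}$ for all $\ell$; (A3) with $\pi^\star_{\min}=\min_\ell\pi^\star_\ell$, $\min_{i\ne j}\|\mu_i^\star-\mu_j^\star\|\ge C_0\max\{\sqrt{D_{\max}}(dn)^{1/4},\sqrt{d/\pi^\star_{\min}},\sqrt{\log(D_{\max}dnm/(\lambda_{\min}\pi^\star_{\min}))}\}$ for a sufficiently large constant $C_0>0$. For $\mu=(\mu_1,\dots,\mu_n)\in\mathbb R^{dn}$ and $\pi\in\Delta^{n-1}$ (probability simplex): $p_{\mu,\pi}=\sum_{i=1}^n\pi_i\phi(\cdot\mid\mu_i)$ and $\mathcal L(\mu,\pi)=\mathbb E_{X\sim p^\star}[\log(p^\star(X)/p_{\mu,\pi}(X))]$; the optimal value of the loss is denoted $\mathcal L(\theta^\star)$ and equals $0$. Fix a partition $[n]=\bigsqcup_{\ell=1}^mS_\ell$ into nonempty sets, the point $\widetilde\mu\in\mathbb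 R^{dn}$ with $\widetilde\mu_i=\mu^\star_\ell$ for $i\in S_\ell$, and strictly positive student weights $\pi\in\Delta^{n-1}$. Put $\widehat\pi_\ell=\sum_{i\in S_\ell}\pi_i$, $\Delta_\pi=\max_\ell|\widehat\pi_\ell-\pi^\star_\ell|/\pi^\star_\ell$, and define the reference weights $\bar\pi_i=\pi_i\pi^\star_\ell/\widehat\pi_\ell$ for $i\in S_\ell$, so that $\sum_{i\in S_\ell}\bar\pi_i=\pi_\ell^\star$. $\mathcal M$ is the local $C^\infty$ Morse ravine (in the sense of Davis, Drusvyatskiy and Jiang) of the reference objective $f(\mu)=\mathcal L(\mu,\bar\pi)$ near its isolated minimizer $\widetilde\mu$: with $H=\nabla^2f(\widetilde\mu)$, it is the $C^\infty$ manifold, through $\widetilde\mu$ with tangent space $\ker H$ there, of points $\mu$ near $\widetilde\mu$ at which the orthogonal projection of $\nabla f(\mu)$ onto $\operatorname{range}H$ vanishes. $P_{\mathcal M}$ is the nearest-point projection (single-valued and smooth on a neighborhood $U$ of $\widetilde\mu$) and $\operatorname{dist}_{\mathcal M}(\mu)=\inf_{y\in\mathcal M}\|\mu-y\|$. With $\bar\mu_\ell=\frac1{\widehat\pi_\ell}\sum_{i\in S_\ell}\pi_i\mu_i$ let $\mathsf D(\mu)=\sum_{\ell}\sum_{i\in S_\ell}\pi_i\|\mu_i-\bar\mu_\ell\|^2$. For $\tau,\kappa>0$ and $y=P_{\mathcal M}(\mu)$: $\mathcal T_\tau=\{\mu:\operatorname{dist}_{\mathcal M}(\mu)\le\tau\mathsf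 D(y)^{3/2}\}$, $\mathcal C_\kappa=\{\mu:\mathsf D(y)\le\kappa\Delta_\pi^{2/3}\}$, $\mathcal A_{\tau,\kappa}=\mathcal T_\tau\setminus\mathcal C_\kappa$. The number $q\in(0,1)$ is the contraction factor of the Polyak step for the reference objective: writing $\mathcal L_T(\mu)=\mathcal L(P_{\mathcal M}(\mu),\bar\pi)$ and $\mathcal L_N(\mu)=\mathcal L(\mu,\bar\pi)-\mathcal L(P_{\mathcal M}(\mu),\bar\pi)$, after shrinking $U$ if necessary, every $\mu\in U$ with $\|\nabla\mathcal L_N(\mu)\|\le\frac1{100}\|\nabla\mathcal L_T(P_{\mathcal M}(\mu))\|$ satisfies $\|P_{\mathcal M}(\bar\mu^+)-\widetilde\mu\|\le q\|P_{\mathcal M}(\mu)-\widetilde\mu\|$, where $\bar\mu^+=\mu-\frac{\mathcal L(\mu,\bar\pi)}{\|\nabla_\mu\mathcal L(\mu,\bar\pi)\|^2}\nabla_\mu\mathcal L(\mu,\bar\pi)$.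
   Formalization: "Exactly one of the following holds" is proved as "(i) holds, or otherwise (ii) holds"; literal mutual exclusivity fails, since a point just outside C_κ can be contracted into C_κ, so that (i) and (ii) both hold. *)

theory Defs
  imports "HOL-Analysis.Analysis"
begin

section \<open>Smooth maps, gradients and submanifolds\<close>

text \<open>On an open set of a Euclidean space, continuity of all directional derivatives of order
  at most \<open>k\<close> is the usual notion of a \<open>k\<close> times continuously differentiable map.\<close>

primrec Ck_on :: "nat \<Rightarrow> 'a::real_normed_vector set \<Rightarrow> ('a \<Rightarrow> 'b::real_normed_vector) \<Rightarrow> bool" where
  "Ck_on 0 X f \<longleftrightarrow> continuous_on X f"
| "Ck_on (Suc k) X f \<longleftrightarrow> (\<forall>x\<in>X. f differentiable (at x)) \<and>
     (\<forall>v. Ck_on k X (\<lambda>x. frechet_derivative f (at x) v))"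

definition smooth_on :: "'a::real_normed_vector set \<Rightarrow> ('a \<Rightarrow> 'b::real_normed_vector) \<Rightarrow> bool" where
  "smooth_on X f \<longleftrightarrow> open X \<and> (\<forall>k. Ck_on k X f)"

definition grad :: "('a::real_inner \<Rightarrow> real) \<Rightarrow> 'a \<Rightarrow> 'a" where
  "grad f x = (THE D. GDERIV f x :> D)"

definition hessian :: "('a::real_inner \<Rightarrow> real) \<Rightarrow> 'a \<Rightarrow> 'a \<Rightarrow> 'a" where
  "hessian f x = frechet_derivative (grad f) (at x)"

definition orth_proj :: "'a::real_inner set \<Rightarrow> 'a \<Rightarrow> 'a" where
  "orth_proj T x = (THE p. p \<in> T \<and> (\<forall>t\<in>T. orthogonal (x - p) t))"

definition smooth_submanifold :: "'a::euclidean_space set \<Rightarrow> bool" where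
  "smooth_submanifold M \<longleftrightarrow>
     (\<forall>x\<in>M. \<exists>A B \<Phi> \<Psi> L. x \<in> A \<and> homeomorphism A B \<Phi> \<Psi> \<and> smooth_on A \<Phi> \<and> smooth_on B \<Psi> \<and>
        subspace (L :: 'a set) \<and> \<Phi> ` (A \<inter> M) = B \<inter> L)"

text \<open>Tangent vectors of \<open>M\<close> at \<open>x\<close> are the velocities of smooth curves in \<open>M\<close>.\<close>

definition tangent_space :: "'a::euclidean_space set \<Rightarrow> 'a \<Rightarrow> 'a set" where
  "tangent_space M x =
     {v. \<exists>(\<gamma> :: real \<Rightarrow> 'a) \<epsilon>. 0 < \<epsilon> \<and> smooth_on {-\<epsilon><..<\<epsilon>} \<gamma> \<and> \<gamma> ` {-\<epsilon><..<\<epsilon>} \<subseteq> M \<and>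
        \<gamma> 0 = x \<and> (\<gamma> has_vector_derivative v) (at 0)}"

text \<open>Since a ravine is a local object, any open neighbourhood \<open>N\<close> of the base point on which the
  zero set is a manifold is allowed.\<close>

definition morse_ravine :: "('a::euclidean_space \<Rightarrow> real) \<Rightarrow> 'a \<Rightarrow> 'a set \<Rightarrow> bool" where
  "morse_ravine f x\<^sub>0 M \<longleftrightarrow>
     (\<exists>N. open N \<and> x\<^sub>0 \<in> N \<and> M = {x \<in> N. orth_proj (range (hessian f x\<^sub>0)) (grad f x) = 0}) \<and>
     smooth_submanifold M \<and> x\<^sub>0 \<in> M \<and> tangent_space M x\<^sub>0 = {v. hessian f x\<^sub>0 v = 0}"

definition polyak_step :: "('a::real_inner \<Rightarrow> real) \<Rightarrow> real \<Rightarrow> 'a \<Rightarrow> 'a" where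
  "polyak_step f opt x = x - ((f x - opt) / (norm (grad f x))\<^sup>2) *\<^sub>R grad f x"


section \<open>Eigenvalues\<close>

definition eigenspace :: "real^'d^'d \<Rightarrow> real \<Rightarrow> (real^'d) set" where
  "eigenspace A c = {v. A *v v = c *\<^sub>R v}"

definition nonzero_eigenvalues :: "real^'d^'d \<Rightarrow> real set" where
  "nonzero_eigenvalues A = {c. c \<noteq> 0 \<and> (\<exists>v. v \<noteq> 0 \<and> v \<in> eigenspace A c)}"

text \<open>Eigenvalues are counted with multiplicity. The count is only used for symmetric matrices,
  for which geometric and algebraic multiplicities agree.\<close>

definition num_nonzero_eigenvalues :: "real^'d^'d \<Rightarrow> nat" where
  "num_nonzero_eigenvalues A = (\<Sum>c\<in>nonzero_eigenvalues A. dim (eigenspace A c))"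

definition second_moment :: "('m::finite \<Rightarrow> real) \<Rightarrow> ('m \<Rightarrow> real^'d) \<Rightarrow> real^'d^'d" where
  "second_moment p \<mu> = (\<chi> a b. \<Sum>l\<in>UNIV. p l * (\<mu> l $ a * \<mu> l $ b))"


section \<open>Gaussian mixtures and the population loss\<close>

definition prob_simplex :: "('k::finite \<Rightarrow> real) set" where
  "prob_simplex = {p. (\<forall>k. 0 \<le> p k) \<and> (\<Sum>k\<in>UNIV. p k) = 1}"

definition gauss :: "real^'d \<Rightarrow> real^'d \<Rightarrow> real" where
  "gauss \<mu> x = (2 * pi) powr (- real CARD('d) / 2) * exp (- (norm (x - \<mu>))\<^sup>2 / 2)"

definition mixture :: "('k::finite \<Rightarrow> real) \<Rightarrow> ('k \<Rightarrow> real^'d) \<Rightarrow> real^'d \<Rightarrow> real" where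
  "mixture p \<mu> x = (\<Sum>k\<in>UNIV. p k * gauss (\<mu> k) x)"

definition loss ::
  "('m::finite \<Rightarrow> real) \<Rightarrow> ('m \<Rightarrow> real^'d) \<Rightarrow> ('n::finite \<Rightarrow> real) \<Rightarrow> real^'d^'n \<Rightarrow> real" where
  "loss p\<^sub>s \<mu>\<^sub>s p \<mu> =
     (LINT x|density lborel (\<lambda>x. ennreal (mixture p\<^sub>s \<mu>\<^sub>s x)).
        ln (mixture p\<^sub>s \<mu>\<^sub>s x / mixture p (\<lambda>i. \<mu> $ i) x))"

definition opt_loss ::
  "'n::finite itself \<Rightarrow> ('m::finite \<Rightarrow> real) \<Rightarrow> ('m \<Rightarrow> real^'d) \<Rightarrow> real" where
  "opt_loss _ p\<^sub>s \<mu>\<^sub>s =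
     (INF (\<mu>, p)\<in>(UNIV :: (real^'d^'n) set) \<times> prob_simplex. loss p\<^sub>s \<mu>\<^sub>s p \<mu>)"


section \<open>Clusters of students\<close>

definition cluster_weight :: "('m \<Rightarrow> 'n set) \<Rightarrow> ('n \<Rightarrow> real) \<Rightarrow> 'm \<Rightarrow> real" where
  "cluster_weight S p l = (\<Sum>i\<in>S l. p i)"

definition weight_mismatch ::
  "('m::finite \<Rightarrow> 'n set) \<Rightarrow> ('m \<Rightarrow> real) \<Rightarrow> ('n \<Rightarrow> real) \<Rightarrow> real" where
  "weight_mismatch S p\<^sub>s p = (MAX l. \<bar>cluster_weight S p l - p\<^sub>s l\<bar> / p\<^sub>s l)"

definition is_reference_weights ::
  "('m \<Rightarrow> 'n set) \<Rightarrow> ('m \<Rightarrow> real) \<Rightarrow> ('n \<Rightarrow> real) \<Rightarrow> ('n \<Rightarrow> real) \<Rightarrow> bool" where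
  "is_reference_weights S p\<^sub>s p w \<longleftrightarrow> (\<forall>l. \<forall>i\<in>S l. w i = p i * p\<^sub>s l / cluster_weight S p l)"

definition barycenter :: "('m \<Rightarrow> 'n set) \<Rightarrow> ('n \<Rightarrow> real) \<Rightarrow> real^'d^'n \<Rightarrow> 'm \<Rightarrow> real^'d" where
  "barycenter S p \<mu> l = (1 / cluster_weight S p l) *\<^sub>R (\<Sum>i\<in>S l. p i *\<^sub>R (\<mu> $ i))"

definition dispersion ::
  "('m::finite \<Rightarrow> 'n set) \<Rightarrow> ('n \<Rightarrow> real) \<Rightarrow> real^'d^'n \<Rightarrow> real" where
  "dispersion S p \<mu> = (\<Sum>l\<in>UNIV. \<Sum>i\<in>S l. p i * (norm (\<mu> $ i - barycenter S p \<mu> l))\<^sup>2)"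

text \<open>The sets below involve the nearest-point projection onto \<open>M\<close>, hence they are subsets of the
  neighbourhood \<open>U\<close> on which this projection is defined.\<close>

definition tube ::
  "(real^'d^'n) set \<Rightarrow> (real^'d^'n) set \<Rightarrow> ('m::finite \<Rightarrow> 'n set) \<Rightarrow> ('n::finite \<Rightarrow> real) \<Rightarrow>
     real \<Rightarrow> (real^'d^'n) set" where
  "tube U M S p \<tau> =
     {\<mu> \<in> U. infdist \<mu> M \<le> \<tau> * dispersion S p (closest_point M \<mu>) powr (3 / 2)}"

definition core ::
  "(real^'d^'n) set \<Rightarrow> (real^'d^'n) set \<Rightarrow> ('m::finite \<Rightarrow> 'n set) \<Rightarrow> ('m \<Rightarrow> real) \<Rightarrow>
     ('n::finite \<Rightarrow> real) \<Rightarrow> real \<Rightarrow> (real^'d^'n) set" where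
  "core U M S p\<^sub>s p \<kappa> =
     {\<mu> \<in> U. dispersion S p (closest_point M \<mu>) \<le> \<kappa> * weight_mismatch S p\<^sub>s p powr (2 / 3)}"

definition annulus ::
  "(real^'d^'n) set \<Rightarrow> (real^'d^'n) set \<Rightarrow> ('m::finite \<Rightarrow> 'n set) \<Rightarrow> ('m \<Rightarrow> real) \<Rightarrow>
     ('n::finite \<Rightarrow> real) \<Rightarrow> real \<Rightarrow> real \<Rightarrow> (real^'d^'n) set" where
  "annulus U M S p\<^sub>s p \<tau> \<kappa> = tube U M S p \<tau> - core U M S p\<^sub>s p \<kappa>"

end

theory Submission
  imports Defs "HOL-Probability.Distributions"
begin

text \<open>
  Write the densities as \<open>gauss 0\<close> times a mixture \<open>s\<close> of exponential tilts, with \<open>t\<close> the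
  mixture of the teacher, and let \<open>H\<close> be the Hessian of the reference loss \<open>f\<close> at its
  minimizer \<open>x0\<close>. The excess \<open>s - t\<close> at \<open>x0 + v + e\<close>, where \<open>v\<close> lies in \<open>ker H\<close> and
  \<open>e = O(|v|\<^sup>2)\<close>, is \<open>T(v, e) = D e + D\<^sup>2(v, v) / 2\<close> up to \<open>O(|v|\<^sup>3)\<close>, and \<open>T\<close> vanishes only if
  \<open>v = 0\<close>, because Gaussian derivatives at distinct means are linearly independent. Hence
  \<open>f\<close> is of order \<open>r\<^sup>4\<close> near a point of the ravine at distance \<open>r\<close> from \<open>x0\<close>, and testing the
  gradient against the Euler field \<open>v + 2e\<close> bounds its norm below by a multiple of \<open>r\<^sup>3\<close>.

  On the ravine the gradient lies in \<open>ker H\<close>, and the derivative of the nearest-point projection at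
  \<open>x0\<close> is the orthogonal projection onto \<open>ker H\<close>. So in the tube the normal part of the gradient is
  dominated by the tangential part and the reference Polyak step contracts by \<open>q\<close>.

  Replacing the reference weights by the actual ones changes the gradient by \<open>O(\<Delta>)\<close> and the loss by
  \<open>O(\<Delta>\<^sup>2 + \<Delta> r)\<close>. Outside the core \<open>\<Delta> \<le> r\<^sup>3 / \<kappa>\<close>, so both relative errors are \<open>O(1 / \<kappa>)\<close> and
  the Polyak step moves by only \<open>O(r / \<kappa>)\<close>.
\<close>

section \<open>Exponential tilts of the standard Gaussian\<close>

text \<open>The obstacle is the degeneracy of the minimizer: students of one cluster can move
  against each other without changing the mixture to first order, so no quadratic growth is
  available and every error has to be measured in powers of the distance r. The ravine leaves its
  tangent space quadratically; this is the origin of the remainder e and the reason why v carries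
  weight 1 and e weight 2 in all homogeneity arguments. The exponents in the tube and the core fit
  these orders: since the dispersion is at most r^2, its power 3/2 is at most r^3, and raising the
  core inequality to the power 3/2 bounds the mismatch by a multiple of r^3.

  Integrals are differentiated by hand. After division by the standard Gaussian, the densities,
  their reciprocals, derivatives and Taylor remainders are all bounded pointwise by one function,
  \<open>envelope\<close>, all of whose powers are integrable. The envelope depends on a radius but
  not on the weights, so the constants obtained for the fixed reference weights serve uniformly for
  all student weights having that reference.\<close>

definition gauss_measure :: "(real^'d) measure" where
  "gauss_measure = density lborel (\<lambda>x. ennreal (gauss 0 x))"

lemma gauss_pos: "0 < gauss a x"
  by (simp add: gauss_def)

lemma gauss_measurable [measurable]: "gauss a \<in> borel_measurable borel"
  unfolding gauss_def by measurable

lemma sets_gauss_measure [measurable_cong, simp]: "sets gauss_measure = sets borel"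
  by (simp add: gauss_measure_def)

text \<open>Fubini over the coordinates; in one dimension the function is a multiple of the normal
  density of variance 2. The rate 1/4 is half the Gaussian rate and leaves the other half for
  absorbing exponential growth.\<close>

lemma integrable_exp_neg_norm_sq:
  "integrable lborel (\<lambda>x::'a::euclidean_space. exp (- (norm x)\<^sup>2 / 4))"
proof -
  have one: "integrable lborel (\<lambda>z::real. exp (- z\<^sup>2 / 4))"
  proof -
    have "(\<lambda>z::real. exp (- z\<^sup>2 / 4)) = (\<lambda>z. sqrt (4 * pi) * normal_density 0 (sqrt 2) z)"
      by (auto simp: normal_density_def)
    then show ?thesis by simp
  qed
  have ex: "ennreal (exp (- (norm x)\<^sup>2 / 4)) = (\<Prod>b\<in>Basis. ennreal (exp (- (x \<bullet> b)\<^sup>2 / 4)))" for x :: 'a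
  proof -
    have "(norm x)\<^sup>2 = (\<Sum>b\<in>Basis. (x \<bullet> b)\<^sup>2)"
      by (subst power2_norm_eq_inner, subst euclidean_inner) (simp add: power2_eq_square)
    then have "- (norm x)\<^sup>2 / 4 = (\<Sum>b\<in>Basis. - (x \<bullet> b)\<^sup>2 / 4)"
      by (simp add: sum_negf sum_divide_distrib)
    then show ?thesis
      by (simp add: exp_sum prod_ennreal)
  qed
  have "(\<integral>\<^sup>+x. ennreal (exp (- (norm (x::'a))\<^sup>2 / 4)) \<partial>lborel)
      = (\<Prod>b\<in>(Basis::'a set). \<integral>\<^sup>+z. ennreal (exp (- z\<^sup>2 / 4)) \<partial>lborel)"
    unfolding ex by (rule nn_integral_lborel_prod) auto
  also have "\<dots> < top"
    using one by (simp add: integrable_iff_bounded ennreal_prod_eq_top power_less_top_ennreal)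
  finally show ?thesis
    by (simp add: integrable_iff_bounded)
qed

lemma integrable_exp_norm:
  "integrable gauss_measure (\<lambda>x::real^'d. exp (B * (1 + norm x)))"
proof -
  have "integrable lborel (\<lambda>x::real^'d. gauss 0 x * exp (B * (1 + norm x)))"
  proof (rule Bochner_Integration.integrable_bound)
    let ?c = "(2 * pi) powr (- real CARD('d) / 2)"
    show "integrable lborel (\<lambda>x::real^'d. ?c * exp (B + B\<^sup>2) * exp (- (norm x)\<^sup>2 / 4))"
      using integrable_exp_neg_norm_sq by (rule integrable_mult_right)
    show "AE x in lborel. norm (gauss 0 (x::real^'d) * exp (B * (1 + norm x)))
        \<le> norm (?c * exp (B + B\<^sup>2) * exp (- (norm x)\<^sup>2 / 4))"
    proof (rule AE_I2)
      fix x :: "real^'d"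
      \<comment> \<open>Completing the square: B |x| is at most B^2 + |x|^2 / 4.\<close>
      have "- (norm x)\<^sup>2 / 2 + B * (1 + norm x) \<le> B + B\<^sup>2 + (- (norm x)\<^sup>2 / 4)"
        using zero_le_power2[of "norm x / 2 - B"] by (simp add: power2_eq_square algebra_simps)
      then have "exp (- (norm x)\<^sup>2 / 2) * exp (B * (1 + norm x))
          \<le> exp (B + B\<^sup>2) * exp (- (norm x)\<^sup>2 / 4)"
        by (simp flip: exp_add)
      then show "norm (gauss 0 x * exp (B * (1 + norm x)))
        \<le> norm (?c * exp (B + B\<^sup>2) * exp (- (norm x)\<^sup>2 / 4))"
        by (simp add: gauss_def abs_mult mult_left_mono mult.assoc)
    qed
  qed measurable
  then show ?thesis
    unfolding gauss_measure_def
    by (subst integrable_real_density) (auto simp: gauss_pos less_imp_le)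
qed

text \<open>The likelihood ratio of the normal laws with means \<open>a\<close> and 0. Below,
  \<open>dtilt\<close> and \<open>ddtilt\<close> are its first and second directional derivatives in
  the parameter \<open>a\<close>: Hermite polynomials in \<open>x - a\<close> times the
  tilt.\<close>

definition tilt :: "'a::real_inner \<Rightarrow> 'a \<Rightarrow> real" where
  "tilt a x = exp (x \<bullet> a - a \<bullet> a / 2)"

definition dtilt :: "'a::real_inner \<Rightarrow> 'a \<Rightarrow> 'a \<Rightarrow> real" where
  "dtilt a u x = ((x - a) \<bullet> u) * tilt a x"

definition ddtilt :: "'a::real_inner \<Rightarrow> 'a \<Rightarrow> 'a \<Rightarrow> 'a \<Rightarrow> real" where
  "ddtilt a v u x = (((x - a) \<bullet> v) * ((x - a) \<bullet> u) - v \<bullet> u) * tilt a x"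

lemma tilt_measurable [measurable]:
  "tilt (a::'a::euclidean_space) \<in> borel_measurable borel"
  "dtilt (a::'a::euclidean_space) u \<in> borel_measurable borel"
  "ddtilt (a::'a::euclidean_space) v u \<in> borel_measurable borel"
  unfolding tilt_def dtilt_def ddtilt_def by measurable

lemma tilt_pos: "0 < tilt a x"
  by (simp add: tilt_def)

lemma gauss_eq_tilt: "gauss a x = gauss 0 x * tilt a x"
  by (simp add: gauss_def tilt_def power2_norm_eq_inner inner_diff_left inner_diff_right
      inner_commute field_simps flip: exp_add)

text \<open>By translation invariance. What matters later is that all total masses agree, so their
  common value is left as an integral.\<close>

lemma integral_tilt: "(\<integral>x. tilt (a::real^'d) x \<partial>gauss_measure) = (\<integral>x. gauss 0 (x::real^'d) \<partial>lborel)"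
proof -
  have "(\<integral>x. tilt a x \<partial>gauss_measure) = (\<integral>x. gauss 0 x * tilt a x \<partial>lborel)"
    unfolding gauss_measure_def
    by (subst integral_real_density) (auto simp: gauss_pos less_imp_le)
  also have "\<dots> = (\<integral>x. gauss a x \<partial>lborel)"
    by (simp flip: gauss_eq_tilt)
  also have "\<dots> = (\<integral>x. gauss a (a + x) \<partial>lborel)"
    by (subst lborel_distr_plus[symmetric, of a], subst integral_distr) (auto)
  finally show ?thesis by (simp add: gauss_def)
qed

text \<open>A nonzero value of a continuous function persists on a ball, which has positive measure.
  This turns almost-everywhere identities between exponential polynomials into pointwise
  ones.\<close>

lemma AE_gauss_measure_zero_imp_zero:
  fixes f :: "real^'d \<Rightarrow> real"
  assumes "AE x in gauss_measure. f x = 0" and cont: "continuous_on UNIV f"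
  shows "f x = 0"
proof (rule ccontr)
  assume nz: "f x \<noteq> 0"
  have "AE x in lborel. f x = 0"
    using assms(1) unfolding gauss_measure_def
    by (subst (asm) AE_density) (auto simp: gauss_pos)
  then obtain N where N: "{x. f x \<noteq> 0} \<subseteq> N" "emeasure lborel N = 0" "N \<in> sets lborel"
    by (auto elim!: AE_E)
  have "open {x. f x \<noteq> 0}"
    using cont by (intro open_Collect_neq continuous_intros)
  then obtain e where e: "e > 0" "ball x e \<subseteq> {x. f x \<noteq> 0}"
    using nz openE by blast
  have "emeasure lborel (ball x e) \<le> emeasure lborel N"
    using e N by (intro emeasure_mono) auto
  then have "emeasure lborel (ball x e) = 0" using N by simp
  then show False
    using e(1) content_ball_pos[of e x] by (simp add: measure_def)
qed

text \<open>The exponent of the tilt is quadratic along a line and \<open>L\<close> is the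
  logarithmic derivative of \<open>G\<close>, so all higher derivatives along the line are
  polynomials in \<open>L\<close> and \<open>K\<close> times \<open>G\<close>.\<close>

lemma tilt_line_derivatives:
  fixes a v u x :: "'a::real_inner"
  defines "L \<equiv> \<lambda>t. (x - (a + t *\<^sub>R v)) \<bullet> v" and "K \<equiv> \<lambda>t. (x - (a + t *\<^sub>R v)) \<bullet> u"
    and "G \<equiv> \<lambda>t. tilt (a + t *\<^sub>R v) x"
  shows "(L has_real_derivative - (v \<bullet> v)) (at t)"
    and "(K has_real_derivative - (v \<bullet> u)) (at t)"
    and "(G has_real_derivative L t * G t) (at t)"
proof -
  have L: "L = (\<lambda>t. (x - a) \<bullet> v - t * (v \<bullet> v))"
    and K: "K = (\<lambda>t. (x - a) \<bullet> u - t * (v \<bullet> u))"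
    by (auto simp: L_def K_def inner_diff_left inner_add_left algebra_simps)
  have G: "G = (\<lambda>t. exp ((x \<bullet> a - a \<bullet> a / 2) + t * ((x - a) \<bullet> v) - t\<^sup>2 / 2 * (v \<bullet> v)))"
    by (auto simp: G_def tilt_def inner_diff_left inner_diff_right inner_add_left inner_add_right
        inner_commute power2_eq_square field_simps)
  show "(L has_real_derivative - (v \<bullet> v)) (at t)" "(K has_real_derivative - (v \<bullet> u)) (at t)"
    unfolding L K by (auto intro!: derivative_eq_intros)
  show "(G has_real_derivative L t * G t) (at t)"
    unfolding G L by (auto intro!: derivative_eq_intros simp: algebra_simps)
qed

section \<open>Pointwise bounds for tilts and their Taylor remainders\<close>

lemma tilt_le:
  fixes a x :: "'a::real_inner"
  assumes "norm a \<le> R"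
  shows "tilt a x \<le> exp (R * norm x)"
proof -
  have "x \<bullet> a \<le> norm x * norm a" by (rule norm_cauchy_schwarz)
  also have "\<dots> \<le> R * norm x" using assms by (simp add: mult.commute mult_right_mono)
  finally have "x \<bullet> a - a \<bullet> a / 2 \<le> R * norm x" using inner_ge_zero[of a] by linarith
  then show ?thesis by (simp add: tilt_def)
qed

lemma tilt_ge:
  fixes a x :: "'a::real_inner"
  assumes "norm a \<le> R"
  shows "exp (- (R * norm x) - R\<^sup>2 / 2) \<le> tilt a x"
proof -
  have "- (x \<bullet> a) \<le> norm x * norm a" using norm_cauchy_schwarz[of "-x" a] by simp
  also have "\<dots> \<le> R * norm x" using assms by (simp add: mult.commute mult_right_mono)
  moreover have "a \<bullet> a \<le> R\<^sup>2"
    using assms by (metis norm_ge_zero power2_norm_eq_inner power_mono)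
  ultimately show ?thesis by (simp add: tilt_def)
qed

text \<open>A common bound, on the ball of radius \<open>R\<close>, for the tilts, their reciprocals, and all Taylor
  coefficients and remainders.\<close>

definition envelope :: "real \<Rightarrow> 'a::real_inner \<Rightarrow> real" where
  "envelope R x = exp ((5 + R + R\<^sup>2) * (1 + norm x))"

lemma envelope_measurable [measurable]:
  "envelope R \<in> borel_measurable (borel :: 'a::euclidean_space measure)"
  unfolding envelope_def by measurable

lemma envelope_ge_1: "0 \<le> R \<Longrightarrow> 1 \<le> envelope R x"
  by (simp add: envelope_def)

lemma inverse_tilt_le_envelope:
  fixes a x :: "'a::real_inner"
  assumes "norm a \<le> R"
  shows "1 \<le> tilt a x * envelope R x"
proof -
  have R: "0 \<le> R" using assms norm_ge_zero order_trans by blast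
  \<comment> \<open>The summand R^2 in the exponent of the envelope pays for the term
    \<open>a \<bullet> a / 2\<close> in the exponent of the tilt.\<close>
  have "R * norm x + R\<^sup>2 / 2 \<le> (5 + R + R\<^sup>2) * (1 + norm x)"
    using R by (simp add: algebra_simps add_nonneg_nonneg)
  then have "1 \<le> exp (- (R * norm x) - R\<^sup>2 / 2) * envelope R x"
    by (simp add: envelope_def flip: exp_add)
  also have "\<dots> \<le> tilt a x * envelope R x"
    using tilt_ge[OF assms] by (intro mult_right_mono) (auto simp: envelope_def)
  finally show ?thesis .
qed

text \<open>Origin of the 5 in the envelope: one term of the exponential series gives 4 m^3 \<le> 24
  exp m \<le> exp (4 + m) with m = 1 + R + |x|, and 4 + 1 = 5. The factor 4 m^3 dominates every
  polynomial that appears when a tilt is differentiated up to three times and the norms of the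
  directions are factored out.\<close>

lemma cubic_le_envelope:
  fixes x :: "'a::real_inner"
  assumes "0 \<le> R"
  shows "4 * (1 + R + norm x) ^ 3 * exp (R * norm x) \<le> envelope R x"
proof -
  define m where "m = 1 + R + norm x"
  have m: "1 \<le> m" using assms by (simp add: m_def)
  have "m ^ 3 / fact 3 \<le> exp m"
  proof -
    obtain t where "exp m = (\<Sum>k<4. m ^ k / fact k) + exp t / fact 4 * m ^ 4"
      using Maclaurin_exp_le[of m 4] by blast
    moreover have "0 \<le> exp t / fact 4 * m ^ 4" by simp
    moreover have "(\<Sum>k<4. m ^ k / fact k) = 1 + m + m ^ 2 / 2 + m ^ 3 / fact 3"
      by (simp add: eval_nat_numeral)
    ultimately show ?thesis using m by simp
  qed
  then have "4 * m ^ 3 \<le> 24 * exp m" by (simp add: fact_numeral)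
  also have "(24::real) \<le> exp 4"
  proof -
    have "(2::real) \<le> exp 1" using exp_ge_add_one_self[of "1::real"] by simp
    then have "(5/2::real) \<le> exp 1" 
      using exp_lower_Taylor_quadratic[of "1::real"] by simp
    then have "(5/2::real) ^ 4 \<le> exp 1 ^ 4" by (intro power_mono) auto
    then show ?thesis by (simp flip: exp_of_nat_mult) (simp add: eval_nat_numeral)
  qed
  finally have "4 * m ^ 3 \<le> exp (4 + m)" by (simp add: exp_add)
  then have "4 * m ^ 3 * exp (R * norm x) \<le> exp (4 + m + R * norm x)"
    by (subst exp_add) simp
  also have "\<dots> \<le> envelope R x"
    unfolding envelope_def m_def using assms by (simp add: algebra_simps add_nonneg_nonneg)
  finally show ?thesis by (simp add: m_def)
qed

text \<open>The difference bounds are Maclaurin's formula in one variable along the segment from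
  \<open>a\<close> to \<open>a + v\<close>, which stays in the ball by convexity; the favourable
  factorials are dropped.\<close>

lemma tilt_taylor:
  fixes a v u x :: "'a::real_inner"
  assumes a: "norm a \<le> R" and av: "norm (a + v) \<le> R"
  shows "\<bar>tilt a x\<bar> \<le> envelope R x"
    and "\<bar>dtilt a u x\<bar> \<le> norm u * envelope R x"
    and "\<bar>ddtilt a v u x\<bar> \<le> norm v * norm u * envelope R x"
    and "\<bar>tilt (a + v) x - tilt a x\<bar> \<le> norm v * envelope R x"
    and "\<bar>tilt (a + v) x - tilt a x - dtilt a v x\<bar> \<le> (norm v)\<^sup>2 * envelope R x"
    and "\<bar>tilt (a + v) x - tilt a x - dtilt a v x - ddtilt a v v x / 2\<bar> \<le> (norm v) ^ 3 * envelope R x"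
    and "\<bar>dtilt (a + v) u x - dtilt a u x\<bar> \<le> norm v * norm u * envelope R x"
    and "\<bar>dtilt (a + v) u x - dtilt a u x - ddtilt a v u x\<bar> \<le> (norm v)\<^sup>2 * norm u * envelope R x"
proof -
  define L where "L = (\<lambda>t. (x - (a + t *\<^sub>R v)) \<bullet> v)"
  define K where "K = (\<lambda>t. (x - (a + t *\<^sub>R v)) \<bullet> u)"
  define G where "G = (\<lambda>t. tilt (a + t *\<^sub>R v) x)"
  note dL = tilt_line_derivatives(1)[of x a v, folded L_def]
  note dK = tilt_line_derivatives(2)[of x a v u, folded K_def]
  have dG: "(G has_real_derivative L t * G t) (at t)" for t
    using tilt_line_derivatives(3)[of a v x t] by (simp add: G_def L_def)
  have dLG: "((\<lambda>t. L t * G t) has_real_derivative ((L t)\<^sup>2 - v \<bullet> v) * G t) (at t)" for t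
    by (rule DERIV_cong[OF DERIV_mult[OF dL dG]]) (simp add: algebra_simps power2_eq_square)
  have dLLG: "((\<lambda>t. ((L t)\<^sup>2 - v \<bullet> v) * G t) has_real_derivative
      ((L t)^3 - 3 * (v \<bullet> v) * L t) * G t) (at t)" for t
    by (rule DERIV_cong[OF DERIV_mult[OF DERIV_diff[OF DERIV_power[OF dL, of 2] DERIV_const] dG]])
      (simp add: algebra_simps power2_eq_square power3_eq_cube)
  have dKG: "((\<lambda>t. K t * G t) has_real_derivative (L t * K t - v \<bullet> u) * G t) (at t)" for t
    by (rule DERIV_cong[OF DERIV_mult[OF dK dG]]) (simp add: algebra_simps)
  have dLKG: "((\<lambda>t. (L t * K t - v \<bullet> u) * G t) has_real_derivative
      ((L t)\<^sup>2 * K t - (v \<bullet> v) * K t - 2 * L t * (v \<bullet> u)) * G t) (at t)" for t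
    by (rule DERIV_cong[OF DERIV_mult[OF DERIV_diff[OF DERIV_mult[OF dL dK] DERIV_const] dG]])
      (simp add: algebra_simps power2_eq_square)
  define m where "m = 1 + R + norm x"
  define e where "e = exp (R * norm x)"
  have R: "0 \<le> R" using a norm_ge_zero order_trans by blast
  then have m1: "1 \<le> m" by (simp add: m_def)
  have m2: "m \<le> m\<^sup>2" "m\<^sup>2 \<le> m^3" "1 \<le> m^2" "1 \<le> m^3"
    using m1 power_increasing[of 1 2 m] power_increasing[of 2 3 m] by (auto simp: one_le_power)
  have env: "4 * m ^ 3 * e \<le> envelope R x"
    using cubic_le_envelope[OF R, of x] by (simp add: m_def e_def)
  have e: "0 < e" by (simp add: e_def)
  have seg: "norm (a + t *\<^sub>R v) \<le> R" if "0 \<le> t" "t \<le> 1" for t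
  proof -
    have "a + t *\<^sub>R v = (1 - t) *\<^sub>R a + t *\<^sub>R (a + v)" by (simp add: algebra_simps)
    then have "norm (a + t *\<^sub>R v) \<le> (1 - t) * norm a + t * norm (a + v)"
      using that by (metis abs_of_nonneg diff_ge_0_iff_ge norm_scaleR norm_triangle_ineq)
    also have "\<dots> \<le> (1 - t) * R + t * R"
      using that a av by (intro add_mono mult_left_mono) auto
    finally show ?thesis by (simp add: algebra_simps)
  qed
  have xm: "norm (x - (a + t *\<^sub>R v)) \<le> m" if "0 \<le> t" "t \<le> 1" for t
    using norm_triangle_ineq4[of x "a + t *\<^sub>R v"] seg[OF that] by (simp add: m_def)
  have bG: "0 \<le> G t" "G t \<le> e" if "0 \<le> t" "t \<le> 1" for t
    using tilt_le[OF seg[OF that], of x] tilt_pos[of _ x] by (auto simp: G_def e_def less_imp_le)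
  have bL: "\<bar>L t\<bar> \<le> m * norm v" and bK: "\<bar>K t\<bar> \<le> m * norm u" if "0 \<le> t" "t \<le> 1" for t
    unfolding L_def K_def using xm[OF that] Cauchy_Schwarz_ineq2
    by (meson mult_right_mono norm_ge_zero order_trans)+
  have vu: "\<bar>v \<bullet> u\<bar> \<le> norm v * norm u" "v \<bullet> v = norm v * norm v" 
    using Cauchy_Schwarz_ineq2[of v u] power2_norm_eq_inner[of v] by (auto simp: power2_eq_square)
  have at0: "G 0 = tilt a x" "G 1 = tilt (a + v) x" "L 0 * G 0 = dtilt a v x"
    "((L 0)\<^sup>2 - v \<bullet> v) * G 0 = ddtilt a v v x" "K 0 * G 0 = dtilt a u x"
    "K 1 * G 1 = dtilt (a + v) u x" "(L 0 * K 0 - v \<bullet> u) * G 0 = ddtilt a v u x"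
    by (auto simp: G_def L_def K_def dtilt_def ddtilt_def power2_eq_square)
  \<comment> \<open>Reduces each bound to its polynomial factor \<open>c\<close>, which must be at
    most \<open>4 * m ^ 3\<close> times the product \<open>q\<close> of the norms of the
    directions.\<close>
  have fin: "\<bar>c * G t\<bar> \<le> q * envelope R x"
    if t: "0 \<le> t" "t \<le> 1" and c: "\<bar>c\<bar> \<le> q * (4 * m ^ 3)" and "0 \<le> q" for c q t
  proof -
    have "\<bar>c * G t\<bar> \<le> q * (4 * m ^ 3) * e"
      using c bG[OF t] by (auto simp: abs_mult intro!: mult_mono)
    also have "\<dots> \<le> q * envelope R x"
      using mult_left_mono[OF env \<open>0 \<le> q\<close>] by (simp add: mult.assoc)
    finally show ?thesis .
  qed
  have lin: "\<bar>c\<bar> \<le> q * (4 * m ^ 3)" if "\<bar>c\<bar> \<le> m * q" "0 \<le> q" for c q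
  proof -
    have "q * m \<le> q * (4 * m ^ 3)" using m2 m1 that by (intro mult_left_mono) auto
    then show ?thesis using that by (simp add: mult.commute)
  qed
  have bLL: "\<bar>(L t)\<^sup>2 - v \<bullet> v\<bar> \<le> (norm v)\<^sup>2 * (2 * m\<^sup>2)" if "0 \<le> t" "t \<le> 1" for t
  proof -
    have "(L t)\<^sup>2 \<le> (m * norm v)\<^sup>2" using bL[OF that] by (metis abs_ge_zero power2_abs power_mono)
    moreover have "(norm v)\<^sup>2 * 1 \<le> (norm v)\<^sup>2 * m\<^sup>2" using m2 by (intro mult_left_mono) auto
    moreover have "v \<bullet> v = (norm v)\<^sup>2" by (simp add: power2_norm_eq_inner)
    moreover have "(m * norm v)\<^sup>2 = (norm v)\<^sup>2 * m\<^sup>2" by (simp add: power_mult_distrib)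
    ultimately show ?thesis
      using zero_le_power2[of "L t"] zero_le_power2[of "norm v"] unfolding abs_le_iff by linarith
  qed
  have bLK: "\<bar>L t * K t - v \<bullet> u\<bar> \<le> norm v * norm u * (2 * m\<^sup>2)" if "0 \<le> t" "t \<le> 1" for t
  proof -
    have "\<bar>L t * K t\<bar> \<le> (m * norm v) * (m * norm u)"
      using bL[OF that] bK[OF that] m1 by (auto simp: abs_mult intro!: mult_mono)
    moreover have "norm v * norm u * 1 \<le> norm v * norm u * m\<^sup>2" using m2 by (intro mult_left_mono) auto
    moreover have "(m * norm v) * (m * norm u) = norm v * norm u * m\<^sup>2" by (simp add: power2_eq_square)
    ultimately show ?thesis
      using vu(1) by linarith
  qed
  have quad: "\<bar>c\<bar> \<le> q * (4 * m ^ 3)" if "\<bar>c\<bar> \<le> q * (2 * m\<^sup>2)" "0 \<le> q" for c q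
  proof -
    have "q * (2 * m\<^sup>2) \<le> q * (4 * m ^ 3)" using m2 m1 that by (intro mult_left_mono) auto
    then show ?thesis using that by linarith
  qed
  \<comment> \<open>The coefficients 1 and 3 of the third Hermite polynomial add up to the 4 in
    \<open>4 * m ^ 3\<close>; in the mixed case \<open>bLLK\<close> it is 1 + 1 + 2.\<close>
  have bLLL: "\<bar>(L t)^3 - 3 * (v \<bullet> v) * L t\<bar> \<le> (norm v)^3 * (4 * m ^ 3)" if t: "0 \<le> t" "t \<le> 1" for t
  proof -
    have "\<bar>(L t)^3\<bar> \<le> (m * norm v)^3" using bL[OF t] by (simp add: power_abs power_mono)
    moreover have "\<bar>3 * (v \<bullet> v) * L t\<bar> \<le> 3 * (norm v * norm v) * (m * norm v)"
      using bL[OF t] by (auto simp: abs_mult vu(2) intro!: mult_left_mono)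
    moreover have "norm v ^ 3 * m \<le> norm v ^ 3 * m ^ 3"
      using m2 by (intro mult_left_mono) auto
    moreover have "(m * norm v)^3 = norm v ^ 3 * m ^ 3"
      "3 * (norm v * norm v) * (m * norm v) = 3 * (norm v ^ 3 * m)"
      by (simp_all add: power_mult_distrib power3_eq_cube)
    ultimately show ?thesis by linarith
  qed
  have bLLK: "\<bar>(L t)\<^sup>2 * K t - (v \<bullet> v) * K t - 2 * L t * (v \<bullet> u)\<bar> \<le> (norm v)\<^sup>2 * norm u * (4 * m ^ 3)"
    if t: "0 \<le> t" "t \<le> 1" for t
  proof -
    have "\<bar>(L t)\<^sup>2 * K t\<bar> \<le> (m * norm v)\<^sup>2 * (m * norm u)"
      unfolding abs_mult using bL[OF t] bK[OF t] m1
      by (intro mult_mono) (auto simp: abs_le_square_iff[symmetric])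
    moreover have "\<bar>(v \<bullet> v) * K t\<bar> \<le> (norm v * norm v) * (m * norm u)"
      using bK[OF t] by (auto simp: abs_mult vu(2) intro!: mult_left_mono)
    moreover have "\<bar>2 * L t * (v \<bullet> u)\<bar> \<le> (2 * (m * norm v)) * (norm v * norm u)"
      unfolding abs_mult using bL[OF t] vu(1) m1 by (intro mult_mono) auto
    moreover have "(norm v)\<^sup>2 * norm u * m \<le> (norm v)\<^sup>2 * norm u * m ^ 3"
      using m2 by (intro mult_left_mono) auto
    moreover have "(m * norm v)\<^sup>2 * (m * norm u) = (norm v)\<^sup>2 * norm u * m ^ 3"
      "(norm v * norm v) * (m * norm u) = (norm v)\<^sup>2 * norm u * m"
      "(2 * (m * norm v)) * (norm v * norm u) = 2 * ((norm v)\<^sup>2 * norm u * m)"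
      by (simp_all add: power_mult_distrib power3_eq_cube power2_eq_square)
    ultimately show ?thesis by linarith
  qed
  show "\<bar>tilt a x\<bar> \<le> envelope R x"
    using fin[of 0 1 1] at0 m2 by simp
  show "\<bar>dtilt a u x\<bar> \<le> norm u * envelope R x"
    using fin[of 0 "K 0" "norm u"] at0 lin[OF bK[of 0]] by simp
  show "\<bar>ddtilt a v u x\<bar> \<le> norm v * norm u * envelope R x"
    using fin[of 0 "L 0 * K 0 - v \<bullet> u" "norm v * norm u"] at0 quad[OF bLK[of 0]] by simp
  show "\<bar>tilt (a + v) x - tilt a x\<bar> \<le> norm v * envelope R x"
  proof -
    have "\<exists>t>0. t < 1 \<and> G 1 = (\<Sum>i<1. ([G, \<lambda>t. L t * G t] ! i) 0 / fact i * 1 ^ i)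
        + ([G, \<lambda>t. L t * G t] ! 1) t / fact 1 * 1 ^ 1"
      by (rule Maclaurin) (auto simp: dG)
    then obtain t where t: "0 < t" "t < 1" "G 1 - G 0 = L t * G t" by auto
    show ?thesis using fin[of t "L t" "norm v"] lin[OF bL[of t]] t at0 by simp
  qed
  show "\<bar>tilt (a + v) x - tilt a x - dtilt a v x\<bar> \<le> (norm v)\<^sup>2 * envelope R x"
  proof -
    let ?d = "[G, \<lambda>t. L t * G t, \<lambda>t. ((L t)\<^sup>2 - v \<bullet> v) * G t]"
    have "\<exists>t>0. t < 1 \<and> G 1 = (\<Sum>i<2. (?d ! i) 0 / fact i * 1 ^ i) + (?d ! 2) t / fact 2 * 1 ^ 2"
      by (rule Maclaurin)
        (auto simp: less_2_cases_iff dG dLG)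
    then obtain t where t: "0 < t" "t < 1" "G 1 - G 0 - L 0 * G 0 = ((L t)\<^sup>2 - v \<bullet> v) * G t / 2"
      by (auto simp: numeral_2_eq_2)
    show ?thesis using fin[of t "(L t)\<^sup>2 - v \<bullet> v" "(norm v)\<^sup>2"] quad[OF bLL[of t]] t at0 by simp
  qed
  show "\<bar>tilt (a + v) x - tilt a x - dtilt a v x - ddtilt a v v x / 2\<bar> \<le> (norm v) ^ 3 * envelope R x"
  proof -
    let ?d = "[G, \<lambda>t. L t * G t, \<lambda>t. ((L t)\<^sup>2 - v \<bullet> v) * G t, \<lambda>t. ((L t)^3 - 3 * (v \<bullet> v) * L t) * G t]"
    have "\<exists>t>0. t < 1 \<and> G 1 = (\<Sum>i<3. (?d ! i) 0 / fact i * 1 ^ i) + (?d ! 3) t / fact 3 * 1 ^ 3"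
    proof (rule Maclaurin)
      show "\<forall>k t. k < 3 \<and> 0 \<le> t \<and> t \<le> 1 \<longrightarrow> ((?d ! k) has_real_derivative (?d ! Suc k) t) (at t)"
      proof (intro allI impI)
        fix k :: nat and t :: real assume "k < 3 \<and> 0 \<le> t \<and> t \<le> 1"
        then consider "k = 0" | "k = 1" | "k = 2" by linarith
        then show "((?d ! k) has_real_derivative (?d ! Suc k) t) (at t)"
          by cases (auto simp: dG dLG dLLG)
      qed
    qed auto
    then obtain t where t: "0 < t" "t < 1"
      "G 1 - G 0 - L 0 * G 0 - ((L 0)\<^sup>2 - v \<bullet> v) * G 0 / 2 = ((L t)^3 - 3 * (v \<bullet> v) * L t) * G t / 6"
      by (auto simp: numeral_3_eq_3 numeral_2_eq_2)
    have "tilt (a + v) x - tilt a x - dtilt a v x - ddtilt a v v x / 2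
        = ((L t)^3 - 3 * (v \<bullet> v) * L t) * G t / 6"
      using t(3) unfolding at0(3,4) unfolding at0(1,2) .
    moreover have "\<bar>((L t)^3 - 3 * (v \<bullet> v) * L t) * G t\<bar> \<le> (norm v)^3 * envelope R x"
      using fin[of t "(L t)^3 - 3 * (v \<bullet> v) * L t" "(norm v)^3"] bLLL[of t] t by simp
    ultimately show ?thesis by linarith
  qed
  show "\<bar>dtilt (a + v) u x - dtilt a u x\<bar> \<le> norm v * norm u * envelope R x"
  proof -
    let ?d = "[\<lambda>t. K t * G t, \<lambda>t. (L t * K t - v \<bullet> u) * G t]"
    have "\<exists>t>0. t < 1 \<and> K 1 * G 1 = (\<Sum>i<1. (?d ! i) 0 / fact i * 1 ^ i) + (?d ! 1) t / fact 1 * 1 ^ 1"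
      by (rule Maclaurin) (auto simp: dKG)
    then obtain t where t: "0 < t" "t < 1" "K 1 * G 1 - K 0 * G 0 = (L t * K t - v \<bullet> u) * G t" by auto
    show ?thesis using fin[of t "L t * K t - v \<bullet> u" "norm v * norm u"] quad[OF bLK[of t]] t at0 by simp
  qed
  show "\<bar>dtilt (a + v) u x - dtilt a u x - ddtilt a v u x\<bar> \<le> (norm v)\<^sup>2 * norm u * envelope R x"
  proof -
    let ?d = "[\<lambda>t. K t * G t, \<lambda>t. (L t * K t - v \<bullet> u) * G t,
      \<lambda>t. ((L t)\<^sup>2 * K t - (v \<bullet> v) * K t - 2 * L t * (v \<bullet> u)) * G t]"
    have "\<exists>t>0. t < 1 \<and> K 1 * G 1 = (\<Sum>i<2. (?d ! i) 0 / fact i * 1 ^ i) + (?d ! 2) t / fact 2 * 1 ^ 2"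
      by (rule Maclaurin) (auto simp: less_2_cases_iff dKG dLKG)
    then obtain t where t: "0 < t" "t < 1" "K 1 * G 1 - K 0 * G 0 - (L 0 * K 0 - v \<bullet> u) * G 0
        = ((L t)\<^sup>2 * K t - (v \<bullet> v) * K t - 2 * L t * (v \<bullet> u)) * G t / 2"
      by (auto simp: numeral_2_eq_2)
    show ?thesis
      using fin[of t "(L t)\<^sup>2 * K t - (v \<bullet> v) * K t - 2 * L t * (v \<bullet> u)" "(norm v)\<^sup>2 * norm u"] bLLK[of t] t at0
      by simp
  qed
qed

section \<open>Relative entropy along a smooth family of densities\<close>

lemma norm_le_of_inner_le:
  fixes z :: "'a::real_inner"
  assumes "\<And>\<xi>. \<bar>z \<bullet> \<xi>\<bar> \<le> C * norm \<xi>" and "0 \<le> C"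
  shows "norm z \<le> C"
proof (cases "z = 0")
  case False
  have "norm z * norm z \<le> C * norm z"
    using assms(1)[of z] by (simp add: power2_norm_eq_inner[symmetric] power2_eq_square)
  then show ?thesis using False by simp
qed (use assms in simp)

text \<open>Concavity bounds the increment of \<open>ln\<close> from above by the tangent at
  \<open>a\<close> and from below by the tangent at \<open>b\<close>; the gap between these two
  bounds is exactly the right-hand side.\<close>

lemma ln_taylor_bound:
  fixes a b :: real
  assumes "0 < a" "0 < b"
  shows "\<bar>ln b - ln a - (b - a) / a\<bar> \<le> (b - a)\<^sup>2 / (a * b)"
proof -
  have 1: "ln b - ln a \<le> (b - a) / a"
    using ln_le_minus_one[of "b / a"] assms by (simp add: ln_div field_simps)
  have 2: "ln a - ln b \<le> (a - b) / b"
    using ln_le_minus_one[of "a / b"] assms by (simp add: ln_div field_simps)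
  have "(b - a) / a + (a - b) / b = (b - a)\<^sup>2 / (a * b)"
    using assms by (simp add: field_simps power2_eq_square)
  then show ?thesis using 1 2 by linarith
qed

lemma quotient_diff_bound:
  fixes d1 d2 s1 s2 :: real
  assumes "0 < s1" "0 < s2" "1 \<le> s1 * e" "1 \<le> s2 * e"
    and "\<bar>d2\<bar> \<le> c" "\<bar>d1 - d2\<bar> \<le> x" "\<bar>s1 - s2\<bar> \<le> y"
  shows "\<bar>d1 / s1 - d2 / s2\<bar> \<le> x * e + c * y * e\<^sup>2"
proof -
  have inv: "1 / s1 \<le> e" "1 / s2 \<le> e" using assms by (auto simp: field_simps)
  then have e: "0 \<le> e" using assms(1) by (meson divide_nonneg_pos order_trans zero_le_one)
  have "d1 / s1 - d2 / s2 = (d1 - d2) * (1 / s1) + d2 * (s2 - s1) * ((1 / s1) * (1 / s2))"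
    using assms by (simp add: field_simps)
  also have "\<bar>\<dots>\<bar> \<le> \<bar>(d1 - d2) * (1 / s1)\<bar> + \<bar>d2 * (s2 - s1) * ((1 / s1) * (1 / s2))\<bar>"
    by (rule abs_triangle_ineq)
  also have "\<bar>(d1 - d2) * (1 / s1)\<bar> \<le> x * e"
    unfolding abs_mult using assms inv e by (intro mult_mono) auto
  also have "\<bar>d2 * (s2 - s1) * ((1 / s1) * (1 / s2))\<bar> \<le> (c * y) * (e * e)"
    unfolding abs_mult using assms inv e
    by (intro mult_mono) (auto simp: abs_minus_commute)
  finally show ?thesis by (simp add: power2_eq_square)
qed

text \<open>The Gaussian model reduced to pointwise bounds: \<open>s\<close> is the student density,
  \<open>D\<close> its derivative, \<open>t\<close> the target, and \<open>E\<close> dominates all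
  of them together with the reciprocals of the densities. It is instantiated with the same
  \<open>E\<close> and \<open>t\<close> for the reference weights and for the actual weights, and
  the two instances are then compared.\<close>

locale smooth_family =
  fixes \<gamma> :: "'x measure" and E :: "'x \<Rightarrow> real"
    and s :: "'a::euclidean_space \<Rightarrow> 'x \<Rightarrow> real" and D :: "'a \<Rightarrow> 'a \<Rightarrow> 'x \<Rightarrow> real"
    and t :: "'x \<Rightarrow> real" and x0 :: 'a
  assumes measurable_E [measurable]: "E \<in> borel_measurable \<gamma>"
    and measurable_s [measurable]: "\<And>\<mu>. s \<mu> \<in> borel_measurable \<gamma>"
    and measurable_D [measurable]: "\<And>\<mu> \<xi>. D \<mu> \<xi> \<in> borel_measurable \<gamma>"
    and measurable_t [measurable]: "t \<in> borel_measurable \<gamma>"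
    and E_ge_1: "\<And>x. 1 \<le> E x"
    and integrable_E: "\<And>k. integrable \<gamma> (\<lambda>x. E x ^ k)"
    and t_pos: "\<And>x. 0 < t x" and t_le: "\<And>x. t x \<le> E x" and t_ge: "\<And>x. 1 \<le> t x * E x"
    and s_pos: "\<And>\<mu> x. 0 < s \<mu> x"
    and s_le: "\<And>\<mu> x. \<mu> \<in> ball x0 1 \<Longrightarrow> s \<mu> x \<le> E x"
    and s_ge: "\<And>\<mu> x. \<mu> \<in> ball x0 1 \<Longrightarrow> 1 \<le> s \<mu> x * E x"
    and s_lipschitz: "\<And>\<mu> \<nu> x. \<mu> \<in> ball x0 1 \<Longrightarrow> \<nu> \<in> ball x0 1 \<Longrightarrow>
          \<bar>s \<nu> x - s \<mu> x\<bar> \<le> norm (\<nu> - \<mu>) * E x"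
    and s_taylor: "\<And>\<mu> \<nu> x. \<mu> \<in> ball x0 1 \<Longrightarrow> \<nu> \<in> ball x0 1 \<Longrightarrow>
          \<bar>s \<nu> x - s \<mu> x - D \<mu> (\<nu> - \<mu>) x\<bar> \<le> (norm (\<nu> - \<mu>))\<^sup>2 * E x"
    and linear_D: "\<And>\<mu> x. linear (\<lambda>\<xi>. D \<mu> \<xi> x)"
    and D_le: "\<And>\<mu> \<xi> x. \<mu> \<in> ball x0 1 \<Longrightarrow> \<bar>D \<mu> \<xi> x\<bar> \<le> norm \<xi> * E x"
    and D_lipschitz: "\<And>\<mu> \<nu> \<xi> x. \<mu> \<in> ball x0 1 \<Longrightarrow> \<nu> \<in> ball x0 1 \<Longrightarrow>
          \<bar>D \<nu> \<xi> x - D \<mu> \<xi> x\<bar> \<le> norm (\<nu> - \<mu>) * norm \<xi> * E x"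
    and integral_s: "\<And>\<mu>. \<mu> \<in> ball x0 1 \<Longrightarrow> (\<integral>x. s \<mu> x \<partial>\<gamma>) = (\<integral>x. t x \<partial>\<gamma>)"
begin

definition moment :: "nat \<Rightarrow> real" where
  "moment k = (\<integral>x. E x ^ k \<partial>\<gamma>)"

definition loss :: "'a \<Rightarrow> real" where
  "loss \<mu> = (\<integral>x. t x * ln (t x / s \<mu> x) \<partial>\<gamma>)"

definition gradient :: "'a \<Rightarrow> 'a" where
  "gradient \<mu> = (\<Sum>b\<in>Basis. (- (\<integral>x. t x * D \<mu> b x / s \<mu> x \<partial>\<gamma>)) *\<^sub>R b)"

lemma moment_nonneg: "0 \<le> moment k"
  unfolding moment_def using E_ge_1 by (intro integral_nonneg_AE AE_I2) (simp add: order_trans[OF zero_le_one])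

lemma E_pos: "0 < E x" "0 \<le> E x"
  using E_ge_1[of x] by auto

lemma E_power_mono: "i \<le> j \<Longrightarrow> E x ^ i \<le> E x ^ j"
  using E_ge_1[of x] by (simp add: power_increasing)

lemma inverse_s_le: "\<mu> \<in> ball x0 1 \<Longrightarrow> 1 / s \<mu> x \<le> E x"
  using s_ge[of \<mu> x] s_pos[of \<mu> x] by (simp add: field_simps)

lemma inverse_t_le: "1 / t x \<le> E x"
  using t_ge[of x] t_pos[of x] by (simp add: field_simps)

text \<open>All integrals are estimated by counting factors: each density, derivative or reciprocal
  costs one power of \<open>E\<close>.\<close>

lemma integral_bound:
  assumes [measurable]: "f \<in> borel_measurable \<gamma>" and le: "\<And>x. \<bar>f x\<bar> \<le> c * E x ^ k"
  shows "integrable \<gamma> f" and "\<bar>\<integral>x. f x \<partial>\<gamma>\<bar> \<le> c * moment k"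
proof -
  have int: "integrable \<gamma> (\<lambda>x. c * E x ^ k)" using integrable_E by simp
  show f: "integrable \<gamma> f"
    by (rule Bochner_Integration.integrable_bound[OF int]) (use le in \<open>auto intro!: AE_I2 order_trans[OF le] \<close>)
  have "\<bar>\<integral>x. f x \<partial>\<gamma>\<bar> \<le> (\<integral>x. \<bar>f x\<bar> \<partial>\<gamma>)" by (rule integral_abs_bound)
  also have "\<dots> \<le> (\<integral>x. c * E x ^ k \<partial>\<gamma>)" using f int le by (intro integral_mono) auto
  finally show "\<bar>\<integral>x. f x \<partial>\<gamma>\<bar> \<le> c * moment k" by (simp add: moment_def)
qed

lemma score_le:
  assumes "\<mu> \<in> ball x0 1"
  shows "\<bar>t x * D \<mu> \<xi> x / s \<mu> x\<bar> \<le> norm \<xi> * E x ^ 3"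
proof -
  have "\<bar>t x * D \<mu> \<xi> x / s \<mu> x\<bar> = t x * \<bar>D \<mu> \<xi> x\<bar> * (1 / s \<mu> x)"
    using t_pos[of x] s_pos[of \<mu> x] by (simp add: abs_mult)
  also have "\<dots> \<le> E x * (norm \<xi> * E x) * E x"
    using t_pos[of x] s_pos[of \<mu> x] t_le D_le[OF assms] inverse_s_le[OF assms] E_pos
    by (intro mult_mono) (auto simp: less_imp_le)
  finally show ?thesis by (simp add: power3_eq_cube mult_ac)
qed

lemma gradient_inner:
  assumes "\<mu> \<in> ball x0 1"
  shows "gradient \<mu> \<bullet> \<xi> = - (\<integral>x. t x * D \<mu> \<xi> x / s \<mu> x \<partial>\<gamma>)"
proof -
  have int: "integrable \<gamma> (\<lambda>x. t x * D \<mu> b x / s \<mu> x)" for b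
    by (rule integral_bound(1)[OF _ score_le[OF assms]]) measurable
  have D: "D \<mu> \<xi> x = (\<Sum>b\<in>Basis. (\<xi> \<bullet> b) * D \<mu> b x)" for x
  proof -
    have "D \<mu> \<xi> x = D \<mu> (\<Sum>b\<in>Basis. (\<xi> \<bullet> b) *\<^sub>R b) x" by (simp add: euclidean_representation)
    also have "\<dots> = (\<Sum>b\<in>Basis. (\<xi> \<bullet> b) * D \<mu> b x)"
      by (simp add: linear_sum[OF linear_D] linear_cmul[OF linear_D])
    finally show ?thesis .
  qed
  have "gradient \<mu> \<bullet> \<xi> = (\<Sum>b\<in>Basis. - ((\<integral>x. t x * D \<mu> b x / s \<mu> x \<partial>\<gamma>) * (\<xi> \<bullet> b)))"
    by (simp add: gradient_def inner_sum_left inner_minus_left inner_commute[of \<xi>])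
  also have "\<dots> = - (\<integral>x. (\<Sum>b\<in>Basis. (\<xi> \<bullet> b) * (t x * D \<mu> b x / s \<mu> x)) \<partial>\<gamma>)"
    by (subst Bochner_Integration.integral_sum) (use int in \<open>auto simp: sum_negf mult.commute simp del: times_divide_eq_right\<close>)
  also have "(\<lambda>x. \<Sum>b\<in>Basis. (\<xi> \<bullet> b) * (t x * D \<mu> b x / s \<mu> x)) = (\<lambda>x. t x * D \<mu> \<xi> x / s \<mu> x)"
    by (auto simp: D sum_distrib_left sum_divide_distrib mult_ac)
  finally show ?thesis .
qed

lemma loss_integrable:
  assumes "\<mu> \<in> ball x0 1"
  shows "integrable \<gamma> (\<lambda>x. t x * ln (t x / s \<mu> x))"
proof (rule integral_bound(1))
  fix x
  have pos: "0 < t x" "0 < s \<mu> x" "0 < E x" using t_pos s_pos E_pos by auto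
  have r: "t x / s \<mu> x \<le> E x ^ 2" "s \<mu> x / t x \<le> E x ^ 2"
    using mult_mono[OF t_le inverse_s_le[OF assms]] mult_mono[OF s_le[OF assms] inverse_t_le] pos
    by (auto simp: power2_eq_square less_imp_le)
  have "\<bar>ln (t x / s \<mu> x)\<bar> \<le> E x ^ 2"
    using ln_le_minus_one[of "t x / s \<mu> x"] ln_le_minus_one[of "s \<mu> x / t x"] pos r
    by (simp add: ln_div)
  then have "t x * \<bar>ln (t x / s \<mu> x)\<bar> \<le> E x * E x ^ 2"
    using t_le pos by (intro mult_mono) auto
  then show "\<bar>t x * ln (t x / s \<mu> x)\<bar> \<le> 1 * E x ^ 3"
    using pos by (simp add: abs_mult power3_eq_cube power2_eq_square)
qed measurable

lemma loss_taylor: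
  assumes \<mu>: "\<mu> \<in> ball x0 1" and \<nu>: "\<nu> \<in> ball x0 1"
  shows "\<bar>loss \<nu> - loss \<mu> - gradient \<mu> \<bullet> (\<nu> - \<mu>)\<bar> \<le> 2 * (norm (\<nu> - \<mu>))\<^sup>2 * moment 5"
proof -
  let ?f = "\<lambda>x. t x * ln (t x / s \<nu> x) - t x * ln (t x / s \<mu> x) + t x * D \<mu> (\<nu> - \<mu>) x / s \<mu> x"
  let ?h = "norm (\<nu> - \<mu>)"
  have int: "integrable \<gamma> (\<lambda>x. t x * D \<mu> b x / s \<mu> x)" for b
    by (rule integral_bound(1)[OF _ score_le[OF \<mu>]]) measurable
  have "loss \<nu> - loss \<mu> - gradient \<mu> \<bullet> (\<nu> - \<mu>) = (\<integral>x. ?f x \<partial>\<gamma>)"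
    using int loss_integrable[OF \<mu>] loss_integrable[OF \<nu>] by (simp add: loss_def gradient_inner[OF \<mu>])
  moreover have "\<bar>?f x\<bar> \<le> (2 * ?h\<^sup>2) * E x ^ 5" for x
  proof -
    have pos: "0 < t x" "0 < s \<mu> x" "0 < s \<nu> x" "0 < E x" using t_pos s_pos E_pos by auto
    have inv: "1 / s \<mu> x \<le> E x" "1 / s \<nu> x \<le> E x" using inverse_s_le \<mu> \<nu> by auto
    \<comment> \<open>\<open>?a\<close> is the second-order error of the logarithm and
      \<open>?b\<close> that of the density; the first-order parts cancel against the gradient
      term.\<close>
    let ?a = "ln (s \<nu> x) - ln (s \<mu> x) - (s \<nu> x - s \<mu> x) / s \<mu> x"
    let ?b = "(s \<nu> x - s \<mu> x - D \<mu> (\<nu> - \<mu>) x) * (1 / s \<mu> x)"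
    have "\<bar>s \<nu> x - s \<mu> x\<bar> ^ 2 \<le> (?h * E x) ^ 2"
      using s_lipschitz[OF \<mu> \<nu>] by (intro power_mono) auto
    then have sq: "(s \<nu> x - s \<mu> x)\<^sup>2 \<le> ?h\<^sup>2 * E x ^ 2" by (simp add: power_mult_distrib)
    have "\<bar>?a\<bar> \<le> (s \<nu> x - s \<mu> x)\<^sup>2 * ((1 / s \<mu> x) * (1 / s \<nu> x))"
      using ln_taylor_bound[OF pos(2,3)] by simp
    also have "\<dots> \<le> (?h\<^sup>2 * E x ^ 2) * (E x * E x)"
      using sq inv pos by (intro mult_mono) (auto simp: less_imp_le)
    finally have a: "\<bar>?a\<bar> \<le> ?h\<^sup>2 * E x ^ 4" by (simp add: eval_nat_numeral mult_ac)
    have "\<bar>?b\<bar> \<le> (?h\<^sup>2 * E x) * E x"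
      unfolding abs_mult using s_taylor[OF \<mu> \<nu>, of x] inv pos by (intro mult_mono) (auto simp: less_imp_le)
    also have "\<dots> \<le> ?h\<^sup>2 * E x ^ 4"
      using mult_left_mono[OF E_power_mono[of 2 4 x], of "?h\<^sup>2"] by (simp add: power2_eq_square mult_ac)
    finally have b: "\<bar>?b\<bar> \<le> ?h\<^sup>2 * E x ^ 4" .
    have "?f x = - (t x * (?a + ?b))"
      using pos by (simp add: ln_div field_simps)
    then have "\<bar>?f x\<bar> = t x * \<bar>?a + ?b\<bar>" using pos by (simp add: abs_mult)
    also have "\<dots> \<le> E x * (?h\<^sup>2 * E x ^ 4 + ?h\<^sup>2 * E x ^ 4)"
      using t_le[of x] pos abs_triangle_ineq[of ?a ?b] a b
      by (intro mult_mono add_mono[THEN order_trans[OF abs_triangle_ineq]]) auto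
    finally show ?thesis by (simp add: eval_nat_numeral algebra_simps)
  qed
  ultimately show ?thesis
    using integral_bound(2)[of ?f "2 * ?h\<^sup>2" 5] by simp
qed

lemma GDERIV_loss:
  assumes \<mu>: "\<mu> \<in> ball x0 1"
  shows "GDERIV loss \<mu> :> gradient \<mu>"
  unfolding gderiv_def has_derivative_at
proof (intro conjI)
  show "bounded_linear (\<lambda>h. h \<bullet> gradient \<mu>)" by (rule bounded_linear_inner_left)
  show "(\<lambda>h. norm (loss (\<mu> + h) - loss \<mu> - h \<bullet> gradient \<mu>) / norm h) \<midarrow>0\<rightarrow> 0"
  proof (rule Lim_null_comparison)
    show "((\<lambda>h::'a. 2 * norm h * moment 5) \<longlongrightarrow> 0) (at 0)" by (auto intro!: tendsto_eq_intros)
    have "eventually (\<lambda>h. \<mu> + h \<in> ball x0 1) (at 0)"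
    proof (rule topological_tendstoD)
      show "((\<lambda>h. \<mu> + h) \<longlongrightarrow> \<mu>) (at 0)" by (auto intro!: tendsto_eq_intros)
    qed (use \<mu> in auto)
    then show "eventually (\<lambda>h. norm (norm (loss (\<mu> + h) - loss \<mu> - h \<bullet> gradient \<mu>) / norm h)
        \<le> 2 * norm h * moment 5) (at 0)"
    proof (rule eventually_mono)
      fix h assume "\<mu> + h \<in> ball x0 1"
      from loss_taylor[OF \<mu> this] have "norm (loss (\<mu> + h) - loss \<mu> - h \<bullet> gradient \<mu>)
          \<le> 2 * norm h * moment 5 * norm h"
        by (simp add: inner_commute power2_eq_square mult_ac)
      then show "norm (norm (loss (\<mu> + h) - loss \<mu> - h \<bullet> gradient \<mu>) / norm h) \<le> 2 * norm h * moment 5"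
        by (cases "h = 0") (auto simp: divide_le_eq moment_nonneg)
    qed
  qed
qed

lemma gradient_perturb:
  assumes other: "smooth_family \<gamma> E s' D' t x0"
    and \<mu>: "\<mu> \<in> ball x0 1" and \<nu>: "\<nu> \<in> ball x0 1"
    and s: "\<And>x. \<bar>s' \<nu> x - s \<mu> x\<bar> \<le> \<delta> * E x"
    and D: "\<And>\<xi> x. \<bar>D' \<nu> \<xi> x - D \<mu> \<xi> x\<bar> \<le> \<delta> * norm \<xi> * E x"
  shows "norm (smooth_family.gradient \<gamma> s' D' t \<nu> - gradient \<mu>) \<le> \<delta> * (2 * moment 5)"
proof -
  interpret o: smooth_family \<gamma> E s' D' t x0 by (rule other)
  have \<delta>: "0 \<le> \<delta>"
  proof -
    have "0 \<le> \<delta> * E undefined" using s[of undefined] by linarith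
    then show ?thesis using E_pos(1)[of undefined] by (simp add: zero_le_mult_iff)
  qed
  show ?thesis
  proof (rule norm_le_of_inner_le)
    fix \<xi>
    let ?f = "\<lambda>x. t x * D \<mu> \<xi> x / s \<mu> x - t x * D' \<nu> \<xi> x / s' \<nu> x"
    have "(o.gradient \<nu> - gradient \<mu>) \<bullet> \<xi> = (\<integral>x. ?f x \<partial>\<gamma>)"
      using integral_bound(1)[OF _ score_le[OF \<mu>, of _ \<xi>]] o.integral_bound(1)[OF _ o.score_le[OF \<nu>, of _ \<xi>]]
      by (simp add: inner_diff_left gradient_inner[OF \<mu>] o.gradient_inner[OF \<nu>])
    moreover have "\<bar>?f x\<bar> \<le> (\<delta> * (2 * norm \<xi>)) * E x ^ 5" for x
    proof -
      have "\<bar>D' \<nu> \<xi> x / s' \<nu> x - D \<mu> \<xi> x / s \<mu> x\<bar>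
          \<le> (\<delta> * norm \<xi> * E x) * E x + (norm \<xi> * E x) * (\<delta> * E x) * (E x)\<^sup>2"
        by (rule quotient_diff_bound)
          (use s D s_ge[OF \<mu>] o.s_ge[OF \<nu>] D_le[OF \<mu>] s_pos o.s_pos in auto)
      also have "\<dots> = (\<delta> * norm \<xi>) * (E x ^ 2 + E x ^ 4)"
        by (simp add: eval_nat_numeral algebra_simps)
      also have "\<dots> \<le> (\<delta> * norm \<xi>) * (E x ^ 4 + E x ^ 4)"
        using E_power_mono[of 2 4 x] \<delta> by (intro mult_left_mono) auto
      finally have "t x * \<bar>D' \<nu> \<xi> x / s' \<nu> x - D \<mu> \<xi> x / s \<mu> x\<bar> \<le> E x * ((\<delta> * norm \<xi>) * (E x ^ 4 + E x ^ 4))"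
        using t_pos[of x] t_le[of x] E_pos[of x] by (intro mult_mono) auto
      moreover have "?f x = - (t x * (D' \<nu> \<xi> x / s' \<nu> x - D \<mu> \<xi> x / s \<mu> x))"
        by (simp add: algebra_simps)
      moreover have "E x * ((\<delta> * norm \<xi>) * (E x ^ 4 + E x ^ 4)) = (\<delta> * (2 * norm \<xi>)) * E x ^ 5"
        by (simp add: eval_nat_numeral)
      ultimately show ?thesis using t_pos[of x] by (simp only: abs_mult abs_minus abs_of_pos)
    qed
    ultimately show "\<bar>(o.gradient \<nu> - gradient \<mu>) \<bullet> \<xi>\<bar> \<le> \<delta> * (2 * moment 5) * norm \<xi>"
      using integral_bound(2)[of ?f "\<delta> * (2 * norm \<xi>)" 5] by (simp add: mult_ac)
  qed (use \<delta> moment_nonneg in simp)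
qed

lemma gradient_lipschitz:
  assumes "\<mu> \<in> ball x0 1" "\<nu> \<in> ball x0 1"
  shows "norm (gradient \<nu> - gradient \<mu>) \<le> norm (\<nu> - \<mu>) * (2 * moment 5)"
  by (rule gradient_perturb[OF smooth_family_axioms assms s_lipschitz[OF assms] D_lipschitz[OF assms]])

section \<open>Relative entropy between zero and the chi-square divergence\<close>

lemma s_integrable:
  assumes "\<mu> \<in> ball x0 1"
  shows "integrable \<gamma> (s \<mu>)"
  by (rule integral_bound(1)[where c = 1 and k = 1]) (use s_le[OF assms] s_pos in \<open>auto simp: less_imp_le\<close>)

lemma t_integrable: "integrable \<gamma> t"
  by (rule integral_bound(1)[where c = 1 and k = 1]) (use t_le t_pos in \<open>auto simp: less_imp_le\<close>)

text \<open>Gibbs' inequality; equality of the total masses takes the place of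
  normalization.\<close>

lemma loss_nonneg:
  assumes "\<mu> \<in> ball x0 1"
  shows "0 \<le> loss \<mu>"
proof -
  have "0 = (\<integral>x. t x - s \<mu> x \<partial>\<gamma>)"
    using s_integrable[OF assms] t_integrable integral_s[OF assms] by simp
  also have "\<dots> \<le> loss \<mu>"
    unfolding loss_def
  proof (rule integral_mono)
    fix x
    have pos: "0 < t x" "0 < s \<mu> x" using t_pos s_pos by auto
    have "1 - s \<mu> x / t x \<le> ln (t x / s \<mu> x)"
      using ln_le_minus_one[of "s \<mu> x / t x"] pos by (simp add: ln_div)
    from mult_left_mono[OF this, of "t x"] show "t x - s \<mu> x \<le> t x * ln (t x / s \<mu> x)"
      using pos by (simp add: right_diff_distrib)
  qed (use s_integrable[OF assms] t_integrable loss_integrable[OF assms] in auto)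
  finally show ?thesis .
qed

text \<open>By \<open>ln z \<le> z - 1\<close> relative entropy is at most the chi-square
  divergence, which is quadratic in the excess \<open>s - t\<close>.\<close>

lemma loss_le:
  assumes \<mu>: "\<mu> \<in> ball x0 1" and le: "\<And>x. \<bar>s \<mu> x - t x\<bar> \<le> a * E x"
  shows "loss \<mu> \<le> a\<^sup>2 * moment 3"
proof -
  have chi: "\<bar>(s \<mu> x - t x)\<^sup>2 / s \<mu> x\<bar> \<le> a\<^sup>2 * E x ^ 3" for x
  proof -
    have "\<bar>s \<mu> x - t x\<bar>\<^sup>2 * (1 / s \<mu> x) \<le> (a * E x)\<^sup>2 * E x"
      using le inverse_s_le[OF \<mu>] s_pos by (intro mult_mono power_mono) (auto simp: less_imp_le)
    then show ?thesis using s_pos[of \<mu> x] by (simp add: eval_nat_numeral mult_ac)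
  qed
  have int: "integrable \<gamma> (\<lambda>x. (s \<mu> x - t x)\<^sup>2 / s \<mu> x)"
    by (rule integral_bound(1)[OF _ chi]) measurable
  have "loss \<mu> \<le> (\<integral>x. (s \<mu> x - t x)\<^sup>2 / s \<mu> x + (t x - s \<mu> x) \<partial>\<gamma>)"
    unfolding loss_def
  proof (rule integral_mono)
    fix x
    have pos: "0 < t x" "0 < s \<mu> x" using t_pos s_pos by auto
    have "t x * ln (t x / s \<mu> x) \<le> t x * (t x / s \<mu> x - 1)"
      using ln_le_minus_one[of "t x / s \<mu> x"] pos by (intro mult_left_mono) auto
    also have "\<dots> = (s \<mu> x - t x)\<^sup>2 / s \<mu> x + (t x - s \<mu> x)"
      using pos by (simp add: field_simps power2_eq_square)
    finally show "t x * ln (t x / s \<mu> x) \<le> (s \<mu> x - t x)\<^sup>2 / s \<mu> x + (t x - s \<mu> x)" .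
  qed (use int s_integrable[OF \<mu>] t_integrable loss_integrable[OF \<mu>] in auto)
  also have "\<dots> = (\<integral>x. (s \<mu> x - t x)\<^sup>2 / s \<mu> x \<partial>\<gamma>)"
    using int s_integrable[OF \<mu>] t_integrable integral_s[OF \<mu>] by simp
  also have "\<dots> \<le> a\<^sup>2 * moment 3"
    using integral_bound(2)[OF _ chi] by (simp add: abs_le_iff)
  finally show ?thesis .
qed

text \<open>At \<open>x0\<close> the original loss vanishes and the perturbed one is quadratic in
  \<delta> by the chi-square bound; away from \<open>x0\<close> the difference grows at rate
  O(\<delta>) by the comparison of gradients. A plain O(\<delta>) bound would be too weak: with
  \<delta> of order r^3 the loss has to be known up to order r^4.\<close>

lemma loss_perturb:
  assumes other: "smooth_family \<gamma> E s' D' t x0"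
    and s: "\<And>\<mu> x. \<mu> \<in> ball x0 1 \<Longrightarrow> \<bar>s' \<mu> x - s \<mu> x\<bar> \<le> \<delta> * E x"
    and D: "\<And>\<mu> \<xi> x. \<mu> \<in> ball x0 1 \<Longrightarrow> \<bar>D' \<mu> \<xi> x - D \<mu> \<xi> x\<bar> \<le> \<delta> * norm \<xi> * E x"
    and t: "\<And>x. s x0 x = t x" and \<mu>: "\<mu> \<in> ball x0 1"
  shows "\<bar>smooth_family.loss \<gamma> s' t \<mu> - loss \<mu>\<bar> \<le> \<delta>\<^sup>2 * moment 3 + \<delta> * (2 * moment 5) * norm (\<mu> - x0)"
proof -
  interpret o: smooth_family \<gamma> E s' D' t x0 by (rule other)
  have x0: "x0 \<in> ball x0 1" by simp
  define h where "h = (\<lambda>\<mu>. o.loss \<mu> - loss \<mu>)"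
  have "norm (h \<mu> - h x0) \<le> \<delta> * (2 * moment 5) * norm (\<mu> - x0)"
  proof (rule differentiable_bound[where S = "ball x0 1"])
    fix \<nu> assume \<nu>: "\<nu> \<in> ball x0 1"
    have "GDERIV h \<nu> :> o.gradient \<nu> - gradient \<nu>"
      unfolding h_def by (intro GDERIV_diff GDERIV_loss o.GDERIV_loss \<nu>)
    then show "(h has_derivative (\<lambda>k. k \<bullet> (o.gradient \<nu> - gradient \<nu>))) (at \<nu> within ball x0 1)"
      unfolding gderiv_def by (rule has_derivative_at_withinI)
    show "onorm (\<lambda>k. k \<bullet> (o.gradient \<nu> - gradient \<nu>)) \<le> \<delta> * (2 * moment 5)"
    proof (rule onorm_le)
      fix k
      have "norm (k \<bullet> (o.gradient \<nu> - gradient \<nu>)) \<le> norm k * norm (o.gradient \<nu> - gradient \<nu>)"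
        by (simp add: Cauchy_Schwarz_ineq2)
      also have "\<dots> \<le> norm k * (\<delta> * (2 * moment 5))"
        using gradient_perturb[OF other \<nu> \<nu> s[OF \<nu>] D[OF \<nu>]] by (intro mult_left_mono) auto
      finally show "norm (k \<bullet> (o.gradient \<nu> - gradient \<nu>)) \<le> \<delta> * (2 * moment 5) * norm k"
        by (simp add: mult_ac)
    qed
  qed (use \<mu> in auto)
  moreover have "loss x0 = 0" using t t_pos by (simp add: loss_def less_imp_neq[THEN not_sym])
  moreover have "0 \<le> o.loss x0" "o.loss x0 \<le> \<delta>\<^sup>2 * moment 3"
    using o.loss_nonneg[OF x0] o.loss_le[OF x0, of \<delta>] s[OF x0] t
    by (auto simp: o.moment_def moment_def)
  ultimately show ?thesis by (simp add: h_def)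
qed

text \<open>The derivative of the constant total mass, obtained from one-sided difference quotients
  and the pointwise Taylor bound.\<close>

lemma integral_D_eq_0:
  assumes \<mu>: "\<mu> \<in> ball x0 1"
  shows "integrable \<gamma> (D \<mu> \<xi>)" and "(\<integral>x. D \<mu> \<xi> x \<partial>\<gamma>) = 0"
proof -
  show int: "integrable \<gamma> (D \<mu> \<xi>)"
    by (rule integral_bound(1)[where c = "norm \<xi>" and k = 1]) (use D_le[OF \<mu>] in auto)
  define c where "c = (norm \<xi>)\<^sup>2 * moment 1"
  have ev: "eventually (\<lambda>\<epsilon>. \<mu> + \<epsilon> *\<^sub>R \<xi> \<in> ball x0 1) (at_right 0)"
  proof (rule topological_tendstoD)
    show "((\<lambda>\<epsilon>. \<mu> + \<epsilon> *\<^sub>R \<xi>) \<longlongrightarrow> \<mu>) (at_right 0)" by (auto intro!: tendsto_eq_intros)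
  qed (use \<mu> in auto)
  have "((\<lambda>_. \<bar>\<integral>x. D \<mu> \<xi> x \<partial>\<gamma>\<bar>) \<longlongrightarrow> 0) (at_right (0::real))"
  proof (rule Lim_null_comparison)
    show "((\<lambda>\<epsilon>. \<epsilon> * c) \<longlongrightarrow> 0) (at_right 0)" by (auto intro!: tendsto_eq_intros)
    show "eventually (\<lambda>\<epsilon>. norm \<bar>\<integral>x. D \<mu> \<xi> x \<partial>\<gamma>\<bar> \<le> \<epsilon> * c) (at_right 0)"
      using ev eventually_at_right_less[of 0]
    proof eventually_elim
      case (elim \<epsilon>)
      let ?f = "\<lambda>x. s (\<mu> + \<epsilon> *\<^sub>R \<xi>) x - s \<mu> x - \<epsilon> * D \<mu> \<xi> x"
      have le: "\<bar>?f x\<bar> \<le> (\<epsilon>\<^sup>2 * (norm \<xi>)\<^sup>2) * E x ^ 1" for x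
        using s_taylor[OF \<mu> elim(1), of x] by (simp add: linear_cmul[OF linear_D] power_mult_distrib)
      have "\<bar>\<integral>x. ?f x \<partial>\<gamma>\<bar> \<le> (\<epsilon>\<^sup>2 * (norm \<xi>)\<^sup>2) * moment 1"
        by (rule integral_bound(2)[OF _ le]) measurable
      also have "(\<integral>x. ?f x \<partial>\<gamma>) = - (\<epsilon> * (\<integral>x. D \<mu> \<xi> x \<partial>\<gamma>))"
        using int s_integrable[OF \<mu>] s_integrable[OF elim(1)] integral_s[OF \<mu>] integral_s[OF elim(1)] by simp
      finally have "\<epsilon> * \<bar>\<integral>x. D \<mu> \<xi> x \<partial>\<gamma>\<bar> \<le> \<epsilon> * (\<epsilon> * c)"
        using elim by (simp add: abs_mult c_def power2_eq_square mult_ac)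
      then show ?case using elim by simp
    qed
  qed
  then show "(\<integral>x. D \<mu> \<xi> x \<partial>\<gamma>) = 0"
    by (simp add: tendsto_const_iff)
qed

text \<open>Adding the vanishing mean of \<open>D\<close> replaces the factor \<open>- t\<close> by
  the small factor \<open>s - t\<close>. In this form the gradient is, up to the weight
  \<open>1 / s\<close>, a product of the excess and its derivative, which makes the degenerate
  expansion possible.\<close>

lemma gradient_inner_excess:
  assumes \<mu>: "\<mu> \<in> ball x0 1"
  shows "gradient \<mu> \<bullet> \<xi> = (\<integral>x. (s \<mu> x - t x) * D \<mu> \<xi> x / s \<mu> x \<partial>\<gamma>)"
proof -
  have int: "integrable \<gamma> (\<lambda>x. t x * D \<mu> \<xi> x / s \<mu> x)"
    by (rule integral_bound(1)[OF _ score_le[OF \<mu>]]) measurable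
  have "(\<integral>x. (s \<mu> x - t x) * D \<mu> \<xi> x / s \<mu> x \<partial>\<gamma>) = (\<integral>x. D \<mu> \<xi> x - t x * D \<mu> \<xi> x / s \<mu> x \<partial>\<gamma>)"
    using s_pos[of \<mu>] by (intro Bochner_Integration.integral_cong) (auto simp: field_simps less_imp_neq[THEN not_sym])
  also have "\<dots> = gradient \<mu> \<bullet> \<xi>"
    using int integral_D_eq_0[OF \<mu>] by (simp add: gradient_inner[OF \<mu>])
  finally show ?thesis by simp
qed

end

section \<open>Quartic growth along the kernel of the Hessian\<close>

lemma abs_mult3_le:
  fixes a b c a' b' c' :: real
  assumes "\<bar>a\<bar> \<le> a'" "\<bar>b\<bar> \<le> b'" "\<bar>c\<bar> \<le> c'"
  shows "\<bar>a * b * c\<bar> \<le> a' * b' * c'"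
  unfolding abs_mult using assms by (intro mult_mono) (auto intro: mult_nonneg_nonneg order_trans[OF abs_ge_zero])

lemma abs_add_half_le:
  fixes a b c :: real
  assumes "\<bar>a\<bar> \<le> a'" "\<bar>b\<bar> \<le> b'" "\<bar>c\<bar> \<le> c'"
  shows "\<bar>a + (b + c) / 2\<bar> \<le> a' + b' + c'"
  using assms unfolding abs_le_iff by (intro conjI; argo)

lemma abs_add3_le:
  fixes a b c :: real
  assumes "\<bar>a\<bar> \<le> a'" "\<bar>b\<bar> \<le> b'" "\<bar>c\<bar> \<le> c'"
  shows "\<bar>a + b + 2 * c\<bar> \<le> a' + b' + 2 * c'"
  using assms unfolding abs_le_iff by (intro conjI; argo)

text \<open>By \<open>t_eq\<close> the base point reproduces the target exactly. In
  \<open>nondegenerate\<close> the conclusion on \<open>e\<close> is that its first-order effect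
  vanishes, not that \<open>e = 0\<close>, because the Hessian may have a kernel; the passage from
  almost everywhere to everywhere is included.\<close>

locale degenerate_family = smooth_family \<gamma> E s D t x0
  for \<gamma> :: "'x measure" and E :: "'x \<Rightarrow> real"
    and s :: "'a::euclidean_space \<Rightarrow> 'x \<Rightarrow> real" and D :: "'a \<Rightarrow> 'a \<Rightarrow> 'x \<Rightarrow> real"
    and t :: "'x \<Rightarrow> real" and x0 :: 'a +
  fixes D2 :: "'a \<Rightarrow> 'a \<Rightarrow> 'x \<Rightarrow> real"
  assumes measurable_D2 [measurable]: "\<And>v u. D2 v u \<in> borel_measurable \<gamma>"
    and t_eq: "\<And>x. t x = s x0 x"
    and s_taylor3: "\<And>v x. norm v < 1 \<Longrightarrow>
        \<bar>s (x0 + v) x - s x0 x - D x0 v x - D2 v v x / 2\<bar> \<le> (norm v) ^ 3 * E x"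
    and D_taylor: "\<And>v \<xi> x. norm v < 1 \<Longrightarrow>
        \<bar>D (x0 + v) \<xi> x - D x0 \<xi> x - D2 v \<xi> x\<bar> \<le> (norm v)\<^sup>2 * norm \<xi> * E x"
    and D2_le: "\<And>v u x. \<bar>D2 v u x\<bar> \<le> norm v * norm u * E x"
    and linear_D2: "\<And>v x. linear (\<lambda>u. D2 v u x)"
    and D2_sym: "\<And>v u x. D2 v u x = D2 u v x"
    and nondegenerate: "\<And>v e. (AE x in \<gamma>. D x0 e x + D2 v v x / 2 = 0) \<Longrightarrow>
        v = 0 \<and> (\<forall>x. D x0 e x = 0)"
begin

text \<open>The Fisher information at \<open>x0\<close>. In the derivative of the integral of
  \<open>(s - t) * D / s\<close> all terms that keep the factor \<open>s - t\<close> vanish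
  there.\<close>

definition hess :: "'a \<Rightarrow> 'a" where
  "hess v = (\<Sum>b\<in>Basis. (\<integral>x. D x0 v x * D x0 b x / t x \<partial>\<gamma>) *\<^sub>R b)"

definition model :: "'a \<Rightarrow> 'a \<Rightarrow> 'x \<Rightarrow> real" where
  "model v e x = D x0 e x + D2 v v x / 2"

definition model_energy :: "'a \<Rightarrow> 'a \<Rightarrow> real" where
  "model_energy v e = (\<integral>x. (model v e x)\<^sup>2 / t x \<partial>\<gamma>)"

lemma x0_in_ball [simp]: "x0 \<in> ball x0 1"
  by simp

lemma measurable_model [measurable]: "model v e \<in> borel_measurable \<gamma>"
  unfolding model_def by measurable

lemma D2_simps:
  "D2 v (u + u') x = D2 v u x + D2 v u' x" "D2 (v + v') u x = D2 v u x + D2 v' u x"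
  "D2 v (c *\<^sub>R u) x = c * D2 v u x" "D2 (c *\<^sub>R v) u x = c * D2 v u x"
  "D2 v (u - u') x = D2 v u x - D2 v u' x" "D2 (v - v') u x = D2 v u x - D2 v' u x"
  using linear_add[OF linear_D2] linear_cmul[OF linear_D2] linear_diff[OF linear_D2] D2_sym
  by auto

lemma D_simps:
  "D \<mu> (u + u') x = D \<mu> u x + D \<mu> u' x" "D \<mu> (c *\<^sub>R u) x = c * D \<mu> u x"
  "D \<mu> (u - u') x = D \<mu> u x - D \<mu> u' x"
  using linear_add[OF linear_D] linear_cmul[OF linear_D] linear_diff[OF linear_D] by auto

lemma inverse_le_abs: "\<bar>1 / t x\<bar> \<le> E x" "\<mu> \<in> ball x0 1 \<Longrightarrow> \<bar>1 / s \<mu> x\<bar> \<le> E x"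
  using inverse_t_le[of x] t_pos[of x] inverse_s_le[of \<mu> x] s_pos[of \<mu> x] by auto

lemma hess_integrand_le: "\<bar>D x0 v x * D x0 \<xi> x / t x\<bar> \<le> (norm v * norm \<xi>) * E x ^ 3"
  using abs_mult3_le[OF D_le[OF x0_in_ball, of v x] D_le[OF x0_in_ball, of \<xi> x] inverse_le_abs(1)[of x]]
  by (simp add: power3_eq_cube mult_ac)

lemma hess_integrable: "integrable \<gamma> (\<lambda>x. D x0 v x * D x0 \<xi> x / t x)"
  by (rule integral_bound(1)[OF _ hess_integrand_le]) measurable

lemma hess_inner: "hess v \<bullet> \<xi> = (\<integral>x. D x0 v x * D x0 \<xi> x / t x \<partial>\<gamma>)"
proof -
  have D: "D x0 \<xi> x = (\<Sum>b\<in>Basis. (\<xi> \<bullet> b) * D x0 b x)" for x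
  proof -
    have "D x0 \<xi> x = D x0 (\<Sum>b\<in>Basis. (\<xi> \<bullet> b) *\<^sub>R b) x" by (simp add: euclidean_representation)
    also have "\<dots> = (\<Sum>b\<in>Basis. (\<xi> \<bullet> b) * D x0 b x)"
      by (simp add: linear_sum[OF linear_D] linear_cmul[OF linear_D])
    finally show ?thesis .
  qed
  have "hess v \<bullet> \<xi> = (\<Sum>b\<in>Basis. (\<integral>x. D x0 v x * D x0 b x / t x \<partial>\<gamma>) * (\<xi> \<bullet> b))"
    by (simp add: hess_def inner_sum_left inner_commute[of \<xi>])
  also have "\<dots> = (\<integral>x. (\<Sum>b\<in>Basis. (\<xi> \<bullet> b) * (D x0 v x * D x0 b x / t x)) \<partial>\<gamma>)"
    by (subst Bochner_Integration.integral_sum)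
      (use hess_integrable in \<open>auto simp: mult.commute simp del: times_divide_eq_right\<close>)
  also have "(\<lambda>x. \<Sum>b\<in>Basis. (\<xi> \<bullet> b) * (D x0 v x * D x0 b x / t x)) = (\<lambda>x. D x0 v x * D x0 \<xi> x / t x)"
    by (auto simp: D[of x for x] sum_distrib_left sum_divide_distrib mult_ac)
  finally show ?thesis .
qed

lemma hess_sym: "hess v \<bullet> \<xi> = v \<bullet> hess \<xi>"
  by (simp add: hess_inner inner_commute[of v] mult.commute)

lemma linear_hess: "linear hess"
proof
  show "hess (u + v) = hess u + hess v" for u v
    by (rule vector_eq_rdot[THEN iffD1]) (simp add: hess_sym inner_add_left)
  show "hess (c *\<^sub>R v) = c *\<^sub>R hess v" for c v
    by (rule vector_eq_rdot[THEN iffD1]) (simp add: hess_sym)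
qed

lemma hess_kernel:
  assumes "hess v = 0"
  shows "D x0 v x = 0"
proof -
  have "(\<integral>x. D x0 v x * D x0 v x / t x \<partial>\<gamma>) = 0"
    using assms hess_inner[of v v] by simp
  then have "AE x in \<gamma>. D x0 v x * D x0 v x / t x = 0"
    by (subst (asm) integral_nonneg_eq_0_iff_AE[OF hess_integrable])
      (auto simp: t_pos less_imp_le)
  \<comment> \<open>The case \<open>v = 0\<close> of \<open>nondegenerate\<close> upgrades the
    identity from almost every to every point.\<close>
  then have "AE x in \<gamma>. D x0 v x + D2 0 0 x / 2 = 0"
    using D2_simps(3)[of 0 0 0] t_pos by (auto simp: less_imp_neq[THEN not_sym])
  then show ?thesis using nondegenerate by blast
qed

lemma excess_le: "norm v < 1 \<Longrightarrow> \<bar>s (x0 + v) x - t x\<bar> \<le> norm v * E x"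
  using s_lipschitz[OF x0_in_ball, of "x0 + v" x] by (simp add: t_eq dist_norm)

lemma gradient_x0: "gradient x0 = 0"
  by (rule vector_eq_rdot[THEN iffD1]) (simp add: gradient_inner_excess t_eq)

text \<open>The three factors excess, derivative and reciprocal density are replaced by their
  leading parts one at a time. Each replacement gains one more power of |v|, whence the constant
  3.\<close>

lemma gradient_taylor:
  assumes v: "norm v < 1"
  shows "norm (gradient (x0 + v) - hess v) \<le> 3 * (norm v)\<^sup>2 * moment 5"
proof (rule norm_le_of_inner_le)
  fix \<xi>
  have xv: "x0 + v \<in> ball x0 1" using v by (simp add: dist_norm)
  let ?h = "\<lambda>x. s (x0 + v) x - t x" and ?q = "\<lambda>x. 1 / s (x0 + v) x"
  let ?D = "\<lambda>x. D (x0 + v) \<xi> x"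
  let ?f = "\<lambda>x. ?h x * ?D x / s (x0 + v) x - D x0 v x * D x0 \<xi> x / t x"
  have le: "\<bar>?f x\<bar> \<le> (3 * (norm v)\<^sup>2 * norm \<xi>) * E x ^ 5" for x
  proof -
    have pos: "0 < t x" "0 < s (x0 + v) x" using t_pos s_pos by auto
    have e1: "\<bar>?h x - D x0 v x\<bar> \<le> (norm v)\<^sup>2 * E x"
      using s_taylor[OF x0_in_ball xv, of x] by (simp add: t_eq)
    have e2: "\<bar>?D x - D x0 \<xi> x\<bar> \<le> norm v * norm \<xi> * E x"
      using D_lipschitz[OF x0_in_ball xv, of \<xi> x] by simp
    have e3: "\<bar>?q x - 1 / t x\<bar> \<le> norm v * E x ^ 3"
    proof -
      have "\<bar>1 / s (x0 + v) x - 1 / t x\<bar> \<le> 0 * E x + 1 * (norm v * E x) * (E x)\<^sup>2"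
        by (rule quotient_diff_bound)
          (use pos s_ge[OF xv] t_ge excess_le[OF v] in auto)
      then show ?thesis by (simp add: eval_nat_numeral mult_ac)
    qed
    have "?f x = (?h x - D x0 v x) * ?D x * ?q x + D x0 v x * (?D x - D x0 \<xi> x) * ?q x
        + D x0 v x * D x0 \<xi> x * (?q x - 1 / t x)"
      by (simp add: algebra_simps diff_divide_distrib)
    moreover have "\<bar>(?h x - D x0 v x) * ?D x * ?q x\<bar> \<le> ((norm v)\<^sup>2 * E x) * (norm \<xi> * E x) * E x"
      by (rule abs_mult3_le[OF e1 D_le[OF xv] inverse_le_abs(2)[OF xv]])
    moreover have "\<bar>D x0 v x * (?D x - D x0 \<xi> x) * ?q x\<bar> \<le> (norm v * E x) * (norm v * norm \<xi> * E x) * E x"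
      by (rule abs_mult3_le[OF D_le[OF x0_in_ball] e2 inverse_le_abs(2)[OF xv]])
    moreover have "\<bar>D x0 v x * D x0 \<xi> x * (?q x - 1 / t x)\<bar> \<le> (norm v * E x) * (norm \<xi> * E x) * (norm v * E x ^ 3)"
      by (rule abs_mult3_le[OF D_le[OF x0_in_ball] D_le[OF x0_in_ball] e3])
    moreover have "((norm v)\<^sup>2 * E x) * (norm \<xi> * E x) * E x = (norm v)\<^sup>2 * norm \<xi> * E x ^ 3"
      "(norm v * E x) * (norm v * norm \<xi> * E x) * E x = (norm v)\<^sup>2 * norm \<xi> * E x ^ 3"
      "(norm v * E x) * (norm \<xi> * E x) * (norm v * E x ^ 3) = (norm v)\<^sup>2 * norm \<xi> * E x ^ 5"
      by (simp_all add: eval_nat_numeral)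
    ultimately have "\<bar>?f x\<bar> \<le> ((norm v)\<^sup>2 * norm \<xi>) * (E x ^ 3 + E x ^ 3 + E x ^ 5)"
      unfolding distrib_left by linarith
    also have "\<dots> \<le> ((norm v)\<^sup>2 * norm \<xi>) * (E x ^ 5 + E x ^ 5 + E x ^ 5)"
      using E_power_mono[of 3 5 x] by (intro mult_left_mono) auto
    finally show ?thesis by (simp add: algebra_simps)
  qed
  have int: "integrable \<gamma> (\<lambda>x. ?h x * ?D x / s (x0 + v) x)"
  proof -
    have "integrable \<gamma> (\<lambda>x. ?f x + D x0 v x * D x0 \<xi> x / t x)"
      by (intro Bochner_Integration.integrable_add hess_integrable integral_bound(1)[OF _ le]) measurable
    then show ?thesis by simp
  qed
  have "(gradient (x0 + v) - hess v) \<bullet> \<xi> = (\<integral>x. ?f x \<partial>\<gamma>)"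
    using int hess_integrable by (simp add: inner_diff_left gradient_inner_excess[OF xv] hess_inner)
  also have "\<bar>\<dots>\<bar> \<le> (3 * (norm v)\<^sup>2 * norm \<xi>) * moment 5"
    by (rule integral_bound(2)[OF _ le]) measurable
  finally show "\<bar>(gradient (x0 + v) - hess v) \<bullet> \<xi>\<bar> \<le> 3 * (norm v)\<^sup>2 * moment 5 * norm \<xi>"
    by (simp add: mult_ac)
qed (simp add: moment_nonneg)

lemma gradient_has_derivative: "(gradient has_derivative hess) (at x0)"
  unfolding has_derivative_at
proof (intro conjI)
  show "bounded_linear hess" by (rule linear_conv_bounded_linear[THEN iffD1, OF linear_hess])
  show "(\<lambda>h. norm (gradient (x0 + h) - gradient x0 - hess h) / norm h) \<midarrow>0\<rightarrow> 0"
  proof (rule Lim_null_comparison)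
    show "((\<lambda>h::'a. 3 * norm h * moment 5) \<longlongrightarrow> 0) (at 0)" by (auto intro!: tendsto_eq_intros)
    have "eventually (\<lambda>h::'a. norm h < 1) (at 0)"
      by (rule order_tendstoD(2)[where y = 0]) (auto intro!: tendsto_eq_intros)
    then show "eventually (\<lambda>h. norm (norm (gradient (x0 + h) - gradient x0 - hess h) / norm h)
        \<le> 3 * norm h * moment 5) (at 0)"
    proof (rule eventually_mono)
      fix h :: 'a assume "norm h < 1"
      from gradient_taylor[OF this]
      show "norm (norm (gradient (x0 + h) - gradient x0 - hess h) / norm h) \<le> 3 * norm h * moment 5"
        by (cases "h = 0") (auto simp: divide_le_eq moment_nonneg gradient_x0 power2_eq_square mult_ac)
    qed
  qed
qed

section \<open>The leading part of the excess and its energy\<close>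

lemma model_le: "\<bar>model v e x\<bar> \<le> (norm e + (norm v)\<^sup>2) * E x"
proof -
  have "\<bar>model v e x\<bar> \<le> norm e * E x + norm v * norm v * E x / 2"
    using D_le[OF x0_in_ball, of e x] D2_le[of v v x] unfolding model_def by linarith
  moreover have "0 \<le> norm v * norm v * E x" using E_pos[of x] by simp
  ultimately show ?thesis by (simp add: power2_eq_square algebra_simps)
qed

lemma model_energy_integrable: "integrable \<gamma> (\<lambda>x. (model v e x)\<^sup>2 / t x)"
proof (rule integral_bound(1))
  fix x
  show "\<bar>(model v e x)\<^sup>2 / t x\<bar> \<le> ((norm e + (norm v)\<^sup>2)\<^sup>2) * E x ^ 3"
    using abs_mult3_le[OF model_le[of v e x] model_le[of v e x] inverse_le_abs(1)[of x]]
    by (simp add: eval_nat_numeral mult_ac)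
qed measurable

lemma model_energy_pos:
  assumes "v \<noteq> 0"
  shows "0 < model_energy v e"
proof -
  have nn: "0 \<le> (model v e x)\<^sup>2 / t x" for x using t_pos[of x] by simp
  then have "0 \<le> model_energy v e" unfolding model_energy_def by (intro integral_nonneg_AE AE_I2) 
  moreover have "model_energy v e \<noteq> 0"
  proof
    assume "model_energy v e = 0"
    then have "AE x in \<gamma>. (model v e x)\<^sup>2 / t x = 0"
      unfolding model_energy_def
      by (subst (asm) integral_nonneg_eq_0_iff_AE[OF model_energy_integrable]) (use nn in auto)
    then have "AE x in \<gamma>. D x0 e x + D2 v v x / 2 = 0"
      using t_pos by (auto simp: model_def less_imp_neq[THEN not_sym])
    then show False using nondegenerate assms by blast
  qed
  ultimately show ?thesis by simp
qed

lemma model_energy_diff: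
  "\<bar>model_energy v e - model_energy v' e'\<bar>
    \<le> (norm (e - e') + norm (v - v') * (norm v + norm v'))
      * (norm e + (norm v)\<^sup>2 + norm e' + (norm v')\<^sup>2) * moment 3"
proof -
  let ?f = "\<lambda>x. (model v e x)\<^sup>2 / t x - (model v' e' x)\<^sup>2 / t x"
  let ?a = "norm (e - e') + norm (v - v') * (norm v + norm v')"
  let ?b = "norm e + (norm v)\<^sup>2 + norm e' + (norm v')\<^sup>2"
  have le: "\<bar>?f x\<bar> \<le> (?a * ?b) * E x ^ 3" for x
  proof -
    \<comment> \<open>Symmetry of \<open>D2\<close> factors the difference of the quadratic forms:
      D2(v, v) - D2(v', v') = D2(v - v', v) + D2(v - v', v').\<close>
    have eq: "model v e x - model v' e' x = D x0 (e - e') x + (D2 (v - v') v x + D2 (v - v') v' x) / 2"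
      by (simp add: model_def D_simps D2_simps D2_sym[of v' v] field_simps)
    have "\<bar>model v e x - model v' e' x\<bar>
        \<le> norm (e - e') * E x + norm (v - v') * norm v * E x + norm (v - v') * norm v' * E x"
      unfolding eq by (rule abs_add_half_le[OF D_le[OF x0_in_ball] D2_le D2_le])
    then have "\<bar>model v e x - model v' e' x\<bar> \<le> ?a * E x" by (simp add: algebra_simps)
    moreover have "\<bar>model v e x + model v' e' x\<bar> \<le> ?b * E x"
      using model_le[of v e x] model_le[of v' e' x] by (simp add: algebra_simps)
    ultimately have "\<bar>(model v e x - model v' e' x) * (model v e x + model v' e' x) * (1 / t x)\<bar>
        \<le> (?a * E x) * (?b * E x) * E x"
      by (rule abs_mult3_le[OF _ _ inverse_le_abs(1)])
    also have "(model v e x - model v' e' x) * (model v e x + model v' e' x) * (1 / t x) = ?f x"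
      by (simp add: power2_eq_square algebra_simps diff_divide_distrib)
    finally show ?thesis by (simp add: power3_eq_cube mult_ac)
  qed
  have "model_energy v e - model_energy v' e' = (\<integral>x. ?f x \<partial>\<gamma>)"
    using model_energy_integrable by (simp add: model_energy_def)
  also have "\<bar>\<dots>\<bar> \<le> (?a * ?b) * moment 3" by (rule integral_bound(2)[OF _ le]) measurable
  finally show ?thesis .
qed

lemma continuous_on_model_energy: "continuous_on A (\<lambda>z. model_energy (fst z) (snd z))"
proof (rule continuous_at_imp_continuous_on, rule ballI)
  fix z :: "'a \<times> 'a"
  let ?b = "\<lambda>y. (norm (snd y - snd z) + norm (fst y - fst z) * (norm (fst y) + norm (fst z)))
      * (norm (snd y) + (norm (fst y))\<^sup>2 + norm (snd z) + (norm (fst z))\<^sup>2) * moment 3"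
  have "((\<lambda>y. model_energy (fst y) (snd y) - model_energy (fst z) (snd z)) \<longlongrightarrow> 0) (at z)"
  proof (rule Lim_null_comparison)
    have "(?b \<longlongrightarrow> ?b z) (at z)" by (intro tendsto_intros)
    then show "(?b \<longlongrightarrow> 0) (at z)" by simp
  qed (use model_energy_diff in auto)
  then show "isCont (\<lambda>z. model_energy (fst z) (snd z)) z"
    unfolding isCont_def by (simp add: LIM_zero_iff)
qed

text \<open>\<open>model\<close> is homogeneous of degree 2 when \<open>v\<close> has weight 1 and
  \<open>e\<close> weight 2, so the energy has degree 4. Rescaling moves \<open>v\<close> to the
  unit sphere and \<open>e\<close> into a fixed ball, where the continuous positive energy attains a
  positive minimum.\<close>

lemma model_energy_lower_bound:
  obtains c where "0 < c" and "\<And>v e. norm e \<le> R * (norm v)\<^sup>2 \<Longrightarrow> c * (norm v) ^ 4 \<le> model_energy v e"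
proof -
  let ?K = "sphere (0::'a) 1 \<times> cball (0::'a) \<bar>R\<bar>"
  obtain b :: 'a where "b \<in> Basis" by (meson nonempty_Basis ex_in_conv)
  then have "(b, 0) \<in> ?K" by simp
  then have "?K \<noteq> {}" by blast
  moreover have "compact ?K" by (intro compact_Times compact_sphere compact_cball)
  ultimately obtain z where z: "z \<in> ?K"
    "\<And>y. y \<in> ?K \<Longrightarrow> model_energy (fst z) (snd z) \<le> model_energy (fst y) (snd y)"
    using continuous_attains_inf[OF _ _ continuous_on_model_energy] by metis
  define c where "c = model_energy (fst z) (snd z)"
  have "0 < c" unfolding c_def using z(1) by (intro model_energy_pos) auto
  moreover have "c * (norm v) ^ 4 \<le> model_energy v e" if e: "norm e \<le> R * (norm v)\<^sup>2" for v e
  proof (cases "v = 0")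
    case True
    have "0 \<le> model_energy v e"
      unfolding model_energy_def using t_pos by (intro integral_nonneg_AE AE_I2) (simp add: less_imp_le)
    then show ?thesis using True by simp
  next
    case False
    define r where "r = norm v"
    have r: "0 < r" using False by (simp add: r_def)
    define v' where "v' = (1 / r) *\<^sub>R v"
    define e' where "e' = (1 / r\<^sup>2) *\<^sub>R e"
    have ve: "v = r *\<^sub>R v'" "e = r\<^sup>2 *\<^sub>R e'" using r by (simp_all add: v'_def e'_def)
    have "norm e' \<le> \<bar>R\<bar>" using e r abs_ge_self[of R] unfolding e'_def r_def[symmetric]
      by (simp add: divide_le_eq) (meson mult_right_mono order_trans zero_le_power2)
    moreover have "norm v' = 1" using r by (simp add: v'_def r_def)
    ultimately have "c \<le> model_energy v' e'" using z(2)[of "(v', e')"] by (simp add: c_def)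
    then have "c * r ^ 4 \<le> model_energy v' e' * r ^ 4" using r by (intro mult_right_mono) auto
    also have "model_energy v' e' * r ^ 4 = model_energy v e"
    proof -
      have "model v e x = r\<^sup>2 * model v' e' x" for x
        by (simp add: ve model_def D_simps D2_simps power2_eq_square algebra_simps)
      then have eq: "(model v e x)\<^sup>2 / t x = r ^ 4 * ((model v' e' x)\<^sup>2 / t x)" for x
        by (simp add: power_mult_distrib)
      show ?thesis unfolding model_energy_def eq integral_mult_right_zero by (rule mult.commute)
    qed
    finally show ?thesis by (simp add: r_def)
  qed
  ultimately show ?thesis by (rule that)
qed

text \<open>Along \<open>ker H\<close> the excess \<open>s - t\<close> is to leading order the model function, which is
  homogeneous of degree 2 when \<open>e\<close> is given weight 2; \<open>v + 2e\<close> is the corresponding Euler field.\<close>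

lemma degenerate_expansion:
  fixes v e :: 'a and C :: real
  defines "k \<equiv> 4 + 8 * C" and "r \<equiv> norm (v + e)"
  assumes C: "0 \<le> C" and v: "\<And>x. D x0 v x = 0" and e: "norm e \<le> C * r\<^sup>2"
    and r: "r \<le> 1 / 2" "C * r \<le> 1 / 2"
  shows "\<bar>s (x0 + (v + e)) x - t x\<bar> \<le> 2 * k * r\<^sup>2 * E x"
    and "2 * model_energy v e - 6 * k\<^sup>2 * r ^ 5 * moment 5 \<le> gradient (x0 + (v + e)) \<bullet> (v + 2 *\<^sub>R e)"
proof -
  let ?x = "x0 + (v + e)" and ?\<xi> = "v + 2 *\<^sub>R e"
  have r0: "0 \<le> r" "norm (v + e) < 1" using r by (auto simp: r_def)
  then have xb: "?x \<in> ball x0 1"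
    by (metis add_diff_cancel_left' dist_norm mem_ball norm_minus_commute)
  have er: "norm e \<le> r / 2"
    using e mult_right_mono[OF r(2) r0(1)] by (simp add: power2_eq_square)
  have "norm v \<le> r + norm e" using norm_triangle_ineq4[of "v + e" e] by (simp add: r_def)
  then have vr: "norm v \<le> 2 * r" using er r0 by linarith
  have "norm ?\<xi> \<le> r + norm e"
    using norm_triangle_ineq[of "v + e" e] by (simp add: r_def scaleR_2 add.assoc)
  then have \<xi>r: "norm ?\<xi> \<le> 2 * r" using er r0 by linarith
  have r1: "r ^ 3 \<le> r\<^sup>2" using r r0 by (intro power_decreasing) auto
  have Cr: "C * r\<^sup>2 * r = C * r ^ 3" by (simp add: eval_nat_numeral)
  \<comment> \<open>The single constant \<open>k\<close> dominates the three that arise below: 4 + C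
    for the model, 1 + 4 C for the excess and 2 + 6 C for the derivative.\<close>
  have k: "0 \<le> k" using C by (simp add: k_def)
  let ?h = "\<lambda>x. s ?x x - t x" and ?D = "\<lambda>x. D ?x ?\<xi> x" and ?T = "model v e"
  have Te: "\<bar>?T x\<bar> \<le> k * r\<^sup>2 * E x" for x
  proof -
    have "(norm v)\<^sup>2 \<le> (2 * r)\<^sup>2" using vr by (intro power_mono) auto
    then have "norm e + (norm v)\<^sup>2 \<le> C * r\<^sup>2 + 4 * r\<^sup>2" using e by (simp add: power_mult_distrib)
    also have "\<dots> \<le> k * r\<^sup>2" using C by (simp add: k_def algebra_simps)
    finally show ?thesis
      using model_le[of v e x] mult_right_mono[OF _ E_pos(2)[of x]] order_trans by blast
  qed
  have De: "\<bar>D2 a e x\<bar> \<le> 2 * C * r ^ 3 * E x" if "norm a \<le> 2 * r" for a x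
  proof -
    have "norm a * norm e \<le> (2 * r) * (C * r\<^sup>2)" using that e r0 by (intro mult_mono) auto
    then have "norm a * norm e * E x \<le> (2 * r) * (C * r\<^sup>2) * E x" using E_pos[of x] by (intro mult_right_mono) auto
    then show ?thesis using D2_le[of a e x] by (simp add: eval_nat_numeral mult_ac)
  qed
  have rr2: "norm (v + e) \<le> 2 * r" by (simp add: r_def)
  \<comment> \<open>In D2(v + e, v + e) every term containing \<open>e\<close> has weight at least 3
    and joins the Taylor remainder; what is left of the excess is \<open>model v e\<close>, because
    D x0 v vanishes.\<close>
  have e1: "\<bar>?h x - ?T x\<bar> \<le> k * r ^ 3 * E x" for x
  proof -
    have "D2 (v + e) (v + e) x = D2 v v x + D2 (v + e) e x + D2 v e x"
      by (simp add: D2_simps D2_sym[of e v])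
    then have "?h x - ?T x = (s ?x x - s x0 x - D x0 (v + e) x - D2 (v + e) (v + e) x / 2)
        + (D2 (v + e) e x + D2 v e x) / 2"
      by (simp add: t_eq model_def D_simps v field_simps)
    also have "\<bar>\<dots>\<bar> \<le> r ^ 3 * E x + 2 * C * r ^ 3 * E x + 2 * C * r ^ 3 * E x"
      using s_taylor3[OF r0(2), of x] De[OF rr2, of x] De[OF vr, of x] unfolding r_def
      by (rule abs_add_half_le)
    also have "\<dots> \<le> k * r ^ 3 * E x"
    proof -
      have "r ^ 3 * E x + 2 * C * r ^ 3 * E x + 2 * C * r ^ 3 * E x = (1 + 4 * C) * (r ^ 3 * E x)" by (simp add: algebra_simps)
      also have "\<dots> \<le> k * (r ^ 3 * E x)"
        using C r0 E_pos[of x] by (intro mult_right_mono) (auto simp: k_def)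
      finally show ?thesis by (simp add: mult_ac)
    qed
    finally show ?thesis .
  qed
  \<comment> \<open>Euler's identity for degree 2: the leading part of the derivative along
    \<open>v + 2 *\<^sub>R e\<close> is 2 D e + D2(v, v), which is twice the model.\<close>
  have e2: "\<bar>?D x - 2 * ?T x\<bar> \<le> k * r ^ 3 * E x" for x
  proof -
    have "D2 (v + e) ?\<xi> x = D2 v v x + 2 * D2 (v + e) e x + D2 v e x"
      by (simp add: D2_simps D2_sym[of e v])
    then have "?D x - 2 * ?T x = (D ?x ?\<xi> x - D x0 ?\<xi> x - D2 (v + e) ?\<xi> x)
        + (2 * D2 (v + e) e x + D2 v e x)"
      by (simp add: model_def D_simps v field_simps)
    moreover have "\<bar>D ?x ?\<xi> x - D x0 ?\<xi> x - D2 (v + e) ?\<xi> x\<bar> \<le> 2 * r ^ 3 * E x"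
    proof -
      have "r\<^sup>2 * norm ?\<xi> \<le> r\<^sup>2 * (2 * r)" using \<xi>r by (intro mult_left_mono) auto
      then have "r\<^sup>2 * norm ?\<xi> * E x \<le> 2 * r ^ 3 * E x"
        using E_pos[of x] by (intro mult_right_mono) (auto simp: eval_nat_numeral)
      then show ?thesis using D_taylor[OF r0(2), of ?\<xi> x] unfolding r_def by linarith
    qed
    moreover note De[OF rr2, of x] De[OF vr, of x]
    ultimately have "\<bar>?D x - 2 * ?T x\<bar> \<le> 2 * r ^ 3 * E x + 6 * C * r ^ 3 * E x" by linarith
    also have "\<dots> \<le> k * r ^ 3 * E x"
    proof -
      have "2 * r ^ 3 * E x + 6 * C * r ^ 3 * E x = (2 + 6 * C) * (r ^ 3 * E x)" by (simp add: algebra_simps)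
      also have "\<dots> \<le> k * (r ^ 3 * E x)"
        using C r0 E_pos[of x] by (intro mult_right_mono) (auto simp: k_def)
      finally show ?thesis by (simp add: mult_ac)
    qed
    finally show ?thesis .
  qed
  have le23: "k * r ^ 3 * E x \<le> k * r\<^sup>2 * E x" for x
    using r1 k E_pos[of x] by (intro mult_right_mono mult_left_mono) auto
  show "\<bar>s ?x x - t x\<bar> \<le> 2 * k * r\<^sup>2 * E x" for x
    using e1[of x] Te[of x] le23[of x] by linarith
  have Dk: "\<bar>?D x\<bar> \<le> 3 * k * r\<^sup>2 * E x" for x
    using e2[of x] Te[of x] le23[of x] by linarith
  let ?f = "\<lambda>x. ?h x * ?D x / s ?x x - 2 * ((?T x)\<^sup>2 / t x)"
  have le: "\<bar>?f x\<bar> \<le> (6 * k\<^sup>2 * r ^ 5) * E x ^ 5" for x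
  proof -
    have e3: "\<bar>1 / s ?x x - 1 / t x\<bar> \<le> r * E x ^ 3"
    proof -
      have "\<bar>1 / s ?x x - 1 / t x\<bar> \<le> 0 * E x + 1 * (r * E x) * (E x)\<^sup>2"
        by (rule quotient_diff_bound)
          (use t_pos s_pos s_ge[OF xb] t_ge excess_le[OF r0(2)] in \<open>auto simp: r_def\<close>)
      then show ?thesis by (simp add: eval_nat_numeral mult_ac)
    qed
    \<comment> \<open>The product is compared with T (2 T) / t one factor at a time; each
      replacement gains a power of r over the leading order r^4.\<close>
    have eq: "?f x = (?h x - ?T x) * ?D x * (1 / s ?x x) + ?T x * (?D x - 2 * ?T x) * (1 / s ?x x)
        + 2 * (?T x * ?T x * (1 / s ?x x - 1 / t x))"
      by (simp add: algebra_simps diff_divide_distrib power2_eq_square)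
    have b1: "\<bar>(?h x - ?T x) * ?D x * (1 / s ?x x)\<bar> \<le> (k * r ^ 3 * E x) * (3 * k * r\<^sup>2 * E x) * E x"
      by (rule abs_mult3_le[OF e1 Dk inverse_le_abs(2)[OF xb]])
    have b2: "\<bar>?T x * (?D x - 2 * ?T x) * (1 / s ?x x)\<bar> \<le> (k * r\<^sup>2 * E x) * (k * r ^ 3 * E x) * E x"
      by (rule abs_mult3_le[OF Te e2 inverse_le_abs(2)[OF xb]])
    have b3: "\<bar>?T x * ?T x * (1 / s ?x x - 1 / t x)\<bar> \<le> (k * r\<^sup>2 * E x) * (k * r\<^sup>2 * E x) * (r * E x ^ 3)"
      by (rule abs_mult3_le[OF Te Te e3])
    have ks: "(k * r ^ 3 * E x) * (3 * k * r\<^sup>2 * E x) * E x = 3 * (k\<^sup>2 * r ^ 5 * E x ^ 3)"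
      "(k * r\<^sup>2 * E x) * (k * r ^ 3 * E x) * E x = k\<^sup>2 * r ^ 5 * E x ^ 3"
      "(k * r\<^sup>2 * E x) * (k * r\<^sup>2 * E x) * (r * E x ^ 3) = k\<^sup>2 * r ^ 5 * E x ^ 5"
      by (simp_all add: eval_nat_numeral)
    have "\<bar>?f x\<bar> \<le> 3 * (k\<^sup>2 * r ^ 5 * E x ^ 3) + k\<^sup>2 * r ^ 5 * E x ^ 3 + 2 * (k\<^sup>2 * r ^ 5 * E x ^ 5)"
      using abs_add3_le[OF b1 b2 b3] unfolding eq ks .
    moreover have "k\<^sup>2 * r ^ 5 * E x ^ 3 \<le> k\<^sup>2 * r ^ 5 * E x ^ 5"
      using E_power_mono[of 3 5 x] r0 by (intro mult_left_mono) auto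
    ultimately show ?thesis by linarith
  qed
  have intf: "integrable \<gamma> ?f" by (rule integral_bound(1)[OF _ le]) measurable
  have int2: "integrable \<gamma> (\<lambda>x. 2 * ((?T x)\<^sup>2 / t x))"
    using model_energy_integrable by (rule integrable_mult_right)
  have "gradient ?x \<bullet> ?\<xi> = (\<integral>x. ?f x + 2 * ((?T x)\<^sup>2 / t x) \<partial>\<gamma>)"
    by (simp add: gradient_inner_excess[OF xb])
  also have "\<dots> = (\<integral>x. ?f x \<partial>\<gamma>) + 2 * model_energy v e"
    by (subst Bochner_Integration.integral_add[OF intf int2])
      (simp only: model_energy_def integral_mult_right_zero)
  finally show "2 * model_energy v e - 6 * k\<^sup>2 * r ^ 5 * moment 5 \<le> gradient ?x \<bullet> ?\<xi>"
    using integral_bound(2)[OF _ le] by (simp add: abs_le_iff)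
qed

text \<open>The lower bound divides the quartic growth along the Euler field by the length of that
  field, at most 2 r. The upper bound is the chi-square bound for an excess of order r^2; the extra
  displacement \<open>u\<close> leaves room for points off the ravine.\<close>

lemma degenerate_bounds:
  assumes C: "0 \<le> C"
  obtains c \<rho> K where "0 < c" "0 < \<rho>" "\<rho> \<le> 1 / 2" "0 \<le> K"
    and "\<And>v e. (\<forall>x. D x0 v x = 0) \<Longrightarrow> norm e \<le> C * (norm (v + e))\<^sup>2 \<Longrightarrow> norm (v + e) \<le> \<rho> \<Longrightarrow>
        c * norm (v + e) ^ 3 \<le> norm (gradient (x0 + (v + e)))"
    and "\<And>v e u. (\<forall>x. D x0 v x = 0) \<Longrightarrow> norm e \<le> C * (norm (v + e))\<^sup>2 \<Longrightarrow> norm (v + e) \<le> \<rho> \<Longrightarrow>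
        norm u \<le> (norm (v + e))\<^sup>2 \<Longrightarrow> loss (x0 + (v + e) + u) \<le> K * norm (v + e) ^ 4"
proof -
  define k where "k = 4 + 8 * C"
  have k: "0 < k" using C by (simp add: k_def)
  obtain c0 where c0: "0 < c0"
    "\<And>v e. norm e \<le> 4 * C * (norm v)\<^sup>2 \<Longrightarrow> c0 * (norm v) ^ 4 \<le> model_energy v e"
    using model_energy_lower_bound[of "4 * C"] by metis
  define N where "N = 6 * k\<^sup>2 * moment 5"
  have N: "0 \<le> N" by (simp add: N_def moment_nonneg)
  \<comment> \<open>The second entry makes \<open>e\<close> at most a quarter of r, the third keeps
    the fifth-order error below c0 r^4 / 16.\<close>
  define \<rho> where "\<rho> = min (1 / 2) (min (1 / (4 * (C + 1))) (c0 / (16 * (N + 1))))"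
  have \<rho>: "0 < \<rho>" "\<rho> \<le> 1 / 2" "C * \<rho> \<le> 1 / 4" "N * \<rho> \<le> c0 / 16"
  proof -
    show "0 < \<rho>" using C N c0 by (auto simp: \<rho>_def)
    show "\<rho> \<le> 1 / 2" unfolding \<rho>_def by (rule min.cobounded1)
    have "\<rho> \<le> 1 / (4 * (C + 1))" "\<rho> \<le> c0 / (16 * (N + 1))" by (auto simp: \<rho>_def)
    then have a: "\<rho> * (4 * (C + 1)) \<le> 1" "\<rho> * (16 * (N + 1)) \<le> c0"
      using C N by (auto simp: field_simps)
    then show "C * \<rho> \<le> 1 / 4" "N * \<rho> \<le> c0 / 16" using \<open>0 < \<rho>\<close> by (auto simp: algebra_simps)
  qed
  have facts: "C * norm (v + e) \<le> 1 / 4" "norm (v + e) \<le> 1 / 2" "N * norm (v + e) \<le> c0 / 16"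
    if "norm (v + e) \<le> \<rho>" for v e
    using that \<rho> mult_left_mono[OF that C] mult_left_mono[OF that N] by linarith+
  show ?thesis
  proof (rule that)
    show "0 < c0 / 32" using c0 by simp
    show "0 < \<rho>" "\<rho> \<le> 1 / 2" by fact+
    show "0 \<le> (2 * k + 1)\<^sup>2 * moment 3" by (simp add: moment_nonneg)
  next
    fix v e :: 'a assume v: "\<forall>x. D x0 v x = 0" and e: "norm e \<le> C * (norm (v + e))\<^sup>2" and r: "norm (v + e) \<le> \<rho>"
    define r where "r = norm (v + e)"
    note f = facts[OF r, folded r_def]
    have r0: "0 \<le> r" by (simp add: r_def)
    show "c0 / 32 * norm (v + e) ^ 3 \<le> norm (gradient (x0 + (v + e)))"
    proof (cases "r = 0")
      case False
      then have r1: "0 < r" using r0 by simp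
      have "C * r\<^sup>2 \<le> r / 4" using mult_right_mono[OF f(1) r0] by (simp add: power2_eq_square)
      then have e4: "norm e \<le> r / 4" using e by (simp add: r_def)
      have "r \<le> norm v + norm e" using norm_triangle_ineq[of v e] by (simp add: r_def)
      \<comment> \<open>As \<open>e\<close> is of higher order, r is at most 2 |v|. This is the
        origin of the 4 in \<open>4 * C\<close> and of the 16 in the quartic bound.\<close>
      then have v2: "r / 2 \<le> norm v" using e4 r0 by linarith
      have "(r / 2)\<^sup>2 \<le> (norm v)\<^sup>2" using v2 r0 by (intro power_mono) auto
      then have "C * r\<^sup>2 \<le> 4 * C * (norm v)\<^sup>2"
        using mult_left_mono[of "r\<^sup>2" "4 * (norm v)\<^sup>2" C] C by (simp add: power_divide mult_ac)
      then have "norm e \<le> 4 * C * (norm v)\<^sup>2" using e by (simp add: r_def)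
      from c0(2)[OF this] have "c0 * (norm v) ^ 4 \<le> model_energy v e" .
      moreover have "c0 * (r / 2) ^ 4 \<le> c0 * (norm v) ^ 4"
        using v2 r0 c0(1) by (intro mult_left_mono power_mono) auto
      ultimately have Q: "c0 * r ^ 4 / 16 \<le> model_energy v e" by (simp add: power_divide)
      \<comment> \<open>Twice c0 r^4 / 16 minus an error of at most one such term leaves c0 r^4 /
        16; division by 2 r yields the constant c0 / 32.\<close>
      have "2 * model_energy v e - 6 * k\<^sup>2 * r ^ 5 * moment 5 \<le> gradient (x0 + (v + e)) \<bullet> (v + 2 *\<^sub>R e)"
        using degenerate_expansion(2)[OF C, of v e] v e f unfolding k_def r_def by auto
      moreover have "6 * k\<^sup>2 * r ^ 5 * moment 5 \<le> c0 * r ^ 4 / 16"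
        using mult_right_mono[OF f(3), of "r ^ 4"] r0 by (simp add: N_def eval_nat_numeral mult_ac)
      ultimately have "c0 * r ^ 4 / 16 \<le> gradient (x0 + (v + e)) \<bullet> (v + 2 *\<^sub>R e)" using Q by linarith
      also have "\<dots> \<le> norm (gradient (x0 + (v + e))) * norm (v + 2 *\<^sub>R e)" by (rule norm_cauchy_schwarz)
      also have "\<dots> \<le> norm (gradient (x0 + (v + e))) * (2 * r)"
      proof (rule mult_left_mono)
        have "norm (v + 2 *\<^sub>R e) \<le> r + norm e"
          using norm_triangle_ineq[of "v + e" e] by (simp add: r_def scaleR_2 add.assoc)
        then show "norm (v + 2 *\<^sub>R e) \<le> 2 * r" using e4 r0 by linarith
      qed simp
      finally have "(c0 / 32 * r ^ 3) * (2 * r) \<le> norm (gradient (x0 + (v + e))) * (2 * r)"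
        by (simp add: eval_nat_numeral)
      then show ?thesis using r1 unfolding r_def[symmetric] by (simp only: mult_le_cancel_right_pos)
    qed (simp add: r_def)
    fix u :: 'a assume u: "norm u \<le> (norm (v + e))\<^sup>2"
    have ru: "r\<^sup>2 \<le> 1 / 4" using f(2) r0 power_mono[of r "1/2" 2] by (simp add: power_divide)
    have "norm (v + e) < 1" using f(2) by (simp add: r_def)
    then have xv: "x0 + (v + e) \<in> ball x0 1"
      by (metis add_diff_cancel_left' dist_norm mem_ball norm_minus_commute)
    have "norm (v + e + u) < 1"
      using norm_triangle_ineq[of "v + e" u] u ru f(2) unfolding r_def by linarith
    then have xu: "x0 + (v + e) + u \<in> ball x0 1"
      by (metis add.assoc add_diff_cancel_left' dist_norm mem_ball norm_minus_commute)
    have "loss (x0 + (v + e) + u) \<le> ((2 * k + 1) * r\<^sup>2)\<^sup>2 * moment 3"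
    proof (rule loss_le[OF xu])
      fix x
      have "\<bar>s (x0 + (v + e)) x - t x\<bar> \<le> 2 * k * r\<^sup>2 * E x"
        using degenerate_expansion(1)[OF C, of v e x] v e f unfolding k_def r_def by auto
      moreover have "\<bar>s (x0 + (v + e) + u) x - s (x0 + (v + e)) x\<bar> \<le> norm u * E x"
        using s_lipschitz[OF xv xu, of x] by simp
      moreover have "norm u * E x \<le> r\<^sup>2 * E x"
        using u E_pos[of x] unfolding r_def by (intro mult_right_mono) auto
      ultimately have "\<bar>s (x0 + (v + e) + u) x - t x\<bar> \<le> 2 * k * r\<^sup>2 * E x + r\<^sup>2 * E x" by linarith
      then show "\<bar>s (x0 + (v + e) + u) x - t x\<bar> \<le> (2 * k + 1) * r\<^sup>2 * E x" by (simp add: algebra_simps)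
    qed
    then show "loss (x0 + (v + e) + u) \<le> (2 * k + 1)\<^sup>2 * moment 3 * norm (v + e) ^ 4"
      by (simp add: r_def power_mult_distrib mult_ac flip: power_mult)
  qed
qed

end

section \<open>Nearest-point projection and stability of the Polyak step\<close>

lemma grad_eq:
  assumes "GDERIV f x :> D"
  shows "grad f x = D"
  unfolding grad_def
proof (rule the_equality)
  show "GDERIV f x :> D" by fact
  fix D' assume "GDERIV f x :> D'"
  then have "(\<lambda>h. h \<bullet> D') = (\<lambda>h. h \<bullet> D)"
    using assms has_derivative_unique unfolding gderiv_def by blast
  then show "D' = D" by (metis vector_eq_ldot)
qed

lemma orth_proj_eq_0D:
  fixes T :: "'a::euclidean_space set"
  assumes "subspace T" "orth_proj T x = 0" "v \<in> T"
  shows "x \<bullet> v = 0"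
proof -
  obtain p z where pz: "p \<in> T" "\<And>w. w \<in> T \<Longrightarrow> orthogonal z w" "x = p + z"
    using orthogonal_subspace_decomp_exists[of T x] span_eq_iff[THEN iffD2, OF assms(1)] by auto
  have "orth_proj T x = p"
    unfolding orth_proj_def
  proof (rule the_equality)
    show "p \<in> T \<and> (\<forall>t\<in>T. orthogonal (x - p) t)" using pz by auto
    fix p' assume p': "p' \<in> T \<and> (\<forall>t\<in>T. orthogonal (x - p') t)"
    have "p' - p \<in> T" using pz p' assms(1) by (auto intro: subspace_diff)
    then have "(x - p) \<bullet> (p' - p) = 0" "(x - p') \<bullet> (p' - p) = 0"
      using pz p' by (auto simp: orthogonal_def)
    then have "(p' - p) \<bullet> (p' - p) = 0" by (simp add: inner_diff_left inner_diff_right)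
    then show "p' = p" by simp
  qed
  then show ?thesis using pz assms by (auto simp: orthogonal_def)
qed

section \<open>Smoothness along lines\<close>

lemma Ck_on_cong:
  assumes "open X" "\<And>x. x \<in> X \<Longrightarrow> f x = g x" "Ck_on k X f"
  shows "Ck_on k X g"
  using assms(2,3)
proof (induction k arbitrary: f g)
  case 0
  then show ?case using continuous_on_cong[of X X f g] by simp
next
  case (Suc k)
  have d: "(g has_derivative frechet_derivative f (at x)) (at x)" if x: "x \<in> X" for x
  proof (rule has_derivative_transform_within_open[OF _ assms(1) x Suc.prems(1)])
    show "(f has_derivative frechet_derivative f (at x)) (at x)"
      using Suc.prems(2) x by (subst frechet_derivative_works[symmetric]) simp
  qed
  show ?case
    unfolding Ck_on.simps
  proof (intro conjI ballI allI)
    show "g differentiable (at x)" if "x \<in> X" for x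
      using d[OF that] by (rule differentiableI)
    show "Ck_on k X (\<lambda>x. frechet_derivative g (at x) v)" for v
    proof (rule Suc.IH)
      show "Ck_on k X (\<lambda>x. frechet_derivative f (at x) v)" using Suc.prems(2) by simp
      show "frechet_derivative f (at x) v = frechet_derivative g (at x) v" if "x \<in> X" for x
        by (rule fun_cong[OF frechet_derivative_at[OF d[OF that]]])
    qed
  qed
qed

text \<open>Needed because tangent vectors are velocities of smooth curves: it makes the projection
  of a straight line an admissible curve.\<close>

lemma Ck_on_line:
  fixes f :: "'a::real_normed_vector \<Rightarrow> 'b::real_normed_vector"
  assumes "open I" and X: "\<And>t. t \<in> I \<Longrightarrow> x + t *\<^sub>R v \<in> X" and "Ck_on k X f"
  shows "Ck_on k I (\<lambda>t::real. f (x + t *\<^sub>R v))"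
  using assms(3)
proof (induction k arbitrary: f)
  case 0
  have "continuous_on I (\<lambda>t. f (x + t *\<^sub>R v))"
  proof (rule continuous_on_compose2[of X f I "\<lambda>t. x + t *\<^sub>R v"])
    show "continuous_on X f" using 0 by simp
    show "continuous_on I (\<lambda>t. x + t *\<^sub>R v)" by (intro continuous_intros)
    show "(\<lambda>t. x + t *\<^sub>R v) ` I \<subseteq> X" using X by blast
  qed
  then show ?case by simp
next
  case (Suc k)
  define D where "D = (\<lambda>y. frechet_derivative f (at y))"
  have D: "(f has_derivative D y) (at y)" if "y \<in> X" for y
    using Suc.prems that unfolding D_def by (subst frechet_derivative_works[symmetric]) simp
  have d: "((\<lambda>t. f (x + t *\<^sub>R v)) has_derivative (\<lambda>s. D (x + t *\<^sub>R v) (s *\<^sub>R v))) (at t)"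
    if "t \<in> I" for t
  proof -
    have "((\<lambda>t. x + t *\<^sub>R v) has_derivative (\<lambda>s. s *\<^sub>R v)) (at t)"
      using has_derivative_add[OF has_derivative_const has_derivative_scaleR_left[OF has_derivative_ident]]
      by simp
    then show ?thesis using D[OF X[OF that]] by (rule has_derivative_compose)
  qed
  have "Ck_on k I (\<lambda>t. frechet_derivative (\<lambda>t. f (x + t *\<^sub>R v)) (at t) s)" for s
  proof -
    have "Ck_on k X (\<lambda>y. D y (s *\<^sub>R v))" using Suc.prems unfolding D_def by simp
    then have ck: "Ck_on k I (\<lambda>t. D (x + t *\<^sub>R v) (s *\<^sub>R v))" by (rule Suc.IH)
    have eq: "D (x + t *\<^sub>R v) (s *\<^sub>R v) = frechet_derivative (\<lambda>t. f (x + t *\<^sub>R v)) (at t) s"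
      if "t \<in> I" for t
      using frechet_derivative_at[OF d[OF that]] by (rule fun_cong)
    show ?thesis by (rule Ck_on_cong[OF assms(1) eq ck])
  qed
  moreover have "(\<lambda>t. f (x + t *\<^sub>R v)) differentiable (at t)" if "t \<in> I" for t
    using d[OF that] by (rule differentiableI)
  ultimately show ?case unfolding Ck_on.simps by blast
qed

section \<open>The nearest-point projection and its differential\<close>

locale smooth_projection =
  fixes M U :: "'a::euclidean_space set" and x0 :: 'a and K :: "'a set"
  assumes open_U: "open U" and x0_U: "x0 \<in> U" and x0_M: "x0 \<in> M"
    and proj: "\<forall>x\<in>U. \<exists>!y. y \<in> M \<and> (\<forall>z\<in>M. dist x y \<le> dist x z)"
    and smooth: "smooth_on U (closest_point M)"
    and tangent: "tangent_space M x0 = K" and subspace_K: "subspace K"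
begin

abbreviation P :: "'a \<Rightarrow> 'a" where "P \<equiv> closest_point M"

abbreviation DP :: "'a \<Rightarrow> 'a \<Rightarrow> 'a" where "DP x \<equiv> frechet_derivative P (at x)"

text \<open>\<open>M\<close> is not assumed closed, so that the choice in
  \<open>closest_point\<close> really selects a nearest point is drawn from
  \<open>proj\<close>.\<close>

lemma P_nearest:
  assumes "x \<in> U"
  shows "P x \<in> M \<and> (\<forall>z\<in>M. dist x (P x) \<le> dist x z)"
proof -
  have "\<exists>y. y \<in> M \<and> (\<forall>z\<in>M. dist x y \<le> dist x z)"
    using bspec[OF proj assms] by (rule ex1_implies_ex)
  then show ?thesis unfolding closest_point_def by (rule someI_ex)
qed

lemma P_in: "x \<in> U \<Longrightarrow> P x \<in> M"
  using P_nearest by blast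

lemma P_le: "x \<in> U \<Longrightarrow> z \<in> M \<Longrightarrow> dist x (P x) \<le> dist x z"
  using P_nearest by blast

lemma P_fixed:
  assumes "x \<in> U" "x \<in> M"
  shows "P x = x"
proof -
  have "dist x (P x) \<le> 0" using P_le[OF assms] unfolding dist_self .
  then show ?thesis unfolding dist_le_zero_iff by (rule sym)
qed

lemma P_x0: "P x0 = x0"
  by (rule P_fixed[OF x0_U x0_M])

lemma has_derivative_P: 
  assumes "x \<in> U"
  shows "(P has_derivative DP x) (at x)"
proof -
  have "Ck_on (Suc 0) U P" using smooth unfolding smooth_on_def by blast
  then show ?thesis using assms by (subst frechet_derivative_works[symmetric]) simp
qed

lemma linear_DP: "x \<in> U \<Longrightarrow> linear (DP x)"
  using has_derivative_P has_derivative_linear by blast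

lemma P_line_has_vector_derivative:
  "((\<lambda>t. P (x0 + t *\<^sub>R v)) has_vector_derivative DP x0 v) (at 0)"
proof -
  have "((\<lambda>t. x0 + t *\<^sub>R v) has_derivative (\<lambda>t. t *\<^sub>R v)) (at 0)"
    using has_derivative_add[OF has_derivative_const has_derivative_scaleR_left[OF has_derivative_ident]]
    by simp
  moreover have "(P has_derivative DP x0) (at (x0 + 0 *\<^sub>R v))"
    using has_derivative_P[OF x0_U] by simp
  ultimately have "((\<lambda>t. P (x0 + t *\<^sub>R v)) has_derivative (\<lambda>t. DP x0 (t *\<^sub>R v))) (at 0)"
    by (rule has_derivative_compose)
  then show ?thesis
    by (simp add: has_vector_derivative_def linear_cmul[OF linear_DP[OF x0_U]])
qed

lemma line_in_U:
  obtains \<epsilon> where "0 < \<epsilon>" "\<And>t. t \<in> {-\<epsilon><..<\<epsilon>} \<Longrightarrow> x0 + t *\<^sub>R v \<in> U"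
proof -
  obtain e where e: "0 < e" "ball x0 e \<subseteq> U" using open_U x0_U openE by blast
  show ?thesis
  proof (rule that[of "e / (norm v + 1)"])
    show "0 < e / (norm v + 1)" using e by (simp add: add_nonneg_pos)
    fix t assume t: "t \<in> {- (e / (norm v + 1))<..<e / (norm v + 1)}"
    have "\<bar>t\<bar> * norm v \<le> \<bar>t\<bar> * (norm v + 1)" by (intro mult_left_mono) auto
    also have "\<dots> < e"
    proof -
      have "\<bar>t\<bar> < e / (norm v + 1)" using t by (auto simp: abs_less_iff)
      then show ?thesis by (subst (asm) pos_less_divide_eq) (auto simp: add_nonneg_pos)
    qed
    finally have "x0 + t *\<^sub>R v \<in> ball x0 e" by (simp add: dist_norm)
    then show "x0 + t *\<^sub>R v \<in> U" using e by blast
  qed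
qed

text \<open>The projection carries the line through \<open>x0\<close> with direction
  \<open>v\<close> to a smooth curve in \<open>M\<close>, whose velocity is
  \<open>DP x0 v\<close>.\<close>

lemma DP_in_tangent: "DP x0 v \<in> K"
proof -
  obtain \<epsilon> where \<epsilon>: "0 < \<epsilon>" "\<And>t. t \<in> {-\<epsilon><..<\<epsilon>} \<Longrightarrow> x0 + t *\<^sub>R v \<in> U" using line_in_U by blast
  have "smooth_on {-\<epsilon><..<\<epsilon>} (\<lambda>t. P (x0 + t *\<^sub>R v))"
    using smooth \<epsilon>(2) unfolding smooth_on_def by (auto intro!: Ck_on_line[where X = U])
  moreover have "(\<lambda>t. P (x0 + t *\<^sub>R v)) ` {-\<epsilon><..<\<epsilon>} \<subseteq> M" using \<epsilon>(2) P_in by blast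
  ultimately have "DP x0 v \<in> tangent_space M x0"
    unfolding tangent_space_def using \<epsilon>(1) P_line_has_vector_derivative[of v] P_x0
    by (intro CollectI exI[of _ "\<lambda>t. P (x0 + t *\<^sub>R v)"] exI[of _ \<epsilon>]) auto
  then show ?thesis by (simp add: tangent)
qed

text \<open>The point \<open>x0 + t *\<^sub>R v\<close> is at least as close to its projection as to
  a curve in \<open>M\<close> with velocity \<open>h\<close>. Dividing both distances by |t| and
  letting t tend to 0 yields the claim.\<close>

lemma DP_nearest:
  assumes "h \<in> K"
  shows "norm (v - DP x0 v) \<le> norm (v - h)"
proof -
  obtain \<gamma> \<epsilon> where \<gamma>: "0 < \<epsilon>" "\<gamma> ` {-\<epsilon><..<\<epsilon>} \<subseteq> M" "\<gamma> 0 = x0" "(\<gamma> has_vector_derivative h) (at 0)"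
    using assms tangent unfolding tangent_space_def by blast
  obtain \<epsilon>' where \<epsilon>': "0 < \<epsilon>'" "\<And>t. t \<in> {-\<epsilon>'<..<\<epsilon>'} \<Longrightarrow> x0 + t *\<^sub>R v \<in> U" using line_in_U by blast
  have lim: "((\<lambda>t. norm ((1 / t) *\<^sub>R c t)) \<longlongrightarrow> norm d) (at 0)"
    if "(c has_vector_derivative d) (at 0)" "c 0 = 0" for c :: "real \<Rightarrow> 'a" and d
  proof -
    have "((\<lambda>t. norm (c t - t *\<^sub>R d) / norm t) \<longlongrightarrow> 0) (at 0)"
      using that by (simp add: has_vector_derivative_def has_derivative_at)
    moreover have "eventually (\<lambda>t. norm (c t - t *\<^sub>R d) / norm t = norm ((1 / t) *\<^sub>R c t - d)) (at 0)"
    proof (rule eventually_at_filter[THEN iffD2], rule always_eventually, intro allI impI)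
      fix t :: real assume t: "t \<noteq> 0"
      then have "(1 / t) *\<^sub>R c t - d = (1 / t) *\<^sub>R (c t - t *\<^sub>R d)" by (simp add: scaleR_diff_right)
      then show "norm (c t - t *\<^sub>R d) / norm t = norm ((1 / t) *\<^sub>R c t - d)" by simp
    qed
    ultimately have "((\<lambda>t. norm ((1 / t) *\<^sub>R c t - d)) \<longlongrightarrow> 0) (at 0)"
      by (rule Lim_transform_eventually)
    then have "((\<lambda>t. (1 / t) *\<^sub>R c t) \<longlongrightarrow> d) (at 0)"
      using tendsto_norm_zero_iff LIM_zero_iff by blast
    then show ?thesis by (rule tendsto_norm)
  qed
  let ?g = "\<lambda>t. x0 + t *\<^sub>R v - P (x0 + t *\<^sub>R v)" and ?k = "\<lambda>t. x0 + t *\<^sub>R v - \<gamma> t"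
  have line: "((\<lambda>t. x0 + t *\<^sub>R v) has_vector_derivative v) (at 0)"
    by (auto simp: has_vector_derivative_def intro!: derivative_eq_intros)
  show ?thesis
  proof (rule tendsto_le)
    show "((\<lambda>t. norm ((1 / t) *\<^sub>R ?g t)) \<longlongrightarrow> norm (v - DP x0 v)) (at 0)"
      by (rule lim[OF has_vector_derivative_diff[OF line P_line_has_vector_derivative]]) (simp add: P_x0)
    show "((\<lambda>t. norm ((1 / t) *\<^sub>R ?k t)) \<longlongrightarrow> norm (v - h)) (at 0)"
      by (rule lim[OF has_vector_derivative_diff[OF line \<gamma>(4)]]) (simp add: \<gamma>)
    have "eventually (\<lambda>t. t \<in> {-\<epsilon><..<\<epsilon>}) (at (0::real))" "eventually (\<lambda>t. t \<in> {-\<epsilon>'<..<\<epsilon>'}) (at (0::real))"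
      by (rule eventually_at_in_open', use \<gamma>(1) \<epsilon>'(1) in simp, use \<gamma>(1) \<epsilon>'(1) in simp)+
    then show "eventually (\<lambda>t. norm ((1 / t) *\<^sub>R ?g t) \<le> norm ((1 / t) *\<^sub>R ?k t)) (at 0)"
    proof eventually_elim
      case (elim t)
      have "norm (?g t) \<le> norm (?k t)"
        using P_le[OF \<epsilon>'(2)[OF elim(2)] subsetD[OF \<gamma>(2) imageI[OF elim(1)]]] unfolding dist_norm .
      then show ?case unfolding norm_scaleR by (intro mult_left_mono) auto
    qed
  qed simp
qed

text \<open>\<open>DP x0 v\<close> is a nearest point of \<open>K\<close> to \<open>v\<close>, so
  the variational inequality holds for every direction of \<open>K\<close> and its negative.\<close>

lemma DP_orthogonal:
  assumes "k \<in> K"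
  shows "(v - DP x0 v) \<bullet> k = 0"
proof -
  have "(v - DP x0 v) \<bullet> (DP x0 v + c - DP x0 v) \<le> 0" if "c \<in> K" for c
  proof (rule any_closest_point_dot[where S = K])
    show "convex K" "closed K" using subspace_K by (auto intro: subspace_imp_convex closed_subspace)
    show "DP x0 v \<in> K" by (rule DP_in_tangent)
    then show "DP x0 v + c \<in> K" using that subspace_K by (auto intro: subspace_add)
    show "\<forall>z\<in>K. dist v (DP x0 v) \<le> dist v z" using DP_nearest by (simp add: dist_norm)
  qed
  from this[OF assms] this[of "- k"] show ?thesis
    using assms subspace_K by (simp add: subspace_neg)
qed

text \<open>Two derivatives of the projection make each \<open>DP x b\<close> differentiable at
  \<open>x0\<close>; the bounds for the finitely many basis vectors \<open>b\<close> are combined by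
  linearity. The estimate is anchored at \<open>x0\<close>, which is the form used.\<close>

lemma DP_lipschitz_at:
  obtains \<rho> C where "0 < \<rho>" "0 \<le> C" "ball x0 \<rho> \<subseteq> U"
    and "\<And>x \<xi>. x \<in> ball x0 \<rho> \<Longrightarrow> norm (DP x \<xi> - DP x0 \<xi>) \<le> C * norm (x - x0) * norm \<xi>"
proof -
  have "\<exists>d C. 0 < d \<and> 0 \<le> C \<and> (\<forall>x. norm (x - x0) < d \<longrightarrow> norm (DP x b - DP x0 b) \<le> C * norm (x - x0))" for b
  proof -
    have "Ck_on (Suc (Suc 0)) U P" using smooth unfolding smooth_on_def by blast
    then have "Ck_on (Suc 0) U (\<lambda>x. DP x b)" by (subst (asm) Ck_on.simps(2)) blast
    then have "(\<lambda>x. DP x b) differentiable (at x0)" using x0_U by (subst (asm) Ck_on.simps(2)) blast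
    then obtain D where D: "((\<lambda>x. DP x b) has_derivative D) (at x0)" unfolding differentiable_def by blast
    then obtain d where d: "0 < d" "\<And>x. norm (x - x0) < d \<Longrightarrow> norm (DP x b - DP x0 b - D (x - x0)) \<le> 1 * norm (x - x0)"
      using D[unfolded has_derivative_at_alt] zero_less_one by blast
    have bl: "bounded_linear D" using D by (rule has_derivative_bounded_linear)
    show ?thesis
    proof (intro exI conjI allI impI)
      show "0 < d" by fact
      show "0 \<le> onorm D + 1" using onorm_pos_le[OF bl] by simp
      fix x assume "norm (x - x0) < d"
      have "norm (DP x b - DP x0 b) \<le> norm (DP x b - DP x0 b - D (x - x0)) + norm (D (x - x0))"
        by (metis diff_add_cancel norm_triangle_ineq)
      also have "\<dots> \<le> 1 * norm (x - x0) + onorm D * norm (x - x0)"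
        using d(2)[OF \<open>norm (x - x0) < d\<close>] onorm[OF bl, of "x - x0"] by (rule add_mono)
      finally show "norm (DP x b - DP x0 b) \<le> (onorm D + 1) * norm (x - x0)" by (simp add: algebra_simps)
    qed
  qed
  then obtain d C where dC: "\<And>b. 0 < d b" "\<And>b. 0 \<le> C b"
    "\<And>b x. norm (x - x0) < d b \<Longrightarrow> norm (DP x b - DP x0 b) \<le> C b * norm (x - x0)"
    by metis
  obtain e where e: "0 < e" "ball x0 e \<subseteq> U" using open_U x0_U openE by blast
  define \<rho> where "\<rho> = Min (insert e (d ` Basis))"
  show ?thesis
  proof (rule that)
    show "0 < \<rho>" using dC e by (auto simp: \<rho>_def)
    have "\<rho> \<le> e" by (simp add: \<rho>_def)
    then show U: "ball x0 \<rho> \<subseteq> U" using e by force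
    show "0 \<le> (\<Sum>b\<in>Basis. C b)" using dC by (intro sum_nonneg) auto
    fix x \<xi> assume x: "x \<in> ball x0 \<rho>"
    then have nx: "norm (x - x0) < d b" if "b \<in> Basis" for b
      using that by (simp add: \<rho>_def dist_norm norm_minus_commute)
    have lin: "DP y \<xi> = (\<Sum>b\<in>Basis. (\<xi> \<bullet> b) *\<^sub>R DP y b)" if "y \<in> U" for y
    proof -
      have "DP y \<xi> = DP y (\<Sum>b\<in>Basis. (\<xi> \<bullet> b) *\<^sub>R b)" by (simp add: euclidean_representation)
      then show ?thesis
        by (simp add: linear_sum[OF linear_DP[OF that]] linear_cmul[OF linear_DP[OF that]])
    qed
    have "DP x \<xi> - DP x0 \<xi> = (\<Sum>b\<in>Basis. (\<xi> \<bullet> b) *\<^sub>R (DP x b - DP x0 b))"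
      using x U by (auto simp: lin[OF x0_U] lin[of x] sum_subtractf scaleR_diff_right)
    also have "norm \<dots> \<le> (\<Sum>b\<in>Basis. norm \<xi> * (C b * norm (x - x0)))"
    proof (rule sum_norm_le)
      fix b :: 'a assume b: "b \<in> Basis"
      show "norm ((\<xi> \<bullet> b) *\<^sub>R (DP x b - DP x0 b)) \<le> norm \<xi> * (C b * norm (x - x0))"
        using dC(3)[OF nx[OF b]] Basis_le_norm[OF b, of \<xi>] by (auto intro!: mult_mono)
    qed
    also have "\<dots> = (\<Sum>b\<in>Basis. C b) * norm (x - x0) * norm \<xi>"
      by (simp add: sum_distrib_right sum_distrib_left mult_ac)
    finally show "norm (DP x \<xi> - DP x0 \<xi>) \<le> (\<Sum>b\<in>Basis. C b) * norm (x - x0) * norm \<xi>" .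
  qed
qed

lemma P_quantitative:
  obtains \<rho> C L where "0 < \<rho>" "0 \<le> C" "0 < L" "ball x0 \<rho> \<subseteq> U"
    and "\<And>x \<xi>. x \<in> ball x0 \<rho> \<Longrightarrow> norm (DP x \<xi> - DP x0 \<xi>) \<le> C * norm (x - x0) * norm \<xi>"
    and "\<And>x y. x \<in> ball x0 \<rho> \<Longrightarrow> y \<in> ball x0 \<rho> \<Longrightarrow> norm (P x - P y) \<le> L * norm (x - y)"
    and "\<And>x. x \<in> ball x0 \<rho> \<Longrightarrow> norm (P x - x0 - DP x0 (x - x0)) \<le> C * (norm (x - x0))\<^sup>2"
proof -
  obtain \<rho> C where \<rho>: "0 < \<rho>" "0 \<le> C" "ball x0 \<rho> \<subseteq> U"
    and lip: "\<And>x \<xi>. x \<in> ball x0 \<rho> \<Longrightarrow> norm (DP x \<xi> - DP x0 \<xi>) \<le> C * norm (x - x0) * norm \<xi>"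
    by (rule DP_lipschitz_at) (rule that)
  have bl: "bounded_linear (DP x)" if "x \<in> U" for x
    using has_derivative_P[OF that] by (rule has_derivative_bounded_linear)
  show ?thesis
  proof (rule that[of \<rho> C "onorm (DP x0) + C * \<rho> + 1"])
    show "0 < \<rho>" "0 \<le> C" "ball x0 \<rho> \<subseteq> U" by (fact \<rho>)+
    show "norm (DP x \<xi> - DP x0 \<xi>) \<le> C * norm (x - x0) * norm \<xi>" if "x \<in> ball x0 \<rho>" for x \<xi>
      by (rule lip[OF that])
    show "0 < onorm (DP x0) + C * \<rho> + 1"
      using onorm_pos_le[OF bl[OF x0_U]] mult_nonneg_nonneg[OF \<rho>(2) less_imp_le[OF \<rho>(1)]] by linarith
    show "norm (P x - P y) \<le> (onorm (DP x0) + C * \<rho> + 1) * norm (x - y)"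
      if xy: "x \<in> ball x0 \<rho>" "y \<in> ball x0 \<rho>" for x y
    proof (rule differentiable_bound[OF convex_ball _ _ xy])
      fix z assume z: "z \<in> ball x0 \<rho>"
      show "(P has_derivative DP z) (at z within ball x0 \<rho>)"
        by (rule has_derivative_at_withinI[OF has_derivative_P[OF subsetD[OF \<rho>(3) z]]])
      show "onorm (DP z) \<le> onorm (DP x0) + C * \<rho> + 1"
      proof (rule onorm_le)
        fix \<xi> :: 'a
        have "norm (DP z \<xi>) \<le> norm (DP z \<xi> - DP x0 \<xi>) + norm (DP x0 \<xi>)"
          using norm_triangle_ineq[of "DP z \<xi> - DP x0 \<xi>" "DP x0 \<xi>"] by simp
        also have "\<dots> \<le> C * norm (z - x0) * norm \<xi> + onorm (DP x0) * norm \<xi>"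
          by (rule add_mono[OF lip[OF z] onorm[OF bl[OF x0_U]]])
        also have "C * norm (z - x0) * norm \<xi> \<le> C * \<rho> * norm \<xi>"
          using z \<rho> by (intro mult_right_mono mult_left_mono) (auto simp: dist_norm norm_minus_commute)
        finally show "norm (DP z \<xi>) \<le> (onorm (DP x0) + C * \<rho> + 1) * norm \<xi>"
          using norm_ge_zero[of \<xi>] unfolding distrib_right by linarith
      qed
    qed
    fix x assume x: "x \<in> ball x0 \<rho>"
    \<comment> \<open>The projection minus its linearization has derivative at most C |x - x0| on
      the ball through \<open>x\<close>; the mean value inequality then gives the quadratic
      remainder.\<close>
    let ?g = "\<lambda>z. P z - DP x0 z" and ?B = "cball x0 (norm (x - x0))"
    have sub: "?B \<subseteq> ball x0 \<rho>" using x by (auto simp: dist_norm norm_minus_commute)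
    have "norm (?g x - ?g x0) \<le> C * norm (x - x0) * norm (x - x0)"
    proof (rule differentiable_bound[OF convex_cball])
      fix z assume z: "z \<in> ?B"
      then have zU: "z \<in> U" "z \<in> ball x0 \<rho>" using sub \<rho> by auto
      show "(?g has_derivative (\<lambda>\<xi>. DP z \<xi> - DP x0 \<xi>)) (at z within ?B)"
        by (rule has_derivative_diff[OF has_derivative_at_withinI[OF has_derivative_P[OF zU(1)]]
            bounded_linear_imp_has_derivative[OF bl[OF x0_U]]])
      show "onorm (\<lambda>\<xi>. DP z \<xi> - DP x0 \<xi>) \<le> C * norm (x - x0)"
      proof (rule onorm_le)
        fix \<xi> :: 'a
        have "C * norm (z - x0) * norm \<xi> \<le> C * norm (x - x0) * norm \<xi>"
          using z \<rho> by (intro mult_right_mono mult_left_mono) (auto simp: dist_norm norm_minus_commute)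
        then show "norm (DP z \<xi> - DP x0 \<xi>) \<le> C * norm (x - x0) * norm \<xi>"
          using lip[OF zU(2), of \<xi>] by linarith
      qed
    qed (simp_all add: dist_norm norm_minus_commute)
    moreover have "?g x - ?g x0 = P x - x0 - DP x0 (x - x0)"
      unfolding P_x0 linear_diff[OF linear_DP[OF x0_U]] by simp
    ultimately show "norm (P x - x0 - DP x0 (x - x0)) \<le> C * (norm (x - x0))\<^sup>2"
      unfolding power2_eq_square by (simp only: mult.assoc)
  qed
qed

end


text \<open>The displacement is a multiple of the inversion u / |u|^2, and inversion distorts
  distances exactly by the factor 1 / (|u| |v|).\<close>

lemma polyak_displacement_diff:
  fixes u v :: "'a::real_inner"
  assumes "0 < \<alpha>" "\<alpha> \<le> norm u" "\<alpha> \<le> norm v" and b: "\<bar>b\<bar> \<le> \<beta>"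
    and ab: "\<bar>a - b\<bar> \<le> x" and uv: "norm (u - v) \<le> y"
  shows "norm ((a / (norm u)\<^sup>2) *\<^sub>R u - (b / (norm v)\<^sup>2) *\<^sub>R v) \<le> x / \<alpha> + \<beta> * y / \<alpha>\<^sup>2"
proof -
  have pos: "0 < norm u" "0 < norm v" using assms by auto
  have inv: "norm ((1 / (norm u)\<^sup>2) *\<^sub>R u - (1 / (norm v)\<^sup>2) *\<^sub>R v) = norm (u - v) / (norm u * norm v)"
    (is "norm ?w = _")
  proof (rule power2_eq_imp_eq)
    define p where "p = norm u"
    define r where "r = norm v"
    have pr: "u \<bullet> u = p\<^sup>2" "v \<bullet> v = r\<^sup>2" "0 < p" "0 < r"
      using pos by (simp_all add: p_def r_def dot_square_norm)
    have w: "?w = (1 / p\<^sup>2) *\<^sub>R u - (1 / r\<^sup>2) *\<^sub>R v" by (simp add: p_def r_def)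
    have "(norm ?w)\<^sup>2 = (1 / p\<^sup>2) * ((1 / p\<^sup>2) * p\<^sup>2) - 2 * ((1 / p\<^sup>2) * ((1 / r\<^sup>2) * (u \<bullet> v)))
        + (1 / r\<^sup>2) * ((1 / r\<^sup>2) * r\<^sup>2)"
      unfolding w power2_norm_eq_inner
        inner_diff_left inner_diff_right inner_scaleR_left inner_scaleR_right pr inner_commute[of v u]
      by (simp add: algebra_simps)
    also have "\<dots> = (p\<^sup>2 - 2 * (u \<bullet> v) + r\<^sup>2) / (p * r)\<^sup>2"
      using pr(3,4) by (simp add: field_simps)
    also have "p\<^sup>2 - 2 * (u \<bullet> v) + r\<^sup>2 = (norm (u - v))\<^sup>2"
      unfolding power2_norm_eq_inner[of "u - v"] inner_diff_left inner_diff_right pr inner_commute[of v u] by simp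
    finally show "(norm ?w)\<^sup>2 = (norm (u - v) / (norm u * norm v))\<^sup>2"
      by (simp add: power_divide p_def r_def)
  qed auto
  have "(a / (norm u)\<^sup>2) *\<^sub>R u - (b / (norm v)\<^sup>2) *\<^sub>R v
      = ((a - b) / (norm u)\<^sup>2) *\<^sub>R u + b *\<^sub>R ((1 / (norm u)\<^sup>2) *\<^sub>R u - (1 / (norm v)\<^sup>2) *\<^sub>R v)"
    by (simp add: diff_divide_distrib scaleR_diff_left scaleR_diff_right)
  also have "norm \<dots> \<le> \<bar>a - b\<bar> / norm u + \<bar>b\<bar> * (norm (u - v) / (norm u * norm v))"
  proof (rule order_trans[OF norm_triangle_ineq add_mono])
    show "norm (((a - b) / (norm u)\<^sup>2) *\<^sub>R u) \<le> \<bar>a - b\<bar> / norm u"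
      using pos by (simp add: power2_eq_square)
    show "norm (b *\<^sub>R ((1 / (norm u)\<^sup>2) *\<^sub>R u - (1 / (norm v)\<^sup>2) *\<^sub>R v))
        \<le> \<bar>b\<bar> * (norm (u - v) / (norm u * norm v))"
      unfolding norm_scaleR inv by simp
  qed
  also have "\<bar>a - b\<bar> / norm u \<le> x / \<alpha>"
    using assms pos by (intro frac_le) auto
  also have "\<bar>b\<bar> * (norm (u - v) / (norm u * norm v)) \<le> \<beta> * (y / (\<alpha> * \<alpha>))"
  proof (rule mult_mono[OF b])
    have "\<alpha> * \<alpha> \<le> norm u * norm v" using assms by (intro mult_mono) auto
    moreover have "0 \<le> y" using uv norm_ge_zero order_trans by blast
    ultimately show "norm (u - v) / (norm u * norm v) \<le> y / (\<alpha> * \<alpha>)"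
      using assms(1) uv by (intro frac_le) auto
    show "0 \<le> \<beta>" using b by linarith
  qed simp
  finally show ?thesis by (simp add: power2_eq_square)
qed

context smooth_projection
begin

text \<open>At scale \<open>r\<close>, the distance from the projected point to \<open>x0\<close>, the function is of order \<open>r\<^sup>4\<close>
  and its gradient of order \<open>r\<^sup>3\<close>, so that the Polyak displacement has order \<open>r\<close> and reacts to relative
  perturbations of size \<open>\<epsilon>\<close> by \<open>O(\<epsilon>r)\<close>.\<close>

lemma polyak_step_stable:
  fixes f :: "'a \<Rightarrow> real" and G :: "'a \<Rightarrow> 'a"
  assumes G: "\<And>x. x \<in> ball x0 1 \<Longrightarrow> GDERIV f x :> G x"
    and f_nonneg: "\<And>x. x \<in> ball x0 1 \<Longrightarrow> 0 \<le> f x"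
    and lip: "\<And>x y. x \<in> ball x0 1 \<Longrightarrow> y \<in> ball x0 1 \<Longrightarrow> norm (G x - G y) \<le> Lg * norm (x - y)"
    and G_tangent: "\<And>y. y \<in> M \<Longrightarrow> y \<in> ball x0 1 \<Longrightarrow> G y \<in> K"
    and bounds: "\<And>C. 0 \<le> C \<Longrightarrow> \<exists>c>0. \<exists>\<rho>>0. \<exists>N\<ge>0. \<forall>v e. v \<in> K \<longrightarrow> norm e \<le> C * (norm (v + e))\<^sup>2 \<longrightarrow>
        norm (v + e) \<le> \<rho> \<longrightarrow> c * norm (v + e) ^ 3 \<le> norm (G (x0 + (v + e))) \<and>
          (\<forall>u. norm u \<le> (norm (v + e))\<^sup>2 \<longrightarrow> f (x0 + (v + e) + u) \<le> N * norm (v + e) ^ 4)"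
    and contraction: "\<forall>x\<in>U. norm (grad (\<lambda>y. f y - f (P y)) x) \<le> 1 / 100 * norm (grad (\<lambda>y. f (P y)) (P x)) \<longrightarrow>
        norm (P (polyak_step f 0 x) - x0) \<le> q * norm (P x - x0)"
  obtains \<rho> \<tau> \<eta> B where "0 < \<rho>" "0 < \<tau>" "0 < \<eta>" "0 < B" "\<rho> \<le> 1 / 2" "ball x0 \<rho> \<subseteq> U"
    and "\<And>x. x \<in> ball x0 \<rho> \<Longrightarrow> norm (P x - x0) \<le> 1 / 2"
    and "\<And>x a u \<epsilon>. x \<in> ball x0 \<rho> \<Longrightarrow> P x \<noteq> x0 \<Longrightarrow> dist x (P x) \<le> \<tau> * norm (P x - x0) ^ 3 \<Longrightarrow>
        0 \<le> \<epsilon> \<Longrightarrow> \<epsilon> \<le> \<eta> \<Longrightarrow> \<bar>a - f x\<bar> \<le> \<epsilon> * norm (P x - x0) ^ 4 \<Longrightarrow>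
        norm (u - G x) \<le> \<epsilon> * norm (P x - x0) ^ 3 \<Longrightarrow>
        x - (a / (norm u)\<^sup>2) *\<^sub>R u \<in> U \<and>
        norm (P (x - (a / (norm u)\<^sup>2) *\<^sub>R u) - x0) \<le> (q + B * \<epsilon>) * norm (P x - x0)"
proof -
  obtain \<rho>1 C L where \<rho>1: "0 < \<rho>1" "0 \<le> C" "0 < L" "ball x0 \<rho>1 \<subseteq> U"
    and DPlip: "\<And>x \<xi>. x \<in> ball x0 \<rho>1 \<Longrightarrow> norm (DP x \<xi> - DP x0 \<xi>) \<le> C * norm (x - x0) * norm \<xi>"
    and Plip: "\<And>x y. x \<in> ball x0 \<rho>1 \<Longrightarrow> y \<in> ball x0 \<rho>1 \<Longrightarrow> norm (P x - P y) \<le> L * norm (x - y)"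
    and Pquad: "\<And>x. x \<in> ball x0 \<rho>1 \<Longrightarrow> norm (P x - x0 - DP x0 (x - x0)) \<le> C * (norm (x - x0))\<^sup>2"
    by (rule P_quantitative) (rule that)
  from bounds[OF \<rho>1(2)] obtain c \<rho>2 N where c: "0 < c" "0 < \<rho>2" "0 \<le> N"
    and all: "\<forall>v e. v \<in> K \<longrightarrow> norm e \<le> C * (norm (v + e))\<^sup>2 \<longrightarrow>
        norm (v + e) \<le> \<rho>2 \<longrightarrow> c * norm (v + e) ^ 3 \<le> norm (G (x0 + (v + e))) \<and>
          (\<forall>u. norm u \<le> (norm (v + e))\<^sup>2 \<longrightarrow> f (x0 + (v + e) + u) \<le> N * norm (v + e) ^ 4)"
    by (elim exE conjE) (rule that)
  have low: "c * norm (v + e) ^ 3 \<le> norm (G (x0 + (v + e)))"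
    and up: "norm u \<le> (norm (v + e))\<^sup>2 \<Longrightarrow> f (x0 + (v + e) + u) \<le> N * norm (v + e) ^ 4"
    if "v \<in> K" "norm e \<le> C * (norm (v + e))\<^sup>2" "norm (v + e) \<le> \<rho>2" for v e u
    using all[rule_format, OF that] by simp_all
  \<comment> \<open>Controls both a point and its projection: inside all radii, and so small that
    \<open>DP x\<close> differs from \<open>DP x0\<close> by at most 1/400.\<close>
  define \<sigma> where "\<sigma> = min (min (\<rho>1 / 2) (1 / 2)) (min \<rho>2 (1 / (400 * (C + 1))))"
  \<comment> \<open>\<open>Z * \<rho>\<close> bounds how far from \<open>x0\<close> the reference
    and the perturbed step can end: the start contributes \<rho>, the reference displacement r (2 N
    / c), the perturbation r (1 + 4 N / c), and r is at most L \<rho>.\<close>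
  define Z where "Z = 1 + L * (1 + 6 * N / c)"
  define \<rho> where "\<rho> = min (\<sigma> / (L + 1)) (min \<sigma> (\<rho>1 / (2 * Z)))"
  \<comment> \<open>Inside the tube the gradients at the point and at its projection then differ by
    at most 1/400 of the lower bound c r^3.\<close>
  define \<tau> where "\<tau> = min 1 (c / (400 * (\<bar>Lg\<bar> + 1)))"
  define B where "B = L * (4 / c + 16 * N / c\<^sup>2)"
  have Z: "1 \<le> Z" using \<rho>1 c by (simp add: Z_def)
  have \<sigma>: "0 < \<sigma>" using \<rho>1 c by (simp add: \<sigma>_def)
  have \<sigma>le: "\<sigma> \<le> \<rho>1 / 2" "\<sigma> \<le> 1 / 2" "\<sigma> \<le> \<rho>2" "\<sigma> \<le> 1 / (400 * (C + 1))"
    unfolding \<sigma>_def by linarith+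
  have C\<sigma>: "C * \<sigma> \<le> 1 / 400"
  proof -
    have "\<sigma> * (400 * (C + 1)) \<le> 1"
      using \<sigma>le(4) \<rho>1(2) by (subst (asm) pos_le_divide_eq) auto
    then show ?thesis using \<sigma> by (simp add: algebra_simps)
  qed
  have \<rho>: "0 < \<rho>" using \<sigma> \<rho>1 Z by (simp add: \<rho>_def)
  have \<rho>le: "\<rho> \<le> \<sigma> / (L + 1)" "\<rho> \<le> \<sigma>" "\<rho> \<le> \<rho>1 / (2 * Z)" unfolding \<rho>_def by linarith+
  have L\<rho>: "L * \<rho> \<le> \<sigma>"
  proof -
    have "\<rho> * (L + 1) \<le> \<sigma>" using \<rho>le(1) \<rho>1(3) by (subst (asm) pos_le_divide_eq) auto
    then show ?thesis using \<rho> by (simp add: algebra_simps)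
  qed
  have Z\<rho>: "Z * \<rho> < \<rho>1"
  proof -
    have "\<rho> * (2 * Z) \<le> \<rho>1" using \<rho>le(3) Z by (subst (asm) pos_le_divide_eq) auto
    then have "2 * (Z * \<rho>) \<le> \<rho>1" by (simp only: mult_ac)
    then show ?thesis using \<rho>1(1) by linarith
  qed
  have \<tau>: "0 < \<tau>" using c by (simp add: \<tau>_def)
  have \<tau>le: "\<tau> \<le> 1" "\<tau> \<le> c / (400 * (\<bar>Lg\<bar> + 1))" unfolding \<tau>_def by linarith+
  have Lg\<tau>: "\<bar>Lg\<bar> * \<tau> \<le> c / 400"
  proof -
    have "\<tau> * (400 * (\<bar>Lg\<bar> + 1)) \<le> c" using \<tau>le(2) by (subst (asm) pos_le_divide_eq) auto
    then show ?thesis using \<tau> by (simp add: algebra_simps)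
  qed
  have B: "0 < B" unfolding B_def using \<rho>1 c by (intro mult_pos_pos add_pos_nonneg) auto
  have in1: "x \<in> ball x0 \<rho>1" "x \<in> U" "x \<in> ball x0 1" if "norm (x - x0) \<le> \<sigma>" for x
  proof -
    show "x \<in> ball x0 \<rho>1" "x \<in> ball x0 1"
      using that \<sigma>le \<rho>1 by (auto simp: dist_norm norm_minus_commute)
    then show "x \<in> U" using \<rho>1 by blast
  qed
  have x0_1: "x0 \<in> ball x0 \<rho>1" using \<rho>1 by simp
  have Pr: "norm (P x - x0) \<le> L * norm (x - x0)" "norm (P x - x0) \<le> \<sigma>" if "x \<in> ball x0 \<rho>" for x
  proof -
    have nx: "norm (x - x0) \<le> \<rho>" using that by (simp add: dist_norm norm_minus_commute)
    then have "x \<in> ball x0 \<rho>1" using in1 \<rho>le by simp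
    then show 1: "norm (P x - x0) \<le> L * norm (x - x0)" using Plip[OF _ x0_1] by (simp add: P_x0)
    have "L * norm (x - x0) \<le> L * \<rho>" using nx \<rho>1 by (intro mult_left_mono) auto
    then show "norm (P x - x0) \<le> \<sigma>" using 1 L\<rho> by linarith
  qed
  define T where "T = (\<lambda>x. adjoint (DP x) (G (P x)))"
  have T: "GDERIV (\<lambda>y. f (P y)) x :> T x" "T x \<bullet> \<xi> = G (P x) \<bullet> DP x \<xi>"
    if "x \<in> U" "P x \<in> ball x0 1" for x \<xi>
  proof -
    have adj: "\<xi> \<bullet> T x = DP x \<xi> \<bullet> G (P x)" for \<xi>
      unfolding T_def by (rule adjoint_works[OF linear_DP[OF that(1)]])
    then show "T x \<bullet> \<xi> = G (P x) \<bullet> DP x \<xi>" by (simp add: inner_commute)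
    have "((\<lambda>y. f (P y)) has_derivative (\<lambda>\<xi>. DP x \<xi> \<bullet> G (P x))) (at x)"
      using has_derivative_P[OF that(1)] G[OF that(2)] unfolding gderiv_def by (rule has_derivative_compose)
    then show "GDERIV (\<lambda>y. f (P y)) x :> T x" by (simp add: gderiv_def adj)
  qed
  \<comment> \<open>On \<open>M\<close> the gradient lies in \<open>K\<close>, and
    \<open>DP x0\<close> is the orthogonal projection onto \<open>K\<close>, so pairing
    \<open>G y\<close> with \<open>DP x0 \<xi>\<close> or with \<xi> gives the same value. The
    difference thus sees only \<open>DP x - DP x0\<close>.\<close>
  have T_near: "norm (T x - G y) \<le> norm (G y) / 400"
    if x: "norm (x - x0) \<le> \<sigma>" and y: "P x = y" "y \<in> M" "y \<in> ball x0 1" for x y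
  proof (rule norm_le_of_inner_le)
    fix \<xi>
    have "G y \<bullet> (\<xi> - DP x0 \<xi>) = 0"
      using DP_orthogonal[OF G_tangent[OF y(2,3)]] by (simp add: inner_commute)
    then have "(T x - G y) \<bullet> \<xi> = G y \<bullet> (DP x \<xi> - DP x0 \<xi>)"
      using T(2)[of x \<xi>] in1[OF x] y by (simp add: inner_diff_left inner_diff_right)
    also have "\<bar>\<dots>\<bar> \<le> norm (G y) * norm (DP x \<xi> - DP x0 \<xi>)" by (rule Cauchy_Schwarz_ineq2)
    also have "\<dots> \<le> norm (G y) * (1 / 400 * norm \<xi>)"
    proof (rule mult_left_mono)
      have "C * norm (x - x0) \<le> C * \<sigma>" using x \<rho>1 by (intro mult_left_mono) auto
      then have "C * norm (x - x0) * norm \<xi> \<le> 1 / 400 * norm \<xi>" using C\<sigma> by (intro mult_right_mono) auto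
      then show "norm (DP x \<xi> - DP x0 \<xi>) \<le> 1 / 400 * norm \<xi>"
        using DPlip[OF in1(1)[OF x], of \<xi>] by linarith
    qed simp
    finally show "\<bar>(T x - G y) \<bullet> \<xi>\<bar> \<le> norm (G y) / 400 * norm \<xi>" by simp
  qed simp
  show ?thesis
  proof (rule that[of \<rho> \<tau> "c / 4" B])
    show "0 < \<rho>" "0 < \<tau>" "0 < c / 4" "0 < B" using \<rho> \<tau> c B by auto
    show "\<rho> \<le> 1 / 2" using \<rho>le(2) \<sigma>le(2) by linarith
    show "ball x0 \<rho> \<subseteq> U" using in1(2) \<rho>le(2) by (auto simp: dist_norm norm_minus_commute)
    show "norm (P x - x0) \<le> 1 / 2" if "x \<in> ball x0 \<rho>" for x using Pr(2)[OF that] \<sigma>le(2) by linarith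
    fix x a u \<epsilon>
    assume x: "x \<in> ball x0 \<rho>" and nz: "P x \<noteq> x0" and tube: "dist x (P x) \<le> \<tau> * norm (P x - x0) ^ 3"
      and \<epsilon>: "0 \<le> \<epsilon>" "\<epsilon> \<le> c / 4" and a: "\<bar>a - f x\<bar> \<le> \<epsilon> * norm (P x - x0) ^ 4"
      and u: "norm (u - G x) \<le> \<epsilon> * norm (P x - x0) ^ 3"
    define y where "y = P x"
    define r where "r = norm (y - x0)"
    have r: "0 < r" using nz by (simp add: r_def y_def)
    have nx: "norm (x - x0) \<le> \<rho>" using x by (simp add: dist_norm norm_minus_commute)
    then have x\<sigma>: "norm (x - x0) \<le> \<sigma>" using \<rho>le by linarith
    have y\<sigma>: "norm (y - x0) \<le> \<sigma>" using Pr(2)[OF x] by (simp add: y_def)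
    have rL: "r \<le> L * \<rho>"
    proof -
      have "L * norm (x - x0) \<le> L * \<rho>" using nx \<rho>1 by (intro mult_left_mono) auto
      then show ?thesis using Pr(1)[OF x] by (simp add: r_def y_def)
    qed
    have yM: "y \<in> M" using P_in in1(2)[OF x\<sigma>] by (simp add: y_def)
    have Py: "P y = y" by (rule P_fixed[OF in1(2)[OF y\<sigma>] yM])
    have xy: "norm (x - y) \<le> \<tau> * r ^ 3" using tube by (simp add: dist_norm y_def r_def)
    \<comment> \<open>Splits a ravine point into tangential part and curvature remainder. As
      \<open>P y = y\<close>, the remainder \<open>e\<close> is exactly the second-order error of
      the projection at \<open>x0\<close>, hence at most C |y - x0|^2.\<close>
    define v where "v = DP x0 (y - x0)"
    define e where "e = y - x0 - v"
    have ve: "v + e = y - x0" by (simp add: e_def)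
    have vK: "v \<in> K" unfolding v_def by (rule DP_in_tangent)
    have eC: "norm e \<le> C * (norm (v + e))\<^sup>2"
      using Pquad[OF in1(1)[OF y\<sigma>]] unfolding Py ve by (simp add: e_def v_def)
    have ve2: "norm (v + e) \<le> \<rho>2" unfolding ve using y\<sigma> \<sigma>le(3) by linarith
    have Gy: "c * r ^ 3 \<le> norm (G y)" using low[OF vK eC ve2] by (simp add: ve r_def)
    have fx: "f x \<le> N * r ^ 4"
    proof -
      have "\<tau> * r ^ 3 \<le> 1 * r ^ 2"
        using \<tau>le(1) \<tau> r y\<sigma> \<sigma>le(2) unfolding r_def[symmetric] by (intro mult_mono power_decreasing) auto
      then have "norm (x - y) \<le> (norm (v + e))\<^sup>2" using xy by (simp add: ve r_def)
      from up[OF vK eC ve2 this] show ?thesis by (simp add: ve r_def)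
    qed
    have fx0: "0 \<le> f x" by (rule f_nonneg[OF in1(3)[OF x\<sigma>]])
    have Gxy: "norm (G x - G y) \<le> c / 400 * r ^ 3"
    proof -
      have "norm (G x - G y) \<le> Lg * norm (x - y)" by (rule lip[OF in1(3)[OF x\<sigma>] in1(3)[OF y\<sigma>]])
      also have "\<dots> \<le> \<bar>Lg\<bar> * (\<tau> * r ^ 3)" using xy by (intro mult_mono) auto
      also have "\<dots> \<le> c / 400 * r ^ 3" using mult_right_mono[OF Lg\<tau>, of "r ^ 3"] r by (simp add: mult_ac)
      finally show ?thesis .
    qed
    have r3: "0 < c * r ^ 3" using c r by simp
    \<comment> \<open>The lower bound c r^3 at the projected point is halved twice, at
      \<open>x\<close> and for the perturbed gradient \<open>u\<close>; this is why \<eta> is c /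
      4.\<close>
    have Gx: "c / 2 * r ^ 3 \<le> norm (G x)"
      using norm_triangle_ineq2[of "G y" "G y - G x"] Gxy Gy r3 by (simp add: norm_minus_commute)
    have ur: "norm (u - G x) \<le> \<epsilon> * r ^ 3" and ar: "\<bar>a - f x\<bar> \<le> \<epsilon> * r ^ 4"
      using u a by (simp_all add: r_def y_def)
    have ul: "c / 4 * r ^ 3 \<le> norm u"
    proof -
      have "\<epsilon> * r ^ 3 \<le> c / 4 * r ^ 3" using \<epsilon> r by (intro mult_right_mono) auto
      then show ?thesis using norm_triangle_ineq2[of "G x" "G x - u"] Gx ur by (simp add: norm_minus_commute)
    qed
    let ?d = "(f x / (norm (G x))\<^sup>2) *\<^sub>R G x" and ?d' = "(a / (norm u)\<^sup>2) *\<^sub>R u"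
    have dd: "norm (?d' - ?d) \<le> \<epsilon> * r * (4 / c + 16 * N / c\<^sup>2)"
    proof -
      have "norm (?d' - ?d) \<le> (\<epsilon> * r ^ 4) / (c / 4 * r ^ 3) + (N * r ^ 4) * (\<epsilon> * r ^ 3) / (c / 4 * r ^ 3)\<^sup>2"
        by (rule polyak_displacement_diff) (use r3 ul Gx fx fx0 ar ur in auto)
      also have "(\<epsilon> * r ^ 4) / (c / 4 * r ^ 3) = \<epsilon> * r * (4 / c)"
        using r c by (simp add: field_simps eval_nat_numeral)
      also have "(N * r ^ 4) * (\<epsilon> * r ^ 3) / (c / 4 * r ^ 3)\<^sup>2 = \<epsilon> * r * (16 * N / c\<^sup>2)"
        using r c by (simp add: field_simps eval_nat_numeral)
      finally show ?thesis by (simp add: algebra_simps)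
    qed
    have d: "norm ?d \<le> r * (2 * N / c)"
    proof -
      have "norm ?d = f x / norm (G x)" using fx0 by (simp add: power2_eq_square)
      also have "\<dots> \<le> (N * r ^ 4) / (c / 2 * r ^ 3)" using fx fx0 Gx r3 by (intro frac_le) auto
      also have "\<dots> = r * (2 * N / c)" using r c by (simp add: field_simps eval_nat_numeral)
      finally show ?thesis .
    qed
    have dd2: "norm (?d' - ?d) \<le> r * (1 + 4 * N / c)"
    proof -
      have "\<epsilon> * (4 / c + 16 * N / c\<^sup>2) \<le> c / 4 * (4 / c + 16 * N / c\<^sup>2)"
        using \<epsilon> c by (intro mult_right_mono) auto
      also have "\<dots> = 1 + 4 * N / c" using c by (simp add: field_simps power2_eq_square)
      finally have "r * (\<epsilon> * (4 / c + 16 * N / c\<^sup>2)) \<le> r * (1 + 4 * N / c)"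
        using r by (intro mult_left_mono) auto
      then show ?thesis using dd by (simp only: mult_ac)
    qed
    have xd: "x - ?d \<in> ball x0 \<rho>1" "x - ?d' \<in> ball x0 \<rho>1"
    proof -
      have "r * (1 + 6 * N / c) \<le> L * \<rho> * (1 + 6 * N / c)"
        using rL c by (intro mult_right_mono) auto
      moreover have "\<rho> + L * \<rho> * (1 + 6 * N / c) = Z * \<rho>" by (simp add: Z_def algebra_simps)
      moreover have "r * (2 * N / c) + r * (1 + 4 * N / c) = r * (1 + 6 * N / c)" by (simp add: algebra_simps add_divide_distrib)
      ultimately have sum: "norm (x - x0) + (r * (2 * N / c) + r * (1 + 4 * N / c)) < \<rho>1"
        using nx Z\<rho> by linarith
      have "0 \<le> r * (1 + 4 * N / c)" using r c by simp
      then have "norm (x - x0) + norm ?d < \<rho>1" "norm (x - x0) + norm ?d + norm (?d' - ?d) < \<rho>1"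
        using sum d dd2 by linarith+
      moreover have "dist x0 (x - ?d) \<le> norm (x - x0) + norm ?d"
      proof -
        have "x0 - (x - ?d) = - (x - x0 - ?d)" by simp
        then show ?thesis using norm_triangle_ineq4[of "x - x0" ?d] by (simp only: dist_norm norm_minus_cancel)
      qed
      moreover have "dist x0 (x - ?d') \<le> dist x0 (x - ?d) + norm (?d' - ?d)"
        using dist_triangle[of x0 "x - ?d'" "x - ?d"] by (simp add: dist_norm)
      ultimately show "x - ?d \<in> ball x0 \<rho>1" "x - ?d' \<in> ball x0 \<rho>1" unfolding mem_ball by linarith+
    qed
    have step: "polyak_step f 0 x = x - ?d"
      using grad_eq[OF G[OF in1(3)[OF x\<sigma>]]] by (simp add: polyak_step_def)
    have "norm (P (x - ?d) - x0) \<le> q * r"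
    proof -
      have "grad (\<lambda>y. f y - f (P y)) x = G x - T x"
        using G[OF in1(3)[OF x\<sigma>]] T(1)[OF in1(2)[OF x\<sigma>]] in1(3)[OF y\<sigma>]
        by (intro grad_eq GDERIV_diff) (auto simp: y_def)
      moreover have "grad (\<lambda>y. f (P y)) (P x) = T y"
        using T(1)[OF in1(2)[OF y\<sigma>]] in1(3)[OF y\<sigma>] Py by (intro grad_eq) (auto simp: y_def)
      \<comment> \<open>With three errors of 1/400, the left side is at most 2/400 of |G y| while |T
        y| is at least 399/400 of it, well within the required ratio 1/100.\<close>
      moreover have "norm (G x - T x) \<le> 1 / 100 * norm (T y)"
      proof -
        have 1: "norm (T x - G y) \<le> norm (G y) / 400"
          by (rule T_near[OF x\<sigma> y_def[symmetric] yM in1(3)[OF y\<sigma>]])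
        have 2: "norm (T y - G y) \<le> norm (G y) / 400"
          by (rule T_near[OF y\<sigma> Py yM in1(3)[OF y\<sigma>]])
        have 3: "norm (G x - G y) \<le> norm (G y) / 400" using Gxy Gy by linarith
        have "norm (G x - T x) \<le> norm (G x - G y) + norm (T x - G y)"
          using norm_triangle_ineq4[of "G x - G y" "T x - G y"] by simp
        moreover have "norm (G y) \<le> norm (T y) + norm (T y - G y)"
          using norm_triangle_ineq4[of "T y" "T y - G y"] by simp
        ultimately show ?thesis using 1 2 3 norm_ge_zero[of "T y"] by linarith
      qed
      ultimately have "norm (P (polyak_step f 0 x) - x0) \<le> q * norm (P x - x0)"
        using contraction[rule_format, OF in1(2)[OF x\<sigma>]] by simp
      then show ?thesis unfolding step by (simp add: r_def y_def)
    qed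
    moreover have "norm (P (x - ?d') - P (x - ?d)) \<le> B * \<epsilon> * r"
    proof -
      have "norm (P (x - ?d') - P (x - ?d)) \<le> L * norm (?d' - ?d)"
        using Plip[OF xd(2,1)] by (simp add: norm_minus_commute)
      also have "\<dots> \<le> L * (\<epsilon> * r * (4 / c + 16 * N / c\<^sup>2))" using dd \<rho>1 by (intro mult_left_mono) auto
      finally show ?thesis by (simp add: B_def mult_ac)
    qed
    moreover have "norm (P (x - ?d') - x0) \<le> norm (P (x - ?d') - P (x - ?d)) + norm (P (x - ?d) - x0)"
      using norm_triangle_ineq[of "P (x - ?d') - P (x - ?d)" "P (x - ?d) - x0"] by simp
    ultimately have "norm (P (x - ?d') - x0) \<le> (q + B * \<epsilon>) * r" by (simp add: algebra_simps)
    then show "x - ?d' \<in> U \<and> norm (P (x - ?d') - x0) \<le> (q + B * \<epsilon>) * norm (P x - x0)"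
      using xd(2) \<rho>1(4) by (auto simp: r_def y_def)
  qed
qed

end

section \<open>Gaussian mixtures\<close>

definition tmix :: "('n::finite \<Rightarrow> real) \<Rightarrow> real^'d^'n \<Rightarrow> real^'d \<Rightarrow> real" where
  "tmix p \<mu> x = (\<Sum>i\<in>UNIV. p i * tilt (\<mu> $ i) x)"

definition dtmix :: "('n::finite \<Rightarrow> real) \<Rightarrow> real^'d^'n \<Rightarrow> real^'d^'n \<Rightarrow> real^'d \<Rightarrow> real" where
  "dtmix p \<mu> \<xi> x = (\<Sum>i\<in>UNIV. p i * dtilt (\<mu> $ i) (\<xi> $ i) x)"

definition ddtmix ::
  "('n::finite \<Rightarrow> real) \<Rightarrow> real^'d^'n \<Rightarrow> real^'d^'n \<Rightarrow> real^'d^'n \<Rightarrow> real^'d \<Rightarrow> real" where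
  "ddtmix p \<mu> v u x = (\<Sum>i\<in>UNIV. p i * ddtilt (\<mu> $ i) (v $ i) (u $ i) x)"

lemma tmix_measurable [measurable]:
  "tmix p \<mu> \<in> borel_measurable borel" "dtmix p \<mu> \<xi> \<in> borel_measurable borel"
  "ddtmix p \<mu> v u \<in> borel_measurable borel"
  unfolding tmix_def dtmix_def ddtmix_def by measurable

lemma mixture_eq_tmix: "mixture p (\<lambda>i. \<mu> $ i) x = gauss 0 x * tmix p \<mu> x"
  unfolding mixture_def tmix_def sum_distrib_left
  by (rule sum.cong[OF refl]) (subst gauss_eq_tilt, simp)

lemma prob_simplexD:
  assumes "p \<in> prob_simplex"
  shows "0 \<le> p k" "(\<Sum>k\<in>UNIV. p k) = 1"
  using assms by (auto simp: prob_simplex_def)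

lemma prob_simplex_average_le:
  fixes p a :: "'n::finite \<Rightarrow> real"
  assumes p: "p \<in> prob_simplex" and a: "\<And>i. \<bar>a i\<bar> \<le> b"
  shows "\<bar>\<Sum>i\<in>UNIV. p i * a i\<bar> \<le> b"
proof -
  have "\<bar>\<Sum>i\<in>UNIV. p i * a i\<bar> \<le> (\<Sum>i\<in>UNIV. \<bar>p i * a i\<bar>)" by (rule sum_abs)
  also have "\<dots> \<le> (\<Sum>i\<in>UNIV. p i * b)"
    using a prob_simplexD(1)[OF p] by (intro sum_mono) (simp add: abs_mult mult_left_mono)
  also have "\<dots> = b" using prob_simplexD(2)[OF p] by (simp flip: sum_distrib_right)
  finally show ?thesis .
qed

lemma tmix_pos:
  assumes p: "p \<in> prob_simplex"
  shows "0 < tmix p \<mu> x"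
proof -
  obtain i where "p i \<noteq> 0" using prob_simplexD(2)[OF p] by (metis sum.neutral zero_neq_one)
  then have "0 < p i * tilt (\<mu> $ i) x" using prob_simplexD(1)[OF p, of i] tilt_pos[of "\<mu> $ i" x] by simp
  then show ?thesis
    unfolding tmix_def
    by (intro sum_pos2[of _ i] mult_nonneg_nonneg[OF prob_simplexD(1)[OF p] less_imp_le[OF tilt_pos]]) auto
qed

lemma tmix_ge:
  assumes p: "p \<in> prob_simplex" and \<mu>: "norm \<mu> \<le> R"
  shows "1 \<le> tmix p \<mu> x * envelope R x"
proof -
  have "1 = (\<Sum>i\<in>UNIV. p i * 1)" using prob_simplexD(2)[OF p] by simp
  also have "\<dots> \<le> (\<Sum>i\<in>UNIV. p i * (tilt (\<mu> $ i) x * envelope R x))"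
    using prob_simplexD(1)[OF p] order_trans[OF Finite_Cartesian_Product.norm_nth_le \<mu>]
    by (intro sum_mono mult_left_mono inverse_tilt_le_envelope) auto
  also have "\<dots> = tmix p \<mu> x * envelope R x"
    by (simp add: tmix_def sum_distrib_right mult.assoc)
  finally show ?thesis .
qed

lemma envelope_scale:
  assumes "\<bar>a\<bar> \<le> c * envelope R x" "c \<le> c'"
  shows "\<bar>a\<bar> \<le> c' * envelope R x"
proof -
  have "c * envelope R x \<le> c' * envelope R x"
    using assms(2) by (rule mult_right_mono) (simp add: envelope_def)
  with assms(1) show ?thesis by linarith
qed

text \<open>Averages with probability weights inherit the bounds of the single tilts, so the
  envelope is the same for all weights; the uniformity of the final constants rests on this.\<close>

lemma tmix_taylor:
  fixes \<mu> v u :: "real^'d^'n"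
  assumes p: "p \<in> prob_simplex" and \<mu>: "norm \<mu> \<le> R" and \<mu>v: "norm (\<mu> + v) \<le> R"
  shows "\<bar>tmix p \<mu> x\<bar> \<le> envelope R x"
    and "\<bar>dtmix p \<mu> u x\<bar> \<le> norm u * envelope R x"
    and "\<bar>ddtmix p \<mu> v u x\<bar> \<le> norm v * norm u * envelope R x"
    and "\<bar>tmix p (\<mu> + v) x - tmix p \<mu> x\<bar> \<le> norm v * envelope R x"
    and "\<bar>tmix p (\<mu> + v) x - tmix p \<mu> x - dtmix p \<mu> v x\<bar> \<le> (norm v)\<^sup>2 * envelope R x"
    and "\<bar>tmix p (\<mu> + v) x - tmix p \<mu> x - dtmix p \<mu> v x - ddtmix p \<mu> v v x / 2\<bar>
          \<le> (norm v) ^ 3 * envelope R x"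
    and "\<bar>dtmix p (\<mu> + v) u x - dtmix p \<mu> u x\<bar> \<le> norm v * norm u * envelope R x"
    and "\<bar>dtmix p (\<mu> + v) u x - dtmix p \<mu> u x - ddtmix p \<mu> v u x\<bar> \<le> (norm v)\<^sup>2 * norm u * envelope R x"
proof -
  have i: "norm (\<mu> $ i) \<le> R" "norm (\<mu> $ i + v $ i) \<le> R" for i
    using order_trans[OF Finite_Cartesian_Product.norm_nth_le \<mu>, of i] order_trans[OF Finite_Cartesian_Product.norm_nth_le \<mu>v, of i] by simp_all
  note T = tilt_taylor[OF i]
  have n: "norm (v $ i) \<le> norm v" "norm (u $ i) \<le> norm u" for i by (rule Finite_Cartesian_Product.norm_nth_le)+
  have n2: "norm (v $ i) * norm (u $ i) \<le> norm v * norm u" "(norm (v $ i))\<^sup>2 \<le> (norm v)\<^sup>2"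
    "(norm (v $ i)) ^ 3 \<le> (norm v) ^ 3" "(norm (v $ i))\<^sup>2 * norm (u $ i) \<le> (norm v)\<^sup>2 * norm u" for i
    using n by (auto intro!: mult_mono power_mono)
  note avg = prob_simplex_average_le[OF p]
  note simps = tmix_def dtmix_def ddtmix_def sum_divide_distrib vector_add_component
    times_divide_eq_right[symmetric]
  show "\<bar>tmix p \<mu> x\<bar> \<le> envelope R x"
    unfolding simps by (rule avg[OF T(1)])
  show "\<bar>dtmix p \<mu> u x\<bar> \<le> norm u * envelope R x"
    unfolding simps by (rule avg[OF envelope_scale[OF T(2) n(2)]])
  show "\<bar>ddtmix p \<mu> v u x\<bar> \<le> norm v * norm u * envelope R x"
    unfolding simps by (rule avg[OF envelope_scale[OF T(3) n2(1)]])
  show "\<bar>tmix p (\<mu> + v) x - tmix p \<mu> x\<bar> \<le> norm v * envelope R x"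
    unfolding simps sum_subtractf[symmetric] right_diff_distrib[symmetric]
    by (rule avg[OF envelope_scale[OF T(4) n(1)]])
  show "\<bar>tmix p (\<mu> + v) x - tmix p \<mu> x - dtmix p \<mu> v x\<bar> \<le> (norm v)\<^sup>2 * envelope R x"
    unfolding simps sum_subtractf[symmetric] right_diff_distrib[symmetric]
    by (rule avg[OF envelope_scale[OF T(5) n2(2)]])
  show "\<bar>tmix p (\<mu> + v) x - tmix p \<mu> x - dtmix p \<mu> v x - ddtmix p \<mu> v v x / 2\<bar>
          \<le> (norm v) ^ 3 * envelope R x"
    unfolding simps sum_subtractf[symmetric] right_diff_distrib[symmetric]
    by (rule avg[OF envelope_scale[OF T(6) n2(3)]])
  show "\<bar>dtmix p (\<mu> + v) u x - dtmix p \<mu> u x\<bar> \<le> norm v * norm u * envelope R x"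
    unfolding simps sum_subtractf[symmetric] right_diff_distrib[symmetric]
    by (rule avg[OF envelope_scale[OF T(7) n2(1)]])
  show "\<bar>dtmix p (\<mu> + v) u x - dtmix p \<mu> u x - ddtmix p \<mu> v u x\<bar> \<le> (norm v)\<^sup>2 * norm u * envelope R x"
    unfolding simps sum_subtractf[symmetric] right_diff_distrib[symmetric]
    by (rule avg[OF envelope_scale[OF T(8) n2(4)]])
qed

lemma integrable_envelope_power: "integrable gauss_measure (\<lambda>x::real^'d. envelope R x ^ k)"
proof -
  have "(\<lambda>x::real^'d. envelope R x ^ k) = (\<lambda>x. exp ((real k * (5 + R + R\<^sup>2)) * (1 + norm x)))"
    by (simp add: envelope_def mult.assoc flip: exp_of_nat_mult)
  then show ?thesis by (simp only: integrable_exp_norm)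
qed

lemma integral_tmix:
  fixes \<mu> :: "real^'d^'n"
  assumes p: "p \<in> prob_simplex"
  shows "integrable gauss_measure (tmix p \<mu>)"
    and "(\<integral>x. tmix p \<mu> x \<partial>gauss_measure) = (\<integral>x. gauss 0 (x::real^'d) \<partial>lborel)"
proof -
  have int: "integrable gauss_measure (tilt a)" for a :: "real^'d"
  proof (rule Bochner_Integration.integrable_bound)
    show "integrable gauss_measure (\<lambda>x::real^'d. envelope (norm a) x ^ 1)" by (rule integrable_envelope_power)
    show "AE x in gauss_measure. norm (tilt a x) \<le> norm (envelope (norm a) x ^ 1)"
      using tilt_taylor(1)[of a "norm a" 0] by (auto simp: envelope_def)
  qed measurable
  then show "integrable gauss_measure (tmix p \<mu>)" unfolding tmix_def by simp
  have "(\<integral>x. tmix p \<mu> x \<partial>gauss_measure) = (\<Sum>i\<in>UNIV. p i * (\<integral>x. tilt (\<mu> $ i) x \<partial>gauss_measure))"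
    unfolding tmix_def using int by simp
  also have "\<dots> = (\<integral>x. gauss 0 (x::real^'d) \<partial>lborel)"
    by (simp add: integral_tilt prob_simplexD(2)[OF p] flip: sum_distrib_right)
  finally show "(\<integral>x. tmix p \<mu> x \<partial>gauss_measure) = (\<integral>x. gauss 0 (x::real^'d) \<partial>lborel)" .
qed

lemma linear_dtmix: "linear (\<lambda>\<xi>. dtmix p \<mu> \<xi> x)"
  by (rule linearI) (simp_all add: dtmix_def dtilt_def inner_add_right distrib_left distrib_right
      sum.distrib sum_distrib_left mult_ac)

lemma linear_ddtmix: "linear (\<lambda>u. ddtmix p \<mu> v u x)"
  by (rule linearI) (simp_all add: ddtmix_def ddtilt_def inner_add_right algebra_simps
      sum.distrib sum_distrib_left sum_subtractf)

text \<open>Student weights and target are kept apart, so that actual weights can be studied against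
  the target built from the reference weights. The radius \<open>R\<close> covers the unit ball
  about \<open>x0\<close> as well as the target means.\<close>

lemma smooth_family_tmix:
  fixes p q :: "'n::finite \<Rightarrow> real" and x0 \<nu> :: "real^'d^'n"
  assumes p: "p \<in> prob_simplex" and q: "q \<in> prob_simplex" and x0: "norm x0 + 1 \<le> R" and \<nu>: "norm \<nu> \<le> R"
  shows "smooth_family gauss_measure (envelope R) (tmix p) (dtmix p) (tmix q \<nu>) x0"
proof (rule smooth_family.intro)
  have R: "0 \<le> R" using \<nu> norm_ge_zero order_trans by blast
  have nb: "norm \<mu> \<le> R" if "\<mu> \<in> ball x0 1" for \<mu>
    using that norm_triangle_ineq4[of x0 "x0 - \<mu>"] x0 by (simp add: dist_norm)
  fix x :: "real^'d" and \<mu> \<mu>' \<xi> :: "real^'d^'n" and k :: nat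
  show "envelope R \<in> borel_measurable gauss_measure" "tmix p \<mu> \<in> borel_measurable gauss_measure"
    "dtmix p \<mu> \<xi> \<in> borel_measurable gauss_measure" "tmix q \<nu> \<in> borel_measurable gauss_measure"
    by measurable
  show "1 \<le> envelope R x" by (rule envelope_ge_1[OF R])
  show "integrable gauss_measure (\<lambda>x. envelope R x ^ k)" by (rule integrable_envelope_power)
  show "0 < tmix q \<nu> x" "0 < tmix p \<mu> x" using tmix_pos p q by auto
  show "tmix q \<nu> x \<le> envelope R x" using tmix_taylor(1)[OF q \<nu>, of 0 x] \<nu> by simp
  show "1 \<le> tmix q \<nu> x * envelope R x" by (rule tmix_ge[OF q \<nu>])
  show "linear (\<lambda>\<xi>. dtmix p \<mu> \<xi> x)" by (rule linear_dtmix)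
  show "(\<integral>x. tmix p \<mu> x \<partial>gauss_measure) = (\<integral>x. tmix q \<nu> x \<partial>gauss_measure)"
    by (simp only: integral_tmix(2)[OF p] integral_tmix(2)[OF q])
  assume \<mu>: "\<mu> \<in> ball x0 1"
  show "tmix p \<mu> x \<le> envelope R x" using tmix_taylor(1)[OF p nb[OF \<mu>], of 0 x] nb[OF \<mu>] by simp
  show "1 \<le> tmix p \<mu> x * envelope R x" by (rule tmix_ge[OF p nb[OF \<mu>]])
  show "\<bar>dtmix p \<mu> \<xi> x\<bar> \<le> norm \<xi> * envelope R x" using tmix_taylor(2)[OF p nb[OF \<mu>], of 0 \<xi> x] nb[OF \<mu>] by simp
  assume \<mu>': "\<mu>' \<in> ball x0 1"
  have e: "\<mu> + (\<mu>' - \<mu>) = \<mu>'" by simp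
  note T = tmix_taylor[OF p nb[OF \<mu>], of "\<mu>' - \<mu>", unfolded e, OF nb[OF \<mu>']]
  show "\<bar>tmix p \<mu>' x - tmix p \<mu> x\<bar> \<le> norm (\<mu>' - \<mu>) * envelope R x" by (rule T(4))
  show "\<bar>tmix p \<mu>' x - tmix p \<mu> x - dtmix p \<mu> (\<mu>' - \<mu>) x\<bar> \<le> (norm (\<mu>' - \<mu>))\<^sup>2 * envelope R x" by (rule T(5))
  show "\<bar>dtmix p \<mu>' \<xi> x - dtmix p \<mu> \<xi> x\<bar> \<le> norm (\<mu>' - \<mu>) * norm \<xi> * envelope R x" by (rule T(7))
qed

section \<open>Linear independence of tilts with quadratic coefficients\<close>

lemma tendsto_quadratic_times_exp_neg:
  fixes a b c k \<delta> :: real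
  assumes "0 < \<delta>"
  shows "((\<lambda>t. (a + b * t + c * t\<^sup>2) * exp (k - \<delta> * t)) \<longlongrightarrow> 0) at_top"
proof -
  have pw: "((\<lambda>t. t ^ j * exp (- (\<delta> * t))) \<longlongrightarrow> 0) at_top" for j
  proof -
    have "filterlim (\<lambda>t. \<delta> * t) at_top at_top"
      using assms by (simp add: filterlim_tendsto_pos_mult_at_top[OF tendsto_const _ filterlim_ident])
    then have "((\<lambda>t. (\<delta> * t) ^ j / exp (\<delta> * t)) \<longlongrightarrow> 0) at_top"
      using filterlim_compose[OF tendsto_power_div_exp_0] by blast
    then have "((\<lambda>t. (1 / \<delta> ^ j) * ((\<delta> * t) ^ j / exp (\<delta> * t))) \<longlongrightarrow> (1 / \<delta> ^ j) * 0) at_top"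
      by (rule tendsto_mult_left)
    moreover have "(\<lambda>t. (1 / \<delta> ^ j) * ((\<delta> * t) ^ j / exp (\<delta> * t))) = (\<lambda>t. t ^ j * exp (- (\<delta> * t)))"
      using assms by (auto simp: power_mult_distrib exp_minus field_simps)
    ultimately show ?thesis by simp
  qed
  have "((\<lambda>t. exp k * (a * (t ^ 0 * exp (- (\<delta> * t))) + b * (t ^ 1 * exp (- (\<delta> * t)))
      + c * (t ^ 2 * exp (- (\<delta> * t))))) \<longlongrightarrow> exp k * (a * 0 + b * 0 + c * 0)) at_top"
    by (intro tendsto_intros pw)
  moreover have "exp k * (a * (t ^ 0 * exp (- (\<delta> * t))) + b * (t ^ 1 * exp (- (\<delta> * t)))
      + c * (t ^ 2 * exp (- (\<delta> * t)))) = (a + b * t + c * t\<^sup>2) * exp (k - \<delta> * t)" for t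
    by (simp add: exp_diff exp_minus field_simps)
  ultimately show ?thesis by simp
qed

text \<open>Along the direction of the longest mean, the tilt with that mean dominates all others.\<close>

lemma tilt_independent:
  fixes \<mu> :: "'m \<Rightarrow> 'a::real_inner" and q :: "'m \<Rightarrow> 'a \<Rightarrow> real"
  assumes "finite A" and inj: "inj_on \<mu> A"
    and quadratic: "\<And>l x y. l \<in> A \<Longrightarrow> \<exists>a b c. \<forall>t. q l (x + t *\<^sub>R y) = a + b * t + c * t\<^sup>2"
    and zero: "\<And>x. (\<Sum>l\<in>A. q l x * tilt (\<mu> l) x) = 0"
    and "l \<in> A"
  shows "q l x = 0"
  using assms
proof (induction "card A" arbitrary: A l x)
  case 0
  then show ?case by simp
next
  case (Suc n)
  obtain m where m: "m \<in> A" "\<And>l. l \<in> A \<Longrightarrow> norm (\<mu> l) \<le> norm (\<mu> m)"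
  proof -
    have "finite ((norm \<circ> \<mu>) ` A)" "(norm \<circ> \<mu>) ` A \<noteq> {}" using Suc.prems by auto
    then have "Max ((norm \<circ> \<mu>) ` A) \<in> (norm \<circ> \<mu>) ` A" by (rule Max_in)
    then obtain m where "m \<in> A" "norm (\<mu> m) = Max ((norm \<circ> \<mu>) ` A)" by auto
    then show ?thesis using that Suc.prems(1) by (metis Max_ge comp_apply finite_imageI imageI)
  qed
  have qm: "q m x = 0" for x
  proof -
    have lim: "((\<lambda>t. q m (x + t *\<^sub>R \<mu> m)) \<longlongrightarrow> 0) at_top"
    proof -
      have summand: "((\<lambda>t. q l (x + t *\<^sub>R \<mu> m) * (tilt (\<mu> l) (x + t *\<^sub>R \<mu> m) / tilt (\<mu> m) (x + t *\<^sub>R \<mu> m))) \<longlongrightarrow> 0) at_top"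
        if l: "l \<in> A - {m}" for l
      proof -
        obtain a b c where abc: "\<And>t. q l (x + t *\<^sub>R \<mu> m) = a + b * t + c * t\<^sup>2"
          using Suc.prems(3)[of l x "\<mu> m"] l by blast
        have "\<mu> l \<noteq> \<mu> m" using l m(1) Suc.prems(2) by (auto dest: inj_onD)
        \<comment> \<open>Expanding this square and using |\<mu> l| \<le> |\<mu> m| gives a strictly
          positive decay rate, even when several means share the maximal length.\<close>
        then have "0 < (\<mu> m - \<mu> l) \<bullet> (\<mu> m - \<mu> l)" by simp
        moreover have "\<mu> l \<bullet> \<mu> l \<le> \<mu> m \<bullet> \<mu> m" using m(2)[of l] l by (simp add: norm_le)
        ultimately have pos: "0 < \<mu> m \<bullet> \<mu> m - \<mu> m \<bullet> \<mu> l"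
          by (simp add: inner_diff_left inner_diff_right inner_commute)
        have "tilt (\<mu> l) (x + t *\<^sub>R \<mu> m) / tilt (\<mu> m) (x + t *\<^sub>R \<mu> m)
            = exp ((x \<bullet> \<mu> l - \<mu> l \<bullet> \<mu> l / 2 - x \<bullet> \<mu> m + \<mu> m \<bullet> \<mu> m / 2) - (\<mu> m \<bullet> \<mu> m - \<mu> m \<bullet> \<mu> l) * t)" for t
          by (simp add: tilt_def inner_add_left algebra_simps flip: exp_diff)
        then show ?thesis using tendsto_quadratic_times_exp_neg[OF pos] by (simp add: abc)
      qed
      have "((\<lambda>t. - (\<Sum>l\<in>A - {m}. q l (x + t *\<^sub>R \<mu> m) *
          (tilt (\<mu> l) (x + t *\<^sub>R \<mu> m) / tilt (\<mu> m) (x + t *\<^sub>R \<mu> m)))) \<longlongrightarrow> - (\<Sum>l\<in>A - {m}. 0)) at_top"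
        by (intro tendsto_minus tendsto_sum summand)
      moreover have "- (\<Sum>l\<in>A - {m}. q l y * (tilt (\<mu> l) y / tilt (\<mu> m) y)) = q m y" for y
      proof -
        have "q m y * tilt (\<mu> m) y + (\<Sum>l\<in>A - {m}. q l y * tilt (\<mu> l) y) = 0"
          using Suc.prems(4)[of y] sum.remove[OF Suc.prems(1) m(1), of "\<lambda>l. q l y * tilt (\<mu> l) y"] by simp
        then have "q m y = - (\<Sum>l\<in>A - {m}. q l y * tilt (\<mu> l) y) / tilt (\<mu> m) y"
          using tilt_pos[of "\<mu> m" y] by (simp add: field_simps)
        then show ?thesis by (simp add: sum_divide_distrib)
      qed
      ultimately show ?thesis by simp
    qed
    obtain a b c where abc: "\<And>t. q m (x + t *\<^sub>R \<mu> m) = a + b * t + c * t\<^sup>2"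
      using Suc.prems(3)[OF m(1), of x "\<mu> m"] by blast
    let ?f = "\<lambda>t. a + b * t + c * t\<^sup>2"
    have f: "(?f \<longlongrightarrow> 0) at_top" using lim by (simp add: abc)
    have sc: "((\<lambda>t. ?f (k * t)) \<longlongrightarrow> 0) at_top" if "0 < k" for k
    proof -
      have "filterlim (\<lambda>t. k * t) at_top at_top"
        using that by (simp add: filterlim_tendsto_pos_mult_at_top[OF tendsto_const _ filterlim_ident])
      then show ?thesis using filterlim_compose[OF f] by blast
    qed
    \<comment> \<open>Lagrange extrapolation: \<open>f(0) = 3f(t) - 3f(2t) + f(3t)\<close> for quadratic \<open>f\<close>.\<close>
    have "((\<lambda>t. 3 * ?f t - 3 * ?f (2 * t) + ?f (3 * t)) \<longlongrightarrow> 3 * 0 - 3 * 0 + 0) at_top"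
      by (intro tendsto_intros f sc) auto
    moreover have "(\<lambda>t. 3 * ?f t - 3 * ?f (2 * t) + ?f (3 * t)) = (\<lambda>t. a)"
      by (auto simp: algebra_simps power2_eq_square)
    ultimately have "a = 0" by (simp add: tendsto_const_iff)
    then show ?thesis using abc[of 0] by simp
  qed
  show ?case
  proof (cases "l = m")
    case False
    show ?thesis
    proof (rule Suc.hyps(1)[of "A - {m}" l x])
      show "n = card (A - {m})" using Suc.hyps(2) m(1) Suc.prems(1) by simp
      show "inj_on \<mu> (A - {m})" using Suc.prems(2) by (auto intro: inj_on_subset)
      show "(\<Sum>l\<in>A - {m}. q l x * tilt (\<mu> l) x) = 0" for x
        using Suc.prems(4)[of x] sum.remove[OF Suc.prems(1) m(1), of "\<lambda>l. q l x * tilt (\<mu> l) x"] qm by simp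
    qed (use Suc.prems False in auto)
  qed (simp add: qm)
qed

lemma sum_partition:
  fixes S :: "'m::finite \<Rightarrow> 'n::finite set" and h :: "'n \<Rightarrow> real"
  assumes "disjoint_family S" "(\<Union>l. S l) = UNIV"
  shows "(\<Sum>i\<in>UNIV. h i) = (\<Sum>l\<in>UNIV. \<Sum>i\<in>S l. h i)"
  unfolding assms(2)[symmetric]
  by (rule sum.UNION_disjoint) (use assms(1) in \<open>auto simp: disjoint_family_on_def\<close>)

text \<open>Students of one cluster share a tilt, so collecting by clusters gives one quadratic
  polynomial for each teacher mean. Linear independence makes each of them vanish identically, and
  positivity of the weights rules out cancellation within a cluster.\<close>

lemma tmix_nondegenerate:
  fixes \<mu>\<^sub>s :: "'m::finite \<Rightarrow> real^'d" and S :: "'m \<Rightarrow> 'n::finite set" and \<mu> v e :: "real^'d^'n"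
  assumes inj: "inj \<mu>\<^sub>s" and part: "disjoint_family S" "(\<Union>l. S l) = UNIV"
    and \<mu>: "\<forall>l. \<forall>i\<in>S l. \<mu> $ i = \<mu>\<^sub>s l" and w: "\<forall>i. 0 < w i"
    and AE: "AE x in gauss_measure. dtmix w \<mu> e x + ddtmix w \<mu> v v x / 2 = 0"
  shows "v = 0 \<and> (\<forall>x. dtmix w \<mu> e x = 0)"
proof -
  have zero: "dtmix w \<mu> e x + ddtmix w \<mu> v v x / 2 = 0" for x
  proof (rule AE_gauss_measure_zero_imp_zero[OF AE])
    show "continuous_on UNIV (\<lambda>x. dtmix w \<mu> e x + ddtmix w \<mu> v v x / 2)"
      unfolding dtmix_def ddtmix_def dtilt_def ddtilt_def tilt_def by (intro continuous_intros) auto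
  qed
  define q where "q = (\<lambda>l x. \<Sum>i\<in>S l. w i * ((x - \<mu>\<^sub>s l) \<bullet> (e $ i)
      + (((x - \<mu>\<^sub>s l) \<bullet> (v $ i))\<^sup>2 - v $ i \<bullet> v $ i) / 2))"
  have q0: "q l x = 0" for l x
  proof (rule tilt_independent[where A = UNIV and \<mu> = \<mu>\<^sub>s])
    show "\<exists>a b c. \<forall>t. q l (x + t *\<^sub>R y) = a + b * t + c * t\<^sup>2" for l x y
    proof (intro exI allI)
      fix t
      show "q l (x + t *\<^sub>R y) = q l x + (\<Sum>i\<in>S l. w i * (y \<bullet> (e $ i) + ((x - \<mu>\<^sub>s l) \<bullet> (v $ i)) * (y \<bullet> (v $ i)))) * t
          + (\<Sum>i\<in>S l. w i * (y \<bullet> (v $ i))\<^sup>2 / 2) * t\<^sup>2"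
        unfolding q_def sum_distrib_right sum.distrib[symmetric]
        by (rule sum.cong[OF refl])
          (simp add: inner_add_left inner_diff_left power2_eq_square field_simps)
    qed
    show "(\<Sum>l\<in>UNIV. q l x * tilt (\<mu>\<^sub>s l) x) = 0" for x
    proof -
      have "dtmix w \<mu> e x + ddtmix w \<mu> v v x / 2 = (\<Sum>i\<in>UNIV. w i * ((x - \<mu> $ i) \<bullet> (e $ i)
          + (((x - \<mu> $ i) \<bullet> (v $ i))\<^sup>2 - v $ i \<bullet> v $ i) / 2) * tilt (\<mu> $ i) x)"
        unfolding dtmix_def ddtmix_def dtilt_def ddtilt_def sum_divide_distrib sum.distrib[symmetric]
        by (rule sum.cong[OF refl]) (simp add: power2_eq_square field_simps)
      also have "\<dots> = (\<Sum>l\<in>UNIV. q l x * tilt (\<mu>\<^sub>s l) x)"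
        unfolding sum_partition[OF part] q_def sum_distrib_right using \<mu> by (intro sum.cong refl) auto
      finally show ?thesis using zero by simp
    qed
  qed (use inj in auto)
  have "v $ i = 0" for i
  proof -
    obtain l where i: "i \<in> S l" using part(2) by blast
    \<comment> \<open>At the mean itself all terms containing \<open>x - \<mu>\<^sub>s l\<close>
      vanish and only the trace part of the second Hermite polynomial survives.\<close>
    have "(\<Sum>i\<in>S l. w i * (v $ i \<bullet> v $ i)) = 0"
      using q0[of l "\<mu>\<^sub>s l"] by (simp add: q_def sum_negf flip: sum_divide_distrib)
    then have "w i * (v $ i \<bullet> v $ i) = 0"
      using i w by (subst (asm) sum_nonneg_eq_0_iff) (auto simp: less_imp_le)
    then show ?thesis using w by (metis inner_eq_zero_iff less_irrefl mult_eq_0_iff)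
  qed
  then have v: "v = 0" by (simp add: vec_eq_iff)
  moreover have "dtmix w \<mu> e x = 0" for x
    using zero[of x] by (simp add: v ddtmix_def ddtilt_def)
  ultimately show ?thesis by blast
qed

lemma degenerate_family_tmix:
  fixes \<mu>\<^sub>s :: "'m::finite \<Rightarrow> real^'d" and S :: "'m \<Rightarrow> 'n::finite set" and \<mu> :: "real^'d^'n"
  assumes w: "w \<in> prob_simplex" "\<forall>i. 0 < w i" and R: "R = norm \<mu> + 1"
    and inj: "inj \<mu>\<^sub>s" and part: "disjoint_family S" "(\<Union>l. S l) = UNIV"
    and \<mu>: "\<forall>l. \<forall>i\<in>S l. \<mu> $ i = \<mu>\<^sub>s l"
  shows "degenerate_family gauss_measure (envelope R) (tmix w) (dtmix w) (tmix w \<mu>) \<mu> (ddtmix w \<mu>)"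
proof -
  have nR: "norm \<mu> \<le> R" using R by simp
  interpret smooth_family gauss_measure "envelope R" "tmix w" "dtmix w" "tmix w \<mu>" \<mu>
    by (rule smooth_family_tmix) (use w R in auto)
  have nv: "norm (\<mu> + v) \<le> R" if "norm v < 1" for v
    using norm_triangle_ineq[of \<mu> v] that R by linarith
  show ?thesis
  proof (intro degenerate_family.intro degenerate_family_axioms.intro)
    fix v u e :: "real^'d^'n" and x :: "real^'d"
    show "ddtmix w \<mu> v u \<in> borel_measurable gauss_measure" by measurable
    have sym: "ddtmix w \<mu> v u x = ddtmix w \<mu> u v x" for v u
      by (simp add: ddtmix_def ddtilt_def inner_commute mult.commute)
    show "\<bar>ddtmix w \<mu> v u x\<bar> \<le> norm v * norm u * envelope R x"
    proof -
      \<comment> \<open>The Taylor bound covers displacements of norm below 1; dividing by |v| + 1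
        brings \<open>v\<close> there, and bilinearity brings it back.\<close>
      define c where "c = norm v + 1"
      have c: "0 < c" unfolding c_def using norm_ge_zero[of v] by linarith
      define v' where "v' = (1 / c) *\<^sub>R v"
      have v': "v = c *\<^sub>R v'" "norm v = c * norm v'" using c by (simp_all add: v'_def)
      have "norm v' < 1" using c by (simp add: v'_def c_def)
      then have "\<bar>ddtmix w \<mu> v' u x\<bar> \<le> norm v' * norm u * envelope R x"
        by (intro tmix_taylor(3)[OF w(1) nR nv])
      then have "c * \<bar>ddtmix w \<mu> v' u x\<bar> \<le> c * (norm v' * norm u * envelope R x)"
        using c by (intro mult_left_mono) auto
      moreover have "ddtmix w \<mu> v u x = c * ddtmix w \<mu> v' u x"
        by (subst (1 2) sym) (simp add: v'(1) linear_cmul[OF linear_ddtmix])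
      ultimately show ?thesis using c unfolding v'(2) by (simp add: abs_mult mult.assoc)
    qed
    show "linear (\<lambda>u. ddtmix w \<mu> v u x)" by (rule linear_ddtmix)
    show "ddtmix w \<mu> v u x = ddtmix w \<mu> u v x" by (rule sym)
    show "v = 0 \<and> (\<forall>x. dtmix w \<mu> e x = 0)" if "AE x in gauss_measure. dtmix w \<mu> e x + ddtmix w \<mu> v v x / 2 = 0"
      by (rule tmix_nondegenerate[OF inj part \<mu> w(2) that])
    assume v: "norm v < 1"
    show "\<bar>tmix w (\<mu> + v) x - tmix w \<mu> x - dtmix w \<mu> v x - ddtmix w \<mu> v v x / 2\<bar> \<le> norm v ^ 3 * envelope R x"
      by (rule tmix_taylor(6)[OF w(1) nR nv[OF v]])
    show "\<bar>dtmix w (\<mu> + v) u x - dtmix w \<mu> u x - ddtmix w \<mu> v u x\<bar> \<le> (norm v)\<^sup>2 * norm u * envelope R x"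
      by (rule tmix_taylor(8)[OF w(1) nR nv[OF v]])
  qed (rule refl smooth_family_axioms)+
qed

section \<open>Change of weights\<close>

text \<open>The factor \<open>gauss 0\<close> cancels inside the logarithm and is otherwise absorbed
  into the measure.\<close>

lemma loss_eq:
  fixes \<mu>\<^sub>s :: "'m::finite \<Rightarrow> real^'d" and \<mu> \<nu> :: "real^'d^'n::finite"
    and p w :: "'n \<Rightarrow> real"
  assumes mix: "\<And>x. mixture p\<^sub>s \<mu>\<^sub>s x = gauss 0 x * tmix w \<nu> x" and w: "w \<in> prob_simplex"
  shows "loss p\<^sub>s \<mu>\<^sub>s p \<mu> = (\<integral>x. tmix w \<nu> x * ln (tmix w \<nu> x / tmix p \<mu> x) \<partial>gauss_measure)"
proof -
  have g: "gauss 0 x \<noteq> 0" for x :: "real^'d" using gauss_pos[of 0 x] by simp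
  have pos: "0 \<le> tmix w \<nu> x" for x using tmix_pos[OF w, of \<nu> x] by simp
  have "loss p\<^sub>s \<mu>\<^sub>s p \<mu> = (\<integral>x. ln (tmix w \<nu> x / tmix p \<mu> x)
      \<partial>density lborel (\<lambda>x. ennreal (gauss 0 x * tmix w \<nu> x)))"
    unfolding loss_def mix mixture_eq_tmix using g by simp
  also have "\<dots> = (\<integral>x. (gauss 0 x * tmix w \<nu> x) * ln (tmix w \<nu> x / tmix p \<mu> x) \<partial>lborel)"
    by (rule integral_real_density) (auto intro!: AE_I2 mult_nonneg_nonneg pos less_imp_le[OF gauss_pos])
  also have "\<dots> = (\<integral>x. tmix w \<nu> x * ln (tmix w \<nu> x / tmix p \<mu> x) \<partial>gauss_measure)"
    unfolding gauss_measure_def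
    by (subst integral_real_density) (auto simp: mult.assoc intro!: AE_I2 less_imp_le[OF gauss_pos])
  finally show ?thesis .
qed

lemma mixture_eq_students:
  fixes \<mu>\<^sub>s :: "'m::finite \<Rightarrow> real^'d" and S :: "'m \<Rightarrow> 'n::finite set" and \<nu> :: "real^'d^'n"
  assumes part: "disjoint_family S" "(\<Union>l. S l) = UNIV" and \<nu>: "\<forall>l. \<forall>i\<in>S l. \<nu> $ i = \<mu>\<^sub>s l"
    and w: "\<forall>l. cluster_weight S w l = p\<^sub>s l"
  shows "mixture p\<^sub>s \<mu>\<^sub>s x = gauss 0 x * tmix w \<nu> x"
proof -
  have "tmix w \<nu> x = (\<Sum>l\<in>UNIV. \<Sum>i\<in>S l. w i * tilt (\<mu>\<^sub>s l) x)"
    unfolding tmix_def sum_partition[OF part] using \<nu> by (intro sum.cong refl) auto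
  also have "\<dots> = (\<Sum>l\<in>UNIV. p\<^sub>s l * tilt (\<mu>\<^sub>s l) x)"
    using w by (simp add: cluster_weight_def flip: sum_distrib_right)
  finally show ?thesis
    unfolding mixture_def by (simp add: sum_distrib_left gauss_eq_tilt[of "\<mu>\<^sub>s _"] mult_ac)
qed

lemma weights_in_prob_simplex:
  fixes S :: "'m::finite \<Rightarrow> 'n::finite set"
  assumes "disjoint_family S" "(\<Union>l. S l) = UNIV" "p\<^sub>s \<in> prob_simplex" "\<forall>i. 0 < w i"
    and "\<forall>l. cluster_weight S w l = p\<^sub>s l"
  shows "w \<in> prob_simplex"
  using assms prob_simplexD(2)[OF assms(3)] sum_partition[OF assms(1,2), of w]
  by (auto simp: prob_simplex_def cluster_weight_def less_imp_le)

text \<open>Gibbs' inequality for every competitor, each in a family centred at its own means and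
  with an envelope radius of its own; the value 0 is attained by the reference weights.\<close>

lemma opt_loss_eq_0:
  fixes \<mu>\<^sub>s :: "'m::finite \<Rightarrow> real^'d" and \<nu> :: "real^'d^'n::finite"
  assumes mix: "\<And>x. mixture p\<^sub>s \<mu>\<^sub>s x = gauss 0 x * tmix w \<nu> x" and w: "w \<in> prob_simplex"
  shows "opt_loss TYPE('n) p\<^sub>s \<mu>\<^sub>s = 0"
proof -
  have nn: "0 \<le> loss p\<^sub>s \<mu>\<^sub>s p \<mu>" if p: "p \<in> prob_simplex" for p :: "'n \<Rightarrow> real" and \<mu>
  proof -
    define R where "R = norm \<mu> + 1 + norm \<nu>"
    interpret smooth_family gauss_measure "envelope R" "tmix p" "dtmix p" "tmix w \<nu>" \<mu>
      by (rule smooth_family_tmix[OF p w]) (simp_all add: R_def)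
    show ?thesis using loss_nonneg[of \<mu>] by (simp add: loss_def loss_eq[OF mix w])
  qed
  have "loss p\<^sub>s \<mu>\<^sub>s w \<nu> = 0"
    unfolding loss_eq[OF mix w] using tmix_pos[OF w, of \<nu>] by (simp add: less_imp_neq[THEN not_sym])
  then have "0 \<in> (\<lambda>(\<mu>, p). loss p\<^sub>s \<mu>\<^sub>s p \<mu>) ` ((UNIV :: (real^'d^'n) set) \<times> prob_simplex)"
    using w by (intro image_eqI[of _ _ "(\<nu>, w)"]) auto
  then show ?thesis
    unfolding opt_loss_def using nn by (intro cInf_eq_minimum) auto
qed

text \<open>The barycenter minimizes the weighted squared distance within a cluster, and the
  competitor is the common value of \<nu> there. This links the dispersion in tube and core to the
  distance from the minimizer.\<close>

lemma dispersion_le: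
  fixes S :: "'m::finite \<Rightarrow> 'n::finite set" and y \<nu> :: "real^'d^'n"
  assumes part: "disjoint_family S" "(\<Union>l. S l) = UNIV" "\<forall>l. S l \<noteq> {}"
    and p: "p \<in> prob_simplex" "\<forall>i. 0 < p i" and \<nu>: "\<forall>l. \<forall>i\<in>S l. \<nu> $ i = \<mu>\<^sub>s l"
  shows "dispersion S p y \<le> (norm (y - \<nu>))\<^sup>2" and "0 \<le> dispersion S p y"
proof -
  have cl: "(\<Sum>i\<in>S l. p i * (norm (y $ i - barycenter S p y l))\<^sup>2) \<le> (\<Sum>i\<in>S l. p i * (norm ((y - \<nu>) $ i))\<^sup>2)" for l
  proof -
    define P where "P = cluster_weight S p l"
    have P: "0 < P" unfolding P_def cluster_weight_def using part(3) p by (intro sum_pos) auto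
    define z where "z = (\<lambda>i. y $ i - \<mu>\<^sub>s l)"
    define d where "d = barycenter S p y l - \<mu>\<^sub>s l"
    have "(\<Sum>i\<in>S l. p i *\<^sub>R z i) = (\<Sum>i\<in>S l. p i *\<^sub>R (y $ i)) - P *\<^sub>R \<mu>\<^sub>s l"
      by (simp add: z_def P_def cluster_weight_def scaleR_diff_right sum_subtractf scaleR_sum_left)
    also have "\<dots> = P *\<^sub>R d"
      using P by (simp add: d_def barycenter_def P_def[symmetric] scaleR_diff_right)
    finally have Pd: "(\<Sum>i\<in>S l. p i *\<^sub>R z i) = P *\<^sub>R d" .
    have "(\<Sum>i\<in>S l. p i * (norm (y $ i - barycenter S p y l))\<^sup>2) = (\<Sum>i\<in>S l. p i * (z i \<bullet> z i) - 2 * ((p i *\<^sub>R z i) \<bullet> d) + p i * (d \<bullet> d))"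
    proof (rule sum.cong[OF refl])
      fix i
      have eq: "y $ i - barycenter S p y l = z i - d" by (simp add: z_def d_def)
      show "p i * (norm (y $ i - barycenter S p y l))\<^sup>2 = p i * (z i \<bullet> z i) - 2 * ((p i *\<^sub>R z i) \<bullet> d) + p i * (d \<bullet> d)"
        unfolding eq power2_norm_eq_inner by (simp add: inner_diff_left inner_diff_right inner_commute algebra_simps)
    qed
    also have "\<dots> = (\<Sum>i\<in>S l. p i * (z i \<bullet> z i)) - 2 * ((\<Sum>i\<in>S l. p i *\<^sub>R z i) \<bullet> d) + P * (d \<bullet> d)"
      by (simp add: sum.distrib sum_subtractf inner_sum_left sum_distrib_left sum_distrib_right P_def cluster_weight_def)
    also have "\<dots> = (\<Sum>i\<in>S l. p i * (z i \<bullet> z i)) - P * (d \<bullet> d)" unfolding Pd by simp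
    also have "\<dots> \<le> (\<Sum>i\<in>S l. p i * (z i \<bullet> z i))" using P by simp
    also have "\<dots> = (\<Sum>i\<in>S l. p i * (norm ((y - \<nu>) $ i))\<^sup>2)"
      using \<nu> by (intro sum.cong refl) (simp add: z_def power2_norm_eq_inner)
    finally show ?thesis .
  qed
  have "dispersion S p y \<le> (\<Sum>i\<in>UNIV. p i * (norm ((y - \<nu>) $ i))\<^sup>2)"
    unfolding dispersion_def sum_partition[OF part(1,2)] by (intro sum_mono cl)
  also have "\<dots> \<le> (\<Sum>i\<in>UNIV. p i * (norm (y - \<nu>))\<^sup>2)"
    using p by (intro sum_mono mult_left_mono power_mono Finite_Cartesian_Product.norm_nth_le) (auto simp: less_imp_le)
  also have "\<dots> = (norm (y - \<nu>))\<^sup>2" using prob_simplexD(2)[OF p(1)] by (simp flip: sum_distrib_right)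
  finally show "dispersion S p y \<le> (norm (y - \<nu>))\<^sup>2" .
  show "0 \<le> dispersion S p y"
    unfolding dispersion_def using p by (intro sum_nonneg mult_nonneg_nonneg) (auto simp: less_imp_le)
qed

text \<open>The relative change of weight is the same for all students of a cluster and equals the
  relative error of the cluster weight. The mismatch is therefore a relative error, the kind that
  positive averages preserve.\<close>

lemma reference_weights_perturb:
  fixes S :: "'m::finite \<Rightarrow> 'n::finite set"
  assumes part: "(\<Union>l. S l) = UNIV" "\<forall>l. S l \<noteq> {}" and ps: "\<forall>l. 0 < p\<^sub>s l"
    and p: "\<forall>i. 0 < p i" and w: "\<forall>i. 0 < w i" and ref: "is_reference_weights S p\<^sub>s p w"
  shows "\<bar>p i - w i\<bar> \<le> weight_mismatch S p\<^sub>s p * w i"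
proof -
  obtain l where l: "i \<in> S l" using part by blast
  let ?P = "cluster_weight S p l"
  have P: "0 < ?P" unfolding cluster_weight_def using part(2) p by (intro sum_pos) auto
  have "w i = p i * p\<^sub>s l / ?P" using ref l by (auto simp: is_reference_weights_def)
  moreover have "p\<^sub>s l \<noteq> 0" using ps by (simp add: less_imp_neq[THEN not_sym])
  ultimately have "p i - w i = w i * ((?P - p\<^sub>s l) / p\<^sub>s l)"
    using P by (simp add: field_simps)
  then have "\<bar>p i - w i\<bar> = w i * (\<bar>?P - p\<^sub>s l\<bar> / p\<^sub>s l)"
    using w ps by (simp add: abs_mult less_imp_le)
  also have "\<bar>?P - p\<^sub>s l\<bar> / p\<^sub>s l \<le> weight_mismatch S p\<^sub>s p"
    unfolding weight_mismatch_def by (rule Max_ge) auto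
  then have "w i * (\<bar>?P - p\<^sub>s l\<bar> / p\<^sub>s l) \<le> w i * weight_mismatch S p\<^sub>s p"
    using w by (intro mult_left_mono) (auto simp: less_imp_le)
  finally show ?thesis by (simp add: mult.commute)
qed

lemma weighted_sum_perturb:
  fixes p w a :: "'n::finite \<Rightarrow> real"
  assumes "\<And>i. \<bar>p i - w i\<bar> \<le> \<delta> * w i" and w: "w \<in> prob_simplex" and "0 \<le> \<delta>" and a: "\<And>i. \<bar>a i\<bar> \<le> b"
  shows "\<bar>(\<Sum>i\<in>UNIV. p i * a i) - (\<Sum>i\<in>UNIV. w i * a i)\<bar> \<le> \<delta> * b"
proof -
  have "(\<Sum>i\<in>UNIV. p i * a i) - (\<Sum>i\<in>UNIV. w i * a i) = (\<Sum>i\<in>UNIV. (p i - w i) * a i)"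
    by (simp add: left_diff_distrib sum_subtractf)
  also have "\<bar>\<dots>\<bar> \<le> (\<Sum>i\<in>UNIV. \<bar>(p i - w i) * a i\<bar>)" by (rule sum_abs)
  also have "\<dots> \<le> (\<Sum>i\<in>UNIV. (\<delta> * w i) * b)"
    unfolding abs_mult using assms prob_simplexD(1)[OF w] by (intro sum_mono mult_mono) auto
  also have "\<dots> = \<delta> * b"
    using prob_simplexD(2)[OF w] by (simp flip: sum_distrib_right sum_distrib_left)
  finally show ?thesis .
qed

text \<open>The reference weights \<open>w\<close> are fixed and the actual weights \<open>p\<close>
  range over those having \<open>w\<close> as reference, so all constants are chosen before
  \<open>p\<close>. Exclusiveness of the alternatives is expressed by placing the negation of the
  first into the second; the contraction itself is established for every point of the annulus near
  the minimizer, and the split is on membership in the core.\<close>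

theorem theoremD8:
  fixes p\<^sub>s :: "'m::finite \<Rightarrow> real"
    and \<mu>\<^sub>s :: "'m \<Rightarrow> real^'d::finite"
    and S :: "'m \<Rightarrow> 'n::finite set"
    and w :: "'n \<Rightarrow> real"
    and \<mu>\<^sub>t :: "real^'d^'n"
    and M U :: "(real^'d^'n) set"
    and D_max D_min lam_max lam_min p_min C\<^sub>0 q :: real
  assumes teacher: "p\<^sub>s \<in> prob_simplex" "\<forall>l. 0 < p\<^sub>s l"
    and A1: "num_nonzero_eigenvalues (second_moment p\<^sub>s \<mu>\<^sub>s) = CARD('m)"
      "lam_max = Max (nonzero_eigenvalues (second_moment p\<^sub>s \<mu>\<^sub>s))"
      "lam_min = Min (nonzero_eigenvalues (second_moment p\<^sub>s \<mu>\<^sub>s))"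
      "0 < lam_min"
    and A2: "\<forall>l. norm (\<mu>\<^sub>s l) \<le> D_max" "\<forall>l. D_min \<le> norm (\<mu>\<^sub>s l)"
      "4 * (lam_max / lam_min) * sqrt (real CARD('d) * real CARD('n)) \<le> D_min"
    and p_min: "p_min = (MIN l. p\<^sub>s l)"
    and C0: "0 < C\<^sub>0"
    and A3: "\<forall>i j. i \<noteq> j \<longrightarrow>
      C\<^sub>0 * Max {sqrt D_max * (real CARD('d) * real CARD('n)) powr (1 / 4),
                sqrt (real CARD('d) / p_min),
                sqrt (ln (D_max * real CARD('d) * real CARD('n) * real CARD('m) / (lam_min * p_min)))}
        \<le> norm (\<mu>\<^sub>s i - \<mu>\<^sub>s j)"
    and partition: "\<forall>l. S l \<noteq> {}" "disjoint_family S" "(\<Union>l. S l) = UNIV"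
    and mu_tilde: "\<forall>l. \<forall>i\<in>S l. \<mu>\<^sub>t $ i = \<mu>\<^sub>s l"
    and reference: "\<forall>i. 0 < w i" "\<forall>l. cluster_weight S w l = p\<^sub>s l"
    and ravine: "morse_ravine (loss p\<^sub>s \<mu>\<^sub>s w) \<mu>\<^sub>t M"
    and U: "open U" "\<mu>\<^sub>t \<in> U"
    and projection: "\<forall>\<mu>\<in>U. \<exists>!y. y \<in> M \<and> (\<forall>z\<in>M. dist \<mu> y \<le> dist \<mu> z)"
      "smooth_on U (closest_point M)"
    and q: "0 < q" "q < 1"
      "\<forall>\<mu>\<in>U.
         norm (grad (\<lambda>\<nu>. loss p\<^sub>s \<mu>\<^sub>s w \<nu> - loss p\<^sub>s \<mu>\<^sub>s w (closest_point M \<nu>)) \<mu>)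
           \<le> 1 / 100 * norm (grad (\<lambda>\<nu>. loss p\<^sub>s \<mu>\<^sub>s w (closest_point M \<nu>)) (closest_point M \<mu>)) \<longrightarrow>
         norm (closest_point M (polyak_step (loss p\<^sub>s \<mu>\<^sub>s w) 0 \<mu>) - \<mu>\<^sub>t)
           \<le> q * norm (closest_point M \<mu> - \<mu>\<^sub>t)"
  shows "\<exists>r>0. \<forall>V. open V \<and> \<mu>\<^sub>t \<in> V \<and> V \<subseteq> U \<inter> ball \<mu>\<^sub>t r \<longrightarrow>
    (\<exists>\<tau>\<^sub>0>0. \<forall>\<tau>. 0 < \<tau> \<and> \<tau> \<le> \<tau>\<^sub>0 \<longrightarrow>
      (\<exists>W C \<kappa>\<^sub>0. open W \<and> \<mu>\<^sub>t \<in> W \<and> W \<subseteq> V \<and> 0 < C \<and> 1 \<le> \<kappa>\<^sub>0 \<and>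
        (\<forall>\<kappa>\<ge>\<kappa>\<^sub>0. q + C / \<kappa> < 1) \<and>
        (\<exists>\<delta>>0. \<forall>p. p \<in> prob_simplex \<and> (\<forall>i. 0 < p i) \<and> is_reference_weights S p\<^sub>s p w \<and>
            weight_mismatch S p\<^sub>s p \<le> \<delta> \<longrightarrow>
          (\<forall>\<kappa>\<ge>\<kappa>\<^sub>0. \<forall>\<mu> \<in> W \<inter> annulus U M S p\<^sub>s p \<tau> \<kappa>.
            let \<mu>\<^sub>p = polyak_step (loss p\<^sub>s \<mu>\<^sub>s p) (opt_loss TYPE('n) p\<^sub>s \<mu>\<^sub>s) \<mu> in
            \<mu>\<^sub>p \<in> core U M S p\<^sub>s p \<kappa> \<or>
            (\<mu>\<^sub>p \<notin> core U M S p\<^sub>s p \<kappa> \<and> \<mu>\<^sub>p \<in> U \<and>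
             norm (closest_point M \<mu>\<^sub>p - \<mu>\<^sub>t) \<le> (q + C / \<kappa>) * norm (closest_point M \<mu> - \<mu>\<^sub>t))))))"
proof -
  let ?f = "loss p\<^sub>s \<mu>\<^sub>s w"
  have inj: "inj \<mu>\<^sub>s"
  proof (rule injI, rule ccontr)
    fix i j assume eq: "\<mu>\<^sub>s i = \<mu>\<^sub>s j" and ne: "i \<noteq> j"
    have "0 < p_min" unfolding p_min using teacher(2) by (subst Min_gr_iff) auto
    let ?s = "sqrt (real CARD('d) / p_min)"
    let ?A = "{sqrt D_max * (real CARD('d) * real CARD('n)) powr (1 / 4), ?s,
                sqrt (ln (D_max * real CARD('d) * real CARD('n) * real CARD('m) / (lam_min * p_min)))}"
    \<comment> \<open>The entry containing \<open>p_min\<close> is positive whatever the other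
      entries are, so the required separation is positive and distinct indices have distinct
      means.\<close>
    have "0 < ?s" using \<open>0 < p_min\<close> by simp
    also have "?s \<le> Max ?A" by (rule Max_ge) simp_all
    finally have "0 < C\<^sub>0 * Max ?A" using C0 by simp
    moreover have "C\<^sub>0 * Max ?A \<le> norm (\<mu>\<^sub>s i - \<mu>\<^sub>s j)" using A3 ne by blast
    ultimately show False by (simp add: eq)
  qed
  note part = partition(2,3)
  have w: "w \<in> prob_simplex"
    by (rule weights_in_prob_simplex[OF part teacher(1) reference])
  note mix = mixture_eq_students[OF part mu_tilde reference(2)]
  define R where "R = norm \<mu>\<^sub>t + 1"
  interpret dg: degenerate_family gauss_measure "envelope R" "tmix w" "dtmix w" "tmix w \<mu>\<^sub>t" \<mu>\<^sub>t "ddtmix w \<mu>\<^sub>t"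
    by (rule degenerate_family_tmix[OF w reference(1) R_def inj part mu_tilde])
  have f: "?f = dg.loss"
    by (rule ext) (simp add: dg.loss_def loss_eq[OF mix w])
  have grad: "grad ?f x = dg.gradient x" if "x \<in> ball \<mu>\<^sub>t 1" for x
    unfolding f by (rule grad_eq[OF dg.GDERIV_loss[OF that]])
  have "(grad ?f has_derivative dg.hess) (at \<mu>\<^sub>t)"
    by (rule has_derivative_transform_within_open[OF dg.gradient_has_derivative open_ball[of \<mu>\<^sub>t 1]])
      (auto simp: grad)
  then have hess: "hessian ?f \<mu>\<^sub>t = dg.hess"
    unfolding hessian_def by (rule frechet_derivative_at[symmetric])
  define K where "K = {v. dg.hess v = 0}"
  have "subspace K" unfolding K_def by (rule linear_subspace_kernel[OF dg.linear_hess])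
  from ravine[unfolded morse_ravine_def hess] obtain N where
    N: "M = {x \<in> N. orth_proj (range dg.hess) (grad ?f x) = 0}" "\<mu>\<^sub>t \<in> M"
      "tangent_space M \<mu>\<^sub>t = {v. dg.hess v = 0}"
    by (elim exE conjE) (rule that)
  note NK = N(3)[folded K_def]
  interpret smooth_projection M U \<mu>\<^sub>t K
    by (rule smooth_projection.intro[OF U N(2) projection NK \<open>subspace K\<close>])
  have gradient_K: "dg.gradient y \<in> K" if y: "y \<in> M" "y \<in> ball \<mu>\<^sub>t 1" for y
  proof -
    have "orth_proj (range dg.hess) (grad ?f y) = 0" using y(1) by (subst (asm) N(1)) simp
    then have "orth_proj (range dg.hess) (dg.gradient y) = 0" unfolding grad[OF y(2)] .
    then have "dg.gradient y \<bullet> dg.hess v = 0" for v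
      by (rule orth_proj_eq_0D[OF linear_subspace_image[OF dg.linear_hess subspace_UNIV]]) simp
    \<comment> \<open>The gradient is orthogonal to the range of the symmetric map
      \<open>dg.hess\<close>; testing against the image of \<open>dg.hess (dg.gradient y)\<close>
      shows that it lies in the kernel.\<close>
    from this[of "dg.hess (dg.gradient y)"]
    have "dg.hess (dg.gradient y) \<bullet> dg.hess (dg.gradient y) = 0" by (simp only: dg.hess_sym)
    then show ?thesis unfolding K_def by simp
  qed
  have lip: "norm (dg.gradient x - dg.gradient y) \<le> (2 * dg.moment 5) * norm (x - y)"
    if "x \<in> ball \<mu>\<^sub>t 1" "y \<in> ball \<mu>\<^sub>t 1" for x y
    using dg.gradient_lipschitz[OF that(2,1)] by (simp add: mult.commute)
  have bounds: "\<exists>c>0. \<exists>\<rho>>0. \<exists>N\<ge>0. \<forall>v e. v \<in> K \<longrightarrow> norm e \<le> C * (norm (v + e))\<^sup>2 \<longrightarrow>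
      norm (v + e) \<le> \<rho> \<longrightarrow> c * norm (v + e) ^ 3 \<le> norm (dg.gradient (\<mu>\<^sub>t + (v + e))) \<and>
        (\<forall>u. norm u \<le> (norm (v + e))\<^sup>2 \<longrightarrow> ?f (\<mu>\<^sub>t + (v + e) + u) \<le> N * norm (v + e) ^ 4)"
    if C: "0 \<le> C" for C
  proof -
    obtain c \<rho> N' where *: "0 < c" "0 < \<rho>" "\<rho> \<le> 1 / 2" "0 \<le> N'"
      and **: "\<And>v e. (\<forall>x. dtmix w \<mu>\<^sub>t v x = 0) \<Longrightarrow> norm e \<le> C * (norm (v + e))\<^sup>2 \<Longrightarrow> norm (v + e) \<le> \<rho> \<Longrightarrow>
        c * norm (v + e) ^ 3 \<le> norm (dg.gradient (\<mu>\<^sub>t + (v + e)))"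
        "\<And>v e u. (\<forall>x. dtmix w \<mu>\<^sub>t v x = 0) \<Longrightarrow> norm e \<le> C * (norm (v + e))\<^sup>2 \<Longrightarrow> norm (v + e) \<le> \<rho> \<Longrightarrow>
        norm u \<le> (norm (v + e))\<^sup>2 \<Longrightarrow> dg.loss (\<mu>\<^sub>t + (v + e) + u) \<le> N' * norm (v + e) ^ 4"
      by (rule dg.degenerate_bounds[OF C]) (rule that)
    have D0: "\<forall>x. dtmix w \<mu>\<^sub>t v x = 0" if "v \<in> K" for v using that dg.hess_kernel by (simp add: K_def)
    have "\<forall>v e. v \<in> K \<longrightarrow> norm e \<le> C * (norm (v + e))\<^sup>2 \<longrightarrow> norm (v + e) \<le> \<rho> \<longrightarrow>
        c * norm (v + e) ^ 3 \<le> norm (dg.gradient (\<mu>\<^sub>t + (v + e))) \<and>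
        (\<forall>u. norm u \<le> (norm (v + e))\<^sup>2 \<longrightarrow> ?f (\<mu>\<^sub>t + (v + e) + u) \<le> N' * norm (v + e) ^ 4)"
      unfolding f by (intro allI impI conjI **(1,2)[OF D0])
    then show ?thesis
      by (intro exI[of _ c] exI[of _ \<rho>] exI[of _ N'] conjI *(1,2,4))
  qed
  have f_deriv: "GDERIV ?f x :> dg.gradient x" and f_nonneg: "0 \<le> ?f x" if "x \<in> ball \<mu>\<^sub>t 1" for x
    unfolding f by (rule dg.GDERIV_loss[OF that], rule dg.loss_nonneg[OF that])
  obtain \<rho> \<tau> \<eta> B where c: "0 < \<rho>" "0 < \<tau>" "0 < \<eta>" "0 < B" "\<rho> \<le> 1 / 2" "ball \<mu>\<^sub>t \<rho> \<subseteq> U"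
    and P_half: "\<And>x. x \<in> ball \<mu>\<^sub>t \<rho> \<Longrightarrow> norm (P x - \<mu>\<^sub>t) \<le> 1 / 2"
    and stable: "\<And>x a u \<epsilon>. x \<in> ball \<mu>\<^sub>t \<rho> \<Longrightarrow> P x \<noteq> \<mu>\<^sub>t \<Longrightarrow> dist x (P x) \<le> \<tau> * norm (P x - \<mu>\<^sub>t) ^ 3 \<Longrightarrow>
        0 \<le> \<epsilon> \<Longrightarrow> \<epsilon> \<le> \<eta> \<Longrightarrow> \<bar>a - ?f x\<bar> \<le> \<epsilon> * norm (P x - \<mu>\<^sub>t) ^ 4 \<Longrightarrow>
        norm (u - dg.gradient x) \<le> \<epsilon> * norm (P x - \<mu>\<^sub>t) ^ 3 \<Longrightarrow>
        x - (a / (norm u)\<^sup>2) *\<^sub>R u \<in> U \<and>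
        norm (P (x - (a / (norm u)\<^sup>2) *\<^sub>R u) - \<mu>\<^sub>t) \<le> (q + B * \<epsilon>) * norm (P x - \<mu>\<^sub>t)"
    by (rule polyak_step_stable[OF f_deriv f_nonneg lip gradient_K bounds q(3)]) (assumption | rule that)+
  \<comment> \<open>Collects the constants of both perturbation estimates, so that m / \<kappa> is
    an admissible relative error for gradient and loss alike.\<close>
  define m where "m = dg.moment 3 + (2 * dg.moment 5) * (\<tau> + 1) + 1"
  have m: "1 \<le> m" "2 * dg.moment 5 \<le> m" "dg.moment 3 + (2 * dg.moment 5) * (\<tau> + 1) \<le> m"
    unfolding m_def using dg.moment_nonneg[of 3] dg.moment_nonneg[of 5] c(2)
    by (auto simp: algebra_simps)
  define C where "C = B * m"
  have C: "0 < C" using c m by (simp add: C_def)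
  define \<kappa>\<^sub>0 where "\<kappa>\<^sub>0 = max 1 (max (m / \<eta>) (C / (1 - q) + 1))"
  \<comment> \<open>The middle entry of the maximum keeps the relative error within the range of the
    stability lemma; the last makes C / \<kappa> smaller than 1 - q, strictly because of its summand
    1.\<close>
  have \<kappa>0: "1 \<le> \<kappa>" "m / \<kappa> \<le> \<eta>" "q + C / \<kappa> < 1" if "\<kappa>\<^sub>0 \<le> \<kappa>" for \<kappa>
  proof -
    have "1 \<le> \<kappa>" "m / \<eta> \<le> \<kappa>" "C / (1 - q) + 1 \<le> \<kappa>" using that unfolding \<kappa>\<^sub>0_def by linarith+
    then show "1 \<le> \<kappa>" "m / \<kappa> \<le> \<eta>" "q + C / \<kappa> < 1"
      using c(3) q(2) by (auto simp: field_simps)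
  qed
  have main: "polyak_step (loss p\<^sub>s \<mu>\<^sub>s p) (opt_loss TYPE('n) p\<^sub>s \<mu>\<^sub>s) \<mu> \<in> U \<and>
      norm (P (polyak_step (loss p\<^sub>s \<mu>\<^sub>s p) (opt_loss TYPE('n) p\<^sub>s \<mu>\<^sub>s) \<mu>) - \<mu>\<^sub>t)
        \<le> (q + C / \<kappa>) * norm (P \<mu> - \<mu>\<^sub>t)"
    if p: "p \<in> prob_simplex" "\<forall>i. 0 < p i" "is_reference_weights S p\<^sub>s p w"
      and \<kappa>: "\<kappa>\<^sub>0 \<le> \<kappa>" and \<mu>: "\<mu> \<in> ball \<mu>\<^sub>t \<rho>" "\<mu> \<in> annulus U M S p\<^sub>s p \<tau>' \<kappa>"
      and \<tau>': "0 < \<tau>'" "\<tau>' \<le> \<tau>"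
    for p \<kappa> \<mu> \<tau>'
  proof -
    define \<Delta> where "\<Delta> = weight_mismatch S p\<^sub>s p"
    define r where "r = norm (P \<mu> - \<mu>\<^sub>t)"
    define Q where "Q = dispersion S p (P \<mu>)"
    note k = \<kappa>0[OF \<kappa>]
    have \<mu>1: "\<mu> \<in> ball \<mu>\<^sub>t 1" and \<mu>U: "\<mu> \<in> U" using \<mu>(1) c by auto
    have tube: "infdist \<mu> M \<le> \<tau>' * Q powr (3 / 2)" and core: "\<kappa> * \<Delta> powr (2 / 3) < Q"
      using \<mu>(2) \<mu>U by (auto simp: annulus_def tube_def core_def Q_def \<Delta>_def)
    have pert: "\<bar>p i - w i\<bar> \<le> \<Delta> * w i" for i
      unfolding \<Delta>_def by (rule reference_weights_perturb[OF partition(3,1) teacher(2) p(2) reference(1) p(3)])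
    have \<Delta>0: "0 \<le> \<Delta>"
    proof -
      have "0 \<le> \<Delta> * w undefined" using pert[of undefined] by linarith
      then show ?thesis using reference(1) by (simp add: zero_le_mult_iff) (metis less_irrefl not_less)
    qed
    have Q: "Q \<le> r\<^sup>2"
      unfolding Q_def r_def by (rule dispersion_le(1)[OF part partition(1) p(1,2) mu_tilde])
    have "0 \<le> \<kappa> * \<Delta> powr (2 / 3)" using k(1) by simp
    then have Qpos: "0 < Q" using core by linarith
    have r: "0 < r"
    proof (rule ccontr)
      assume "\<not> 0 < r"
      then have "r = 0" by (simp add: r_def)
      then show False using Q Qpos by simp
    qed
    have r2: "r \<le> 1 / 2" unfolding r_def by (rule P_half[OF \<mu>(1)])
    have Q32: "Q powr (3 / 2) \<le> r ^ 3"
    proof -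
      have "Q powr (3 / 2) \<le> (r\<^sup>2) powr (3 / 2)" using Q Qpos by (intro powr_mono2) auto
      also have "(r\<^sup>2) powr (3 / 2) = r ^ 3"
      proof -
        have "r\<^sup>2 = r powr 2" "r ^ 3 = r powr 3" using r by (simp_all add: powr_numeral)
        then show ?thesis by (simp add: powr_powr)
      qed
      finally show ?thesis .
    qed
    \<comment> \<open>The inequality defining the complement of the core is raised to the power 3/2;
      as \<kappa> is at least 1, its power 3/2 is at least \<kappa>.\<close>
    have "\<kappa> * \<Delta> \<le> (\<kappa> * \<Delta> powr (2 / 3)) powr (3 / 2)"
    proof (cases "\<Delta> = 0")
      case False
      have "(\<kappa> * \<Delta> powr (2 / 3)) powr (3 / 2) = \<kappa> powr (3 / 2) * \<Delta>"
        using k(1) \<Delta>0 False by (simp add: powr_mult powr_powr)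
      moreover have "\<kappa> powr 1 \<le> \<kappa> powr (3 / 2)" using k(1) by (intro powr_mono) auto
      ultimately show ?thesis using k(1) \<Delta>0 by (simp add: mult_right_mono)
    qed simp
    also have "\<dots> \<le> Q powr (3 / 2)" using core k(1) by (intro powr_mono2) auto
    finally have \<Delta>r: "\<Delta> \<le> r ^ 3 / \<kappa>" using Q32 k(1) by (simp add: field_simps)
    have "dist \<mu> (P \<mu>) \<le> infdist \<mu> M"
      using P_le[OF \<mu>U] N(2) by (subst infdist_notempty) (auto intro: cINF_greatest)
    also note tube
    also have "\<tau>' * Q powr (3 / 2) \<le> \<tau> * r ^ 3" using \<tau>' Q32 by (intro mult_mono) auto
    finally have near: "dist \<mu> (P \<mu>) \<le> \<tau> * r ^ 3" .
    have r31: "r ^ 3 \<le> r" using r r2 power_decreasing[of 1 3 r] by simp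
    have \<mu>r: "norm (\<mu> - \<mu>\<^sub>t) \<le> (\<tau> + 1) * r"
    proof -
      have "norm (\<mu> - \<mu>\<^sub>t) \<le> dist \<mu> (P \<mu>) + r"
        using norm_triangle_ineq[of "\<mu> - P \<mu>" "P \<mu> - \<mu>\<^sub>t"] by (simp add: dist_norm r_def)
      also have "\<tau> * r ^ 3 \<le> \<tau> * r" using r31 c by (intro mult_left_mono) auto
      then have "dist \<mu> (P \<mu>) + r \<le> (\<tau> + 1) * r" using near by (simp add: algebra_simps)
      finally show ?thesis .
    qed
    \<comment> \<open>Envelope, target and base point agree with those of the reference family, so
      the two families are comparable with the moments of the latter.\<close>
    interpret o: smooth_family gauss_measure "envelope R" "tmix p" "dtmix p" "tmix w \<mu>\<^sub>t" \<mu>\<^sub>t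
      by (rule smooth_family_tmix[OF p(1) w]) (simp_all add: R_def)
    have g: "loss p\<^sub>s \<mu>\<^sub>s p = o.loss"
      by (rule ext) (simp add: o.loss_def loss_eq[OF mix w])
    have nR: "norm (\<nu> $ i) \<le> R" if "\<nu> \<in> ball \<mu>\<^sub>t 1" for \<nu> i
    proof -
      have "norm \<nu> \<le> R" using that norm_triangle_ineq4[of \<mu>\<^sub>t "\<mu>\<^sub>t - \<nu>"] by (simp add: dist_norm R_def)
      then show ?thesis using Finite_Cartesian_Product.norm_nth_le[of \<nu> i] by linarith
    qed
    have ps: "\<bar>tmix p \<nu> x - tmix w \<nu> x\<bar> \<le> \<Delta> * envelope R x" if "\<nu> \<in> ball \<mu>\<^sub>t 1" for \<nu> x
      unfolding tmix_def
      by (rule weighted_sum_perturb[OF pert w \<Delta>0 tilt_taylor(1)[where v = 0]]) (use nR[OF that] in simp_all)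
    have pD: "\<bar>dtmix p \<nu> \<xi> x - dtmix w \<nu> \<xi> x\<bar> \<le> \<Delta> * norm \<xi> * envelope R x" if "\<nu> \<in> ball \<mu>\<^sub>t 1" for \<nu> \<xi> x
      unfolding dtmix_def mult.assoc
      by (rule weighted_sum_perturb[OF pert w \<Delta>0 envelope_scale[OF tilt_taylor(2)[where v = 0]
            Finite_Cartesian_Product.norm_nth_le]]) (use nR[OF that] in simp_all)
    note other = o.smooth_family_axioms
    have dG: "norm (o.gradient \<mu> - dg.gradient \<mu>) \<le> m / \<kappa> * r ^ 3"
    proof -
      have "norm (o.gradient \<mu> - dg.gradient \<mu>) \<le> \<Delta> * (2 * dg.moment 5)"
        by (rule dg.gradient_perturb[OF other \<mu>1 \<mu>1 ps[OF \<mu>1] pD[OF \<mu>1]])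
      also have "\<dots> \<le> (r ^ 3 / \<kappa>) * m"
        using \<Delta>r m(2) \<Delta>0 dg.moment_nonneg[of 5] r k(1) by (intro mult_mono) auto
      finally show ?thesis by (simp add: mult.commute)
    qed
    have dF: "\<bar>loss p\<^sub>s \<mu>\<^sub>s p \<mu> - ?f \<mu>\<bar> \<le> m / \<kappa> * r ^ 4"
    proof -
      have r4: "r ^ 4 = r ^ 3 * r" by (simp add: eval_nat_numeral)
      have "\<bar>o.loss \<mu> - dg.loss \<mu>\<bar> \<le> \<Delta>\<^sup>2 * dg.moment 3 + \<Delta> * (2 * dg.moment 5) * norm (\<mu> - \<mu>\<^sub>t)"
        by (rule dg.loss_perturb[OF other ps pD refl \<mu>1])
      also have "\<Delta>\<^sup>2 * dg.moment 3 \<le> (r ^ 4 / \<kappa>) * dg.moment 3"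
      proof (rule mult_right_mono)
        \<comment> \<open>One factor \<Delta> supplies r^3 / \<kappa>; for the other the crude bound
          r is enough to reach order r^4 / \<kappa>.\<close>
        have "r ^ 3 / \<kappa> \<le> r"
          using r31 r k(1) by (simp add: divide_le_eq) (smt (verit) mult_left_le mult_less_cancel_left2)
        then have "\<Delta> * \<Delta> \<le> (r ^ 3 / \<kappa>) * r" using \<Delta>r \<Delta>0 r by (intro mult_mono) auto
        then show "\<Delta>\<^sup>2 \<le> r ^ 4 / \<kappa>" by (simp add: eval_nat_numeral mult_ac)
      qed (rule dg.moment_nonneg)
      also have "\<Delta> * (2 * dg.moment 5) * norm (\<mu> - \<mu>\<^sub>t) \<le> (r ^ 3 / \<kappa>) * (2 * dg.moment 5) * ((\<tau> + 1) * r)"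
        using \<Delta>r \<mu>r \<Delta>0 dg.moment_nonneg[of 5] r k(1) by (intro mult_mono) auto
      finally have "\<bar>o.loss \<mu> - dg.loss \<mu>\<bar> \<le> (r ^ 4 / \<kappa>) * (dg.moment 3 + (2 * dg.moment 5) * (\<tau> + 1))"
        unfolding r4 by (simp add: algebra_simps add_divide_distrib)
      also have "\<dots> \<le> (r ^ 4 / \<kappa>) * m" using m(3) k(1) by (intro mult_left_mono) auto
      finally show ?thesis by (simp add: f g mult.commute)
    qed
    have "polyak_step (loss p\<^sub>s \<mu>\<^sub>s p) (opt_loss TYPE('n) p\<^sub>s \<mu>\<^sub>s) \<mu>
        = \<mu> - (loss p\<^sub>s \<mu>\<^sub>s p \<mu> / (norm (o.gradient \<mu>))\<^sup>2) *\<^sub>R o.gradient \<mu>"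
      using grad_eq[OF o.GDERIV_loss[OF \<mu>1]] opt_loss_eq_0[OF mix w] by (simp add: polyak_step_def g)
    moreover have "P \<mu> \<noteq> \<mu>\<^sub>t" using r by (auto simp: r_def)
    moreover have "0 \<le> m / \<kappa>" using m k by simp
    ultimately show ?thesis
      using stable[OF \<mu>(1) _ near[unfolded r_def] _ k(2) dF[unfolded r_def] dG[unfolded r_def]]
      by (simp add: C_def)
  qed
  show ?thesis
  proof (rule exI[of _ \<rho>], intro conjI allI impI, goal_cases)
    case 1
    show ?case by fact
  next
    case (2 V)
    note V = this
    show ?case
    proof (rule exI[of _ \<tau>], intro conjI allI impI, goal_cases)
      case 1
      show ?case by fact
    next
      case (2 \<tau>')
      note \<tau>' = this
      show ?case
      proof (rule exI[of _ V], rule exI[of _ C], rule exI[of _ \<kappa>\<^sub>0], intro conjI, goal_cases)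
        case 5
        show ?case by (simp add: \<kappa>\<^sub>0_def)
      next
        case 6
        show ?case using \<kappa>0(3) by blast
      next
        case 7
        \<comment> \<open>The witness for the mismatch threshold is 1: the smallness of \<Delta>
          that the estimates use is the bound r^3 / \<kappa> valid on the annulus.\<close>
        show ?case
        proof (rule exI[of _ 1], rule conjI[OF zero_less_one], intro allI impI ballI, goal_cases)
          case (1 p \<kappa> \<mu>)
          then have \<mu>: "\<mu> \<in> ball \<mu>\<^sub>t \<rho>" "\<mu> \<in> annulus U M S p\<^sub>s p \<tau>' \<kappa>" using V by auto
          show ?case
            using main[OF _ _ _ 1(2) \<mu>] 1(1) \<tau>' unfolding Let_def by blast
        qed
      qed (use V C in auto)
    qed
  qed
qed

end
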